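(* Let $A:\mathbb{R}^N\to\mathbb{R}^N$ be Lipschitz and let $u\in H^1_A(\mathbb{R}^N)$. Then $$\lim_{\delta\searrow0}J_\delta(u,x)=Q_N|\nabla u(x)-\mathrm{i}A(x)u(x)|^2\quad\text{for a.e. }x\in\mathbb{R}^N$$ and $$\lim_{\delta\searrow0}J_\delta(u,\cdot)=Q_N|\nabla u(\cdot)-\mathrm{i}A(\cdot)u(\cdot)|^2\quad\text{in }L^1(\mathbb{R}^N).$$
   Context: $N\ge1$ is an integer, $\mathrm{i}$ is the imaginary unit, $|\cdot|$ is the Euclidean norm, and functions $u$ are complex-valued. $H^1_A(\mathbb{R}^N)$ is the space of complex-valued $u\in L^2(\mathbb{R}^N)$ such that $\int_{\mathbb{R}^N}|\nabla u-\mathrm{i}A(x)u|^2dx<\infty$ (weak gradient). For measurable $u:\mathbb{R}^N\to\mathbb{C}$, $\Psi_u(x,y):=e^{\mathrm{i}(x-y)\cdot A\left(\frac{x+y}{2}\right)}u(y)$ for $x,y\in\mathbb{R}^N$ (so $\Psi_u(x,x)=u(x)$). For $u\in L^1_{\mathrm{loc}}(\mathbb{R}^N)$, $\delta>0$ and $x\in\mathbb{R}^N$, $$J_\delta(u,x):=\int_{\{y\in\mathbb{R}^N:\,|\Psi_u(x,y)-\Psi_u(x,x)|>\delta\}}\frac{\delta^2}{|x-y|^{N+2}}\,dy.$$ $Q_N:=\frac12\int_{\mathbb{S}^{N-1}}|\boldsymbol{\omega}\cdot\sigma|^2d\sigma$, where $\mathbb{S}^{N-1}$ is the unit sphere of $\mathbb{R}^N$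 and $\boldsymbol{\omega}$ is an arbitrary unit vector of $\mathbb{R}^N$ (the value does not depend on $\boldsymbol{\omega}$). *)

theory Defs
  imports "HOL-Analysis.Analysis"
begin

definition locally_integrable :: "(real^'n \<Rightarrow> complex) \<Rightarrow> bool" where
  "locally_integrable f \<longleftrightarrow> (\<forall>K. compact K \<longrightarrow> set_integrable lebesgue K f)"

definition partial_deriv :: "'n \<Rightarrow> (real^'n \<Rightarrow> real) \<Rightarrow> real^'n \<Rightarrow> real" where
  "partial_deriv j f x = frechet_derivative f (at x) (axis j 1)"

primrec C_k :: "nat \<Rightarrow> (real^'n \<Rightarrow> real) \<Rightarrow> bool" where
  "C_k 0 f \<longleftrightarrow> continuous_on UNIV f"
| "C_k (Suc k) f \<longleftrightarrow> f differentiable_on UNIV \<and> (\<forall>j. C_k k (partial_deriv j f))"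

definition test_function :: "(real^'n \<Rightarrow> real) \<Rightarrow> bool" where
  "test_function \<phi> \<longleftrightarrow> (\<forall>k. C_k k \<phi>) \<and> compact (closure {x. \<phi> x \<noteq> 0})"

definition weak_gradient :: "(real^'n \<Rightarrow> complex) \<Rightarrow> (real^'n \<Rightarrow> complex^'n) \<Rightarrow> bool" where
  "weak_gradient u g \<longleftrightarrow>
     locally_integrable u \<and>
     (\<forall>j. locally_integrable (\<lambda>x. g x $ j)) \<and>
     (\<forall>\<phi> j. test_function \<phi> \<longrightarrow>
        (\<integral>x. partial_deriv j \<phi> x *\<^sub>R u x \<partial>lebesgue) = - (\<integral>x. \<phi> x *\<^sub>R (g x $ j) \<partial>lebesgue))"

text \<open>The magnetic gradient $\nabla u - \mathrm{i} A u$ when $g$ is (a representative of) $\nabla u$;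
  the norm of \<^typ>\<open>complex^'n\<close> is the Euclidean one.\<close>

definition magnetic_grad ::
  "(real^'n \<Rightarrow> real^'n) \<Rightarrow> (real^'n \<Rightarrow> complex) \<Rightarrow> (real^'n \<Rightarrow> complex^'n) \<Rightarrow> real^'n \<Rightarrow> complex^'n" where
  "magnetic_grad A u g x = (\<chi> j. g x $ j - \<i> * complex_of_real (A x $ j) * u x)"

text \<open>Elements of $H^1_A$ are individual functions here, not classes modulo null sets.\<close>

definition H1A :: "(real^'n \<Rightarrow> real^'n) \<Rightarrow> (real^'n \<Rightarrow> complex) set" where
  "H1A A = {u. u \<in> borel_measurable lebesgue \<and>
               integrable lebesgue (\<lambda>x. (norm (u x))\<^sup>2) \<and>
               (\<exists>g. weak_gradient u g \<and>
                    integrable lebesgue (\<lambda>x. (norm (magnetic_grad A u g x))\<^sup>2))}"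

definition Psi ::
  "(real^'n \<Rightarrow> real^'n) \<Rightarrow> (real^'n \<Rightarrow> complex) \<Rightarrow> real^'n \<Rightarrow> real^'n \<Rightarrow> complex" where
  "Psi A u x y = exp (\<i> * complex_of_real ((x - y) \<bullet> A ((1/2) *\<^sub>R (x + y)))) * u y"

text \<open>The integrand is nonnegative, so the integral is taken with values in $[0,\infty]$.\<close>

definition J ::
  "(real^'n \<Rightarrow> real^'n) \<Rightarrow> real \<Rightarrow> (real^'n \<Rightarrow> complex) \<Rightarrow> real^'n \<Rightarrow> ennreal" where
  "J A \<delta> u x =
     (\<integral>\<^sup>+y\<in>{y. norm (Psi A u x y - Psi A u x x) > \<delta>}.
        ennreal (\<delta>\<^sup>2 / norm (x - y) ^ (CARD('n) + 2)) \<partial>lebesgue)"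

text \<open>Surface measure on the unit sphere, by the usual polar-coordinates (cone) definition:
  the measure of $E$ is $N$ times the Lebesgue measure of
  $\{r\omega : 0 < r < 1,\ \omega \in E\}$. For $N = 1$ this is the counting measure on
  $\{-1, 1\}$.\<close>

definition sphere_measure :: "(real^'n) measure" where
  "sphere_measure =
     distr (scale_measure (of_nat CARD('n)) (restrict_space lborel (ball 0 1 - {0})))
           (restrict_space borel (sphere 0 1)) sgn"

text \<open>$Q_N$, computed with the unit vector $\omega$.\<close>

definition Q :: "real^'n \<Rightarrow> real" where
  "Q \<omega> = 1/2 * (\<integral>\<sigma>. \<bar>\<omega> \<bullet> \<sigma>\<bar>\<^sup>2 \<partial>sphere_measure)"

end

theory Submission
  imports Defs
begin

text \<open>The limit comes from a change of variables. With \<open>y = x + \<delta> z\<close> the functional becomes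

    \<open>J A \<delta> u x\<close> = integral of \<open>1 / norm z ^ (N + 2)\<close> over the \<open>z\<close> with
    \<open>norm (Psi A u x (x + \<delta> z) - u x) > \<delta>\<close>,

  so \<open>\<delta>\<close> survives only in a difference quotient in direction \<open>z\<close>. Put \<open>D = magnetic_grad A u grad_u\<close>.
  For almost every \<open>x\<close> and \<open>z\<close> the quotient tends to the directional derivative \<open>along z D\<close>
  (\<open>gauged_difference_quotient\<close>): \<open>u\<close> is absolutely continuous along almost every line, with derivative
  given by the weak gradient, and the phase contributes the magnetic term. Hence the domain of integration
  tends to the set where \<open>norm (along z D) > 1\<close>. The integral over this limiting set is
  \<open>Q \<omega> * (norm D)^2\<close>, because \<open>along z D\<close> is homogeneous in \<open>z\<close> and the second moments of the ball are
  isotropic (\<open>nn_integral_along_superlevel\<close>).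

  Both modes of convergence then follow from dominated convergence, in \<open>z\<close> for fixed \<open>x\<close>, and in \<open>x\<close>. The
  point is to find a majorant that does not depend on \<open>\<delta>\<close>. Where \<open>\<delta> * norm z > 1\<close>, Chebyshev's
  inequality suffices (\<open>far_le\<close>). Where \<open>\<delta> * norm z \<le> 1\<close>, the increment is the integral of a derivative along
  the segment. Freezing the potential at \<open>x\<close>, the modulus of this derivative is at most \<open>norm z\<close> times
  \<open>F = norm D + L * norm u\<close>, where \<open>L\<close> is a Lipschitz constant of \<open>A\<close>. So the increment is controlled by
  \<open>\<delta> * norm z\<close> times the maximal function of \<open>F\<close> in direction \<open>z\<close>, and the domain of integration lies in
  a set that is independent of \<open>\<delta>\<close>, up to a harmless term in \<open>norm (u x)\<close> (\<open>gauged_increment_bound\<close>). Integrated over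
  \<open>x\<close> and \<open>z\<close>, the weighted measure of this set is at most a constant times the squared norm of \<open>F\<close> in \<open>L^2\<close>
  (\<open>line_max_strong_type\<close>). This is where square integrability enters, and it rests on a weak type inequality with
  constants uniform in the direction (\<open>line_max_weak_type\<close>).

  One point needs care: the exceptional set of \<open>x\<close> must not depend on \<open>\<delta>\<close>. The identity between \<open>u\<close> and the
  primitive of its derivative holds for almost every pair \<open>(x, y)\<close>, and dilations around \<open>x\<close> preserve null
  sets, so that \<open>u\<close> may be replaced by the primitive for all \<open>\<delta>\<close> at once (\<open>AE_Psi_eq_gauged\<close>). Such
  exchanges of quantifiers need measurability on product spaces; therefore the argument is run for Borel
  representatives of \<open>u\<close> and \<open>grad_u\<close>, and transferred at the end.\<close>

abbreviation nn_lborel :: "('a::euclidean_space \<Rightarrow> ennreal) \<Rightarrow> ennreal" (binder "NNINT " 10) where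
  "nn_lborel f \<equiv> nn_integral lborel f"

section \<open>Integration of homogeneous functions\<close>

lemma nn_integral_cong_except:
  fixes f g :: "'a::euclidean_space \<Rightarrow> ennreal"
  assumes "\<And>x. x \<noteq> a \<Longrightarrow> f x = g x"
  shows "(NNINT x. f x) = (NNINT x. g x)"
proof (rule nn_integral_cong_AE)
  show "AE x in lborel. f x = g x"
    using AE_lborel_singleton[of a] by eventually_elim (rule assms)
qed

lemma pred_borel_ball[measurable]: "Measurable.pred borel (\<lambda>x::'a::euclidean_space. x \<in> ball 0 1)"
  by (simp add: pred_def)

lemma nn_integral_lborel_affine:
  fixes f :: "'a::euclidean_space \<Rightarrow> ennreal"
  assumes [measurable]: "f \<in> borel_measurable borel" and c: "c \<noteq> 0"
  shows "(NNINT x. f x) = ennreal (\<bar>c\<bar> ^ DIM('a)) * (NNINT x. f (t + c *\<^sub>R x))"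
  by (subst lborel_affine[OF c, of t])
     (simp add: nn_integral_density nn_integral_distr nn_integral_cmult)

lemma nn_integral_lborel_shift:
  fixes f :: "'a::euclidean_space \<Rightarrow> ennreal"
  assumes [measurable]: "f \<in> borel_measurable borel"
  shows "(NNINT x. f (x + t)) = (NNINT x. f x)"
  using nn_integral_lborel_affine[of f 1 t] by (simp add: add.commute)

text \<open>Turns a power of \<open>norm z\<close> into an integral over radii larger than \<open>norm z\<close>, so that polar coordinates
  follow from the scaling of Lebesgue measure.\<close>

lemma nn_integral_power_tail:
  assumes a: "0 < (a::real)" and p: "0 < p"
  shows "(NNINT r. ennreal (1 / r ^ Suc p) * indicator {a<..} r) = ennreal (1 / (real p * a ^ p))"
proof -
  have "(NNINT r. ennreal (1 / r ^ Suc p) * indicator {a<..} r)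
      = (NNINT r. ennreal (1 / r ^ Suc p) * indicator {a..} r)"
    by (rule nn_integral_cong_except[where a=a])
       (auto split: split_indicator)
  also have "\<dots> = ennreal (0 - (- (1 / (real p * a ^ p))))"
  proof (rule nn_integral_FTC_atLeast)
    show "((\<lambda>r. - (1 / (real p * r ^ p))) has_real_derivative 1 / x ^ Suc p) (at x)" if "a \<le> x" for x
    proof -
      have x: "x > 0" using a that by simp
      have "x ^ p = x * x ^ (p - 1)" using p by (cases p) auto
      then show ?thesis
        using x p by (auto intro!: derivative_eq_intros simp: field_simps power2_eq_square)
    qed
    show "((\<lambda>r. - (1 / (real p * r ^ p))) \<longlongrightarrow> 0) at_top"
    proof -
      have "((\<lambda>r::real. - (inverse (real p) * inverse (r ^ p))) \<longlongrightarrow> - (inverse (real p) * 0)) at_top"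
        by (intro tendsto_intros tendsto_inverse_0_at_top filterlim_pow_at_top filterlim_ident p)
      then show ?thesis by (simp add: field_simps)
    qed
  qed (use a in auto)
  finally show ?thesis by simp
qed

text \<open>Polar coordinates with the unit ball in place of the sphere. Write the constant \<open>1\<close> as
  \<open>N * norm z ^ N\<close> times the integral of \<open>1 / r ^ (N + 1)\<close> over \<open>r > norm z\<close>, exchange the
  integrals, and substitute \<open>z = r w\<close>; the condition \<open>norm z < r\<close> becomes \<open>norm w < 1\<close>.\<close>

lemma nn_integral_polar:
  fixes f :: "'a::euclidean_space \<Rightarrow> ennreal"
  assumes f[measurable]: "f \<in> borel_measurable borel"
  shows "(NNINT z. f z) =
    (NNINT w. indicator (ball 0 1) w * (ennreal (real DIM('a) * norm w ^ DIM('a)) *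
       (NNINT r. ennreal (r ^ (DIM('a) - 1)) * f (r *\<^sub>R w) * indicator {0<..} r)))"
proof -
  define N where "N = DIM('a)"
  have N: "0 < N" by (simp add: N_def)
  \<comment> \<open>For \<open>z \<noteq> 0\<close>, integrating out \<open>r\<close> gives back \<open>f z\<close>.\<close>
  define g where "g r z = f z * ennreal (real N * norm z ^ N) * (ennreal (1 / r ^ Suc N) * indicator {norm z<..} r)" for r :: real and z :: 'a
  have g[measurable]: "case_prod g \<in> borel_measurable (lborel \<Otimes>\<^sub>M lborel)"
  proof -
    have "case_prod g = (\<lambda>p. f (snd p) * ennreal (real N * norm (snd p) ^ N) * (ennreal (1 / fst p ^ Suc N) * (if norm (snd p) < fst p then 1 else 0)))"
      by (auto simp: g_def fun_eq_iff split: split_indicator)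
    also have "\<dots> \<in> borel_measurable (lborel \<Otimes>\<^sub>M lborel)" by measurable
    finally show ?thesis .
  qed
  have "(NNINT z. f z) = (NNINT z r. g r z)"
  proof (rule nn_integral_cong_except[where a=0])
    fix z :: 'a assume z: "z \<noteq> 0"
    have "(NNINT r. g r z) = f z * ennreal (real N * norm z ^ N) * ennreal (1 / (real N * norm z ^ N))"
      unfolding g_def using nn_integral_power_tail[of "norm z" N] z N
      by (subst nn_integral_cmult) auto
    also have "\<dots> = f z * (ennreal (real N * norm z ^ N) * ennreal (1 / (real N * norm z ^ N)))"
      by (simp add: mult.assoc)
    also have "ennreal (real N * norm z ^ N) * ennreal (1 / (real N * norm z ^ N)) = 1"
      using z N by (subst ennreal_mult[symmetric]) auto
    finally show "f z = (NNINT r. g r z)" by simp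
  qed
  also have "\<dots> = (NNINT r z. g r z)"
    by (rule lborel_pair.Fubini'[OF g])
  also have "\<dots> = (NNINT r w. indicator (ball 0 1) w * (ennreal (real N * norm w ^ N) *
       (ennreal (r ^ (N - 1)) * f (r *\<^sub>R w) * indicator {0<..} r)))"
  proof (rule nn_integral_cong_except[where a=0])
    fix r :: real assume r: "r \<noteq> 0"
    show "(NNINT z. g r z) = (NNINT w. indicator (ball 0 1) w * (ennreal (real N * norm w ^ N) *
       (ennreal (r ^ (N - 1)) * f (r *\<^sub>R w) * indicator {0<..} r)))"
    proof (cases "0 < r")
      case True
      have "g r \<in> borel_measurable borel"
        using measurable_compose[OF measurable_Pair1'[of r lborel lborel] g] by simp
      then have "(NNINT z. g r z) = ennreal (\<bar>r\<bar> ^ N) * (NNINT w. g r (0 + r *\<^sub>R w))"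
        unfolding N_def by (rule nn_integral_lborel_affine[OF _ r])
      also have "\<dots> = (NNINT w. ennreal (\<bar>r\<bar> ^ N) * g r (r *\<^sub>R w))"
        by (subst nn_integral_cmult) (use measurable_compose[OF _ \<open>g r \<in> _\<close>, of "\<lambda>w. r *\<^sub>R w" lborel] in simp_all)
      also have "\<dots> = (NNINT w. indicator (ball 0 1) w * (ennreal (real N * norm w ^ N) *
       (ennreal (r ^ (N - 1)) * f (r *\<^sub>R w) * indicator {0<..} r)))"
      proof (intro nn_integral_cong)
        fix w :: 'a
        have eq: "ennreal (r ^ N) * (ennreal (real N * (r * norm w) ^ N) * ennreal (1 / r ^ Suc N))
           = ennreal (real N * norm w ^ N) * ennreal (r ^ (N - 1))"
        proof -
          have "r ^ N = r * r ^ (N - 1)" using N by (cases N) auto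
          then have "r ^ N * (real N * (r * norm w) ^ N * (1 / r ^ Suc N)) = real N * norm w ^ N * r ^ (N - 1)"
            using True by (simp add: power_mult_distrib field_simps)
          then show ?thesis using True
            by (simp add: ennreal_mult[symmetric])
        qed
        have ind: "indicator {norm (r *\<^sub>R w)<..} r = (indicator (ball 0 1) w :: ennreal)"
          using True by (auto split: split_indicator)
        have "ennreal (\<bar>r\<bar> ^ N) * g r (r *\<^sub>R w) =
          (ennreal (r ^ N) * (ennreal (real N * (r * norm w) ^ N) * ennreal (1 / r ^ Suc N))) * (f (r *\<^sub>R w) * indicator (ball 0 1) w)"
          unfolding g_def ind using True by (simp add: ac_simps)
        then show "ennreal (\<bar>r\<bar> ^ N) * g r (r *\<^sub>R w) = indicator (ball 0 1) w * (ennreal (real N * norm w ^ N) *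
           (ennreal (r ^ (N - 1)) * f (r *\<^sub>R w) * indicator {0<..} r))"
          unfolding eq using True by (simp add: ac_simps)
      qed
      finally show ?thesis .
    next
      case False
      have "g r z = 0" for z
        using False norm_ge_zero[of z] by (auto simp: g_def split: split_indicator simp del: norm_ge_zero)
      moreover have "indicator {0<..} r = (0::ennreal)" using False by simp
      ultimately show ?thesis by simp
    qed
  qed
  also have "\<dots> = (NNINT w r. indicator (ball 0 1) w * (ennreal (real N * norm w ^ N) *
       (ennreal (r ^ (N - 1)) * f (r *\<^sub>R w) * indicator {0<..} r)))"
    by (rule lborel_pair.Fubini'[symmetric]) measurable
  also have "\<dots> = (NNINT w. indicator (ball 0 1) w * (ennreal (real N * norm w ^ N) *
       (NNINT r. ennreal (r ^ (N - 1)) * f (r *\<^sub>R w) * indicator {0<..} r)))"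
    by (simp add: nn_integral_cmult)
  finally show ?thesis unfolding N_def .
qed

text \<open>For a 1-homogeneous \<open>k\<close> the weight \<open>1 / norm z ^ (N + p)\<close> is the one for which the radial integral
  separates from the angular one.\<close>

lemma nn_integral_homogeneous:
  fixes k :: "'a::euclidean_space \<Rightarrow> real" and \<phi> :: "real \<Rightarrow> ennreal"
  assumes [measurable]: "k \<in> borel_measurable borel" "\<phi> \<in> borel_measurable borel"
    and hom: "\<And>r z. 0 < r \<Longrightarrow> k (r *\<^sub>R z) = r * k z"
  shows "(NNINT z. \<phi> (k z) * ennreal (1 / norm z ^ (DIM('a) + p))) =
    (NNINT w. indicator (ball 0 1) w * (ennreal (real DIM('a) / norm w ^ p) *
       (NNINT r. \<phi> (r * k w) * (ennreal (1 / r ^ Suc p) * indicator {0<..} r))))"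
proof (subst nn_integral_polar, measurable, rule nn_integral_cong_except[where a=0])
  fix w :: 'a assume w: "w \<noteq> 0"
  define N where "N = DIM('a)"
  have N: "0 < N" by (simp add: N_def)
  have "ennreal (real N * norm w ^ N) * (NNINT r. ennreal (r ^ (N - 1)) * (\<phi> (k (r *\<^sub>R w)) * ennreal (1 / norm (r *\<^sub>R w) ^ (N + p))) * indicator {0<..} r)
     = (NNINT r. ennreal (real N * norm w ^ N) * (ennreal (r ^ (N - 1)) * (\<phi> (k (r *\<^sub>R w)) * ennreal (1 / norm (r *\<^sub>R w) ^ (N + p))) * indicator {0<..} r))"
    by (rule nn_integral_cmult[symmetric]) measurable
  also have "\<dots> = (NNINT r. ennreal (real N / norm w ^ p) * (\<phi> (r * k w) * (ennreal (1 / r ^ Suc p) * indicator {0<..} r)))"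
  proof (intro nn_integral_cong)
    fix r :: real
    show "ennreal (real N * norm w ^ N) * (ennreal (r ^ (N - 1)) * (\<phi> (k (r *\<^sub>R w)) * ennreal (1 / norm (r *\<^sub>R w) ^ (N + p))) * indicator {0<..} r)
      = ennreal (real N / norm w ^ p) * (\<phi> (r * k w) * (ennreal (1 / r ^ Suc p) * indicator {0<..} r))"
    proof (cases "0 < r")
      case True
      have "r ^ N = r * r ^ (N - 1)" using N by (cases N) auto
      then have "real N * norm w ^ N * (r ^ (N - 1) * (1 / norm (r *\<^sub>R w) ^ (N + p))) = real N / norm w ^ p * (1 / r ^ Suc p)"
        using True w by (simp add: power_mult_distrib power_add field_simps)
      then have eq: "ennreal (real N * norm w ^ N) * (ennreal (r ^ (N - 1)) * ennreal (1 / norm (r *\<^sub>R w) ^ (N + p)))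
           = ennreal (real N / norm w ^ p) * ennreal (1 / r ^ Suc p)"
        using True by (simp only: ennreal_mult[symmetric] mult_nonneg_nonneg of_nat_0_le_iff zero_le_power norm_ge_zero divide_nonneg_nonneg zero_le_one less_imp_le)
      have "ennreal (real N * norm w ^ N) * (ennreal (r ^ (N - 1)) * (\<phi> (k (r *\<^sub>R w)) * ennreal (1 / norm (r *\<^sub>R w) ^ (N + p))) * indicator {0<..} r)
        = (ennreal (real N * norm w ^ N) * (ennreal (r ^ (N - 1)) * ennreal (1 / norm (r *\<^sub>R w) ^ (N + p)))) * \<phi> (k (r *\<^sub>R w))"
        using True by (simp add: ac_simps)
      then show ?thesis unfolding eq using True hom[OF True, of w] by (simp add: ac_simps)
    qed simp
  qed
  also have "\<dots> = ennreal (real N / norm w ^ p) * (NNINT r. \<phi> (r * k w) * (ennreal (1 / r ^ Suc p) * indicator {0<..} r))"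
    by (rule nn_integral_cmult) measurable
  finally show "indicator (ball 0 1) w * (ennreal (real DIM('a) * norm w ^ DIM('a)) * (NNINT r. ennreal (r ^ (DIM('a) - 1)) * (\<phi> (k (r *\<^sub>R w)) * ennreal (1 / norm (r *\<^sub>R w) ^ (DIM('a) + p))) * indicator {0<..} r)) =
    indicator (ball 0 1) w * (ennreal (real DIM('a) / norm w ^ p) * (NNINT r. \<phi> (r * k w) * (ennreal (1 / r ^ Suc p) * indicator {0<..} r)))"
    unfolding N_def by simp
qed

text \<open>Applied below to \<open>k z = c * norm z\<close>, which gives the constants in the majorants, and to the modulus
  of a directional derivative, which gives the limit. The right-hand side has the shape of the
  integral that defines \<open>Q\<close>.\<close>

lemma nn_integral_homogeneous_superlevel:
  fixes k :: "'a::euclidean_space \<Rightarrow> real"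
  assumes [measurable]: "k \<in> borel_measurable borel"
    and nonneg: "\<And>z. 0 \<le> k z"
    and hom: "\<And>r z. 0 < r \<Longrightarrow> k (r *\<^sub>R z) = r * k z" and p: "0 < p"
  shows "(NNINT z. indicator {z. 1 < k z} z * ennreal (1 / norm z ^ (DIM('a) + p))) =
    (NNINT w. indicator (ball 0 1) w * ennreal (real DIM('a) / real p * (k w / norm w) ^ p))"
proof -
  have "(NNINT z. indicator {z. 1 < k z} z * ennreal (1 / norm z ^ (DIM('a) + p)))
      = (NNINT z. indicator {1<..} (k z) * ennreal (1 / norm z ^ (DIM('a) + p)))"
    by (intro nn_integral_cong) (auto split: split_indicator)
  also have "\<dots> = (NNINT w. indicator (ball 0 1) w * (ennreal (real DIM('a) / norm w ^ p) *
       (NNINT r. indicator {1<..} (r * k w) * (ennreal (1 / r ^ Suc p) * indicator {0<..} r))))"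
    by (rule nn_integral_homogeneous) (simp_all add: hom)
  also have "\<dots> = (NNINT w. indicator (ball 0 1) w * ennreal (real DIM('a) / real p * (k w / norm w) ^ p))"
  proof (intro nn_integral_cong arg_cong2[where f="(*)"] refl)
    fix w :: 'a
    have "(NNINT r. indicator {1<..} (r * k w) * (ennreal (1 / r ^ Suc p) * indicator {0<..} r)) = ennreal (k w ^ p / real p)"
    proof (cases "k w = 0")
      case True then show ?thesis using p by simp
    next
      case False
      then have kw: "0 < k w" using nonneg[of w] by simp
      have "(NNINT r. indicator {1<..} (r * k w) * (ennreal (1 / r ^ Suc p) * indicator {0<..} r))
         = (NNINT r. ennreal (1 / r ^ Suc p) * indicator {1 / k w<..} r)"
      proof (intro nn_integral_cong)
        fix r
        have "1 < r * k w \<longleftrightarrow> 1 / k w < r" using kw by (simp add: field_simps)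
        moreover have "0 < r" if "1 / k w < r" using kw that by (meson zero_less_divide_1_iff less_trans)
        ultimately show "indicator {1<..} (r * k w) * (ennreal (1 / r ^ Suc p) * indicator {0<..} r) = ennreal (1 / r ^ Suc p) * indicator {1 / k w<..} r"
          by (auto split: split_indicator)
      qed
      also have "\<dots> = ennreal (1 / (real p * (1 / k w) ^ p))"
        using kw p by (intro nn_integral_power_tail) auto
      also have "1 / (real p * (1 / k w) ^ p) = k w ^ p / real p"
        using kw by (simp add: power_divide field_simps)
      finally show ?thesis .
    qed
    then show "ennreal (real DIM('a) / norm w ^ p) * (NNINT r. indicator {1<..} (r * k w) * (ennreal (1 / r ^ Suc p) * indicator {0<..} r))
       = ennreal (real DIM('a) / real p * (k w / norm w) ^ p)"
      using nonneg[of w] by (simp add: ennreal_mult[symmetric] power_divide)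
  qed
  finally show ?thesis .
qed

text \<open>Each ray meets the level set in at most one point. The indicator of a superlevel set is therefore
  continuous under almost everywhere convergence of the functions that define it.\<close>

lemma AE_homogeneous_neq_1:
  fixes k :: "'a::euclidean_space \<Rightarrow> real"
  assumes [measurable]: "k \<in> borel_measurable borel"
    and hom: "\<And>r z. 0 < r \<Longrightarrow> k (r *\<^sub>R z) = r * k z"
  shows "AE z in lborel. k z \<noteq> 1"
proof -
  have "(NNINT z. indicator {1} (k z) * ennreal (1 / norm z ^ (DIM('a) + 1))) =
    (NNINT w. indicator (ball 0 1) w * (ennreal (real DIM('a) / norm w ^ 1) *
       (NNINT r. indicator {1} (r * k w) * (ennreal (1 / r ^ Suc 1) * indicator {0<..} r))))"
    by (rule nn_integral_homogeneous) (simp_all add: hom)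
  also have "\<dots> = (NNINT (w::'a). 0)"
  proof (intro nn_integral_cong)
    fix w :: 'a
    have "(NNINT r. indicator {1} (r * k w) * (ennreal (1 / r ^ Suc 1) * indicator {0<..} r)) = (NNINT (r::real). 0)"
    proof (rule nn_integral_cong_except[where a="1 / k w"])
      fix r assume "r \<noteq> 1 / k w"
      then have "r * k w \<noteq> 1" by (metis mult_zero_right nonzero_eq_divide_eq zero_neq_one)
      then show "indicator {1} (r * k w) * (ennreal (1 / r ^ Suc 1) * indicator {0<..} r) = 0" by simp
    qed
    then show "indicator (ball 0 1) w * (ennreal (real DIM('a) / norm w ^ 1) *
       (NNINT r. indicator {1} (r * k w) * (ennreal (1 / r ^ Suc 1) * indicator {0<..} r))) = 0" by simp
  qed
  also have "\<dots> = 0" by simp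
  finally have "AE z in lborel. indicator {1} (k z) * ennreal (1 / norm z ^ (DIM('a) + 1)) = 0"
    by (subst (asm) nn_integral_0_iff_AE) (auto simp del: mult_eq_0_iff)
  with AE_lborel_singleton[of 0] show ?thesis
    by eventually_elim (auto split: split_indicator_asm)
qed

lemma nn_integral_norm_superlevel:
  fixes c :: real
  assumes "0 \<le> c" and p: "0 < p"
  shows "(NNINT z. indicator {z::'a::euclidean_space. 1 < c * norm z} z * ennreal (1 / norm z ^ (DIM('a) + p))) =
    ennreal (c ^ p * (real DIM('a) / real p * measure lborel (ball (0::'a) 1)))"
proof -
  have "(NNINT z. indicator {z::'a. 1 < c * norm z} z * ennreal (1 / norm z ^ (DIM('a) + p))) =
     (NNINT w. indicator (ball (0::'a) 1) w * ennreal (real DIM('a) / real p * ((c * norm w) / norm w) ^ p))"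
    using assms by (intro nn_integral_homogeneous_superlevel) auto
  also have "\<dots> = (NNINT w. ennreal (real DIM('a) / real p * c ^ p) * indicator (ball (0::'a) 1) w)"
    by (rule nn_integral_cong_except[where a=0]) (simp add: mult.commute)
  also have "\<dots> = ennreal (real DIM('a) / real p * c ^ p) * emeasure lborel (ball (0::'a) 1)"
    by (rule nn_integral_cmult_indicator) simp
  also have "emeasure lborel (ball (0::'a) 1) = ennreal (measure lborel (ball (0::'a) 1))"
    using emeasure_lborel_ball_finite[of "0::'a" 1] by (intro emeasure_eq_ennreal_measure) simp
  finally show ?thesis using assms by (simp add: ennreal_mult[symmetric] ac_simps)
qed

section \<open>Directional derivatives and the constant Q\<close>

definition along :: "real^'n \<Rightarrow> complex^'n \<Rightarrow> complex" where
  "along z G = (\<Sum>j\<in>UNIV. z $ j *\<^sub>R G $ j)"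

lemma Re_along: "Re (along z G) = (\<chi> j. Re (G $ j)) \<bullet> z"
  and Im_along: "Im (along z G) = (\<chi> j. Im (G $ j)) \<bullet> z"
  by (simp_all add: along_def inner_vec_def mult.commute)

lemma along_scale: "along (r *\<^sub>R z) G = r *\<^sub>R along z G"
  by (simp add: along_def scaleR_sum_right)

lemma norm_along_le: "norm (along z G) \<le> norm z * norm G"
proof -
  have "norm (along z G) \<le> (\<Sum>j\<in>UNIV. \<bar>z $ j\<bar> * \<bar>norm (G $ j)\<bar>)"
    unfolding along_def by (rule order_trans[OF norm_sum]) simp
  also have "\<dots> \<le> L2_set (\<lambda>j. z $ j) UNIV * L2_set (\<lambda>j. norm (G $ j)) UNIV"
    by (rule L2_set_mult_ineq)
  finally show ?thesis by (simp add: norm_vec_def L2_set_def)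
qed

lemma borel_measurable_vec_nth[measurable (raw)]:
  fixes f :: "'a \<Rightarrow> ('b::second_countable_topology)^'n"
  assumes "f \<in> borel_measurable M" shows "(\<lambda>x. f x $ i) \<in> borel_measurable M"
  using measurable_compose[OF assms borel_measurable_continuous_onI[of "\<lambda>x. x $ i"]]
  by (simp add: continuous_intros)

lemma borel_measurable_along[measurable (raw)]:
  assumes [measurable]: "f \<in> borel_measurable M" "g \<in> borel_measurable M"
  shows "(\<lambda>x. along (f x) (g x)) \<in> borel_measurable M"
  unfolding along_def by measurable

text \<open>The sphere measure is the image of Lebesgue measure on the ball under \<open>sgn\<close>, so the integral over
  the sphere is an integral over the ball of a 0-homogeneous function.\<close>

lemma Q_eq_nn_integral:
  fixes \<omega> :: "real^'n"
  assumes "norm \<omega> = 1"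
  shows "ennreal (Q \<omega>) = (NNINT w. indicator (ball 0 1) w * ennreal (real CARD('n) / 2 * (\<bar>\<omega> \<bullet> w\<bar> / norm w)\<^sup>2))"
proof -
  let ?I = "NNINT w. indicator (ball 0 1) w * ennreal ((\<bar>\<omega> \<bullet> w\<bar> / norm w)\<^sup>2)"
  have fin: "?I < \<infinity>"
  proof -
    have "?I \<le> (NNINT w. indicator (ball (0::real^'n) 1) w)"
    proof (intro nn_integral_mono)
      fix w :: "real^'n"
      have "\<bar>\<omega> \<bullet> w\<bar> / norm w \<le> 1"
        using Cauchy_Schwarz_ineq2[of \<omega> w] assms by (cases "w = 0") (auto simp: divide_le_eq)
      then have "(\<bar>\<omega> \<bullet> w\<bar> / norm w)\<^sup>2 \<le> 1" by (intro power_le_one) auto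
      then show "indicator (ball 0 1) w * ennreal ((\<bar>\<omega> \<bullet> w\<bar> / norm w)\<^sup>2) \<le> indicator (ball 0 1) w"
        by (auto split: split_indicator)
    qed
    also have "\<dots> < \<infinity>" using emeasure_lborel_ball_finite[of "0::real^'n" 1] by simp
    finally show ?thesis .
  qed
  have sgnm: "sgn \<in> restrict_space lborel (ball (0::real^'n) 1 - {0}) \<rightarrow>\<^sub>M restrict_space borel (sphere 0 1)"
  proof (rule measurable_restrict_space2)
    show "sgn \<in> space (restrict_space lborel (ball (0::real^'n) 1 - {0})) \<rightarrow> sphere 0 1"
      by (auto simp: space_restrict_space norm_sgn)
    show "sgn \<in> borel_measurable (restrict_space lborel (ball (0::real^'n) 1 - {0}))"
      by (rule measurable_restrict_space1) (simp add: sgn_div_norm[abs_def])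
  qed
  have m: "(\<lambda>\<sigma>. ennreal (\<bar>\<omega> \<bullet> \<sigma>\<bar>\<^sup>2)) \<in> borel_measurable (restrict_space borel (sphere (0::real^'n) 1))"
    by (rule measurable_restrict_space1) simp
  have "(\<integral>\<^sup>+\<sigma>. ennreal (\<bar>\<omega> \<bullet> \<sigma>\<bar>\<^sup>2) \<partial>sphere_measure)
     = of_nat CARD('n) * (\<integral>\<^sup>+w\<in>ball 0 1 - {0}. ennreal (\<bar>\<omega> \<bullet> sgn w\<bar>\<^sup>2) \<partial>lborel)"
    unfolding sphere_measure_def
    using sgnm m
    by (subst nn_integral_distr) (auto simp: nn_integral_scale_measure nn_integral_restrict_space measurable_restrict_space1)
  also have "(\<integral>\<^sup>+w\<in>ball 0 1 - {0}. ennreal (\<bar>\<omega> \<bullet> sgn w\<bar>\<^sup>2) \<partial>lborel) = ?I"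
    by (rule nn_integral_cong_except[where a=0])
       (auto split: split_indicator simp: sgn_div_norm abs_mult divide_inverse mult.commute)
  finally have E: "(\<integral>\<^sup>+\<sigma>. ennreal (\<bar>\<omega> \<bullet> \<sigma>\<bar>\<^sup>2) \<partial>sphere_measure) = of_nat CARD('n) * ?I" .
  have "(\<integral>\<sigma>. \<bar>\<omega> \<bullet> \<sigma>\<bar>\<^sup>2 \<partial>sphere_measure) = enn2real (\<integral>\<^sup>+\<sigma>. ennreal (\<bar>\<omega> \<bullet> \<sigma>\<bar>\<^sup>2) \<partial>sphere_measure)"
    using m by (intro integral_eq_nn_integral) (auto simp: sphere_measure_def intro!: measurable_restrict_space1)
  then have "Q \<omega> = 1/2 * (real CARD('n) * enn2real ?I)"
    unfolding Q_def E by (simp add: enn2real_mult)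
  then have Q: "Q \<omega> = real CARD('n) / 2 * enn2real ?I" by simp
  have "ennreal (Q \<omega>) = ennreal (real CARD('n) / 2) * ennreal (enn2real ?I)"
    unfolding Q by (rule ennreal_mult) auto
  also have "\<dots> = ennreal (real CARD('n) / 2) * ?I" using fin by simp
  also have "\<dots> = (NNINT w. ennreal (real CARD('n) / 2) * (indicator (ball 0 1) w * ennreal ((\<bar>\<omega> \<bullet> w\<bar> / norm w)\<^sup>2)))"
    by (rule nn_integral_cmult[symmetric]) measurable
  also have "\<dots> = (NNINT w. indicator (ball 0 1) w * ennreal (real CARD('n) / 2 * (\<bar>\<omega> \<bullet> w\<bar> / norm w)\<^sup>2))"
    by (intro nn_integral_cong) (auto split: split_indicator simp flip: ennreal_mult)
  finally show ?thesis .
qed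

lemma Q_nonneg: "0 \<le> Q \<omega>"
  by (simp add: Q_def)

text \<open>Invariance under coordinate swaps and reflections is all the rotation invariance that quadratic
  forms need: it makes the second moment matrix of the ball a multiple of the identity.\<close>

lemma lborel_swap_coordinates:
  fixes i j :: "'n::finite"
  defines "T \<equiv> \<lambda>w::real^'n. \<chi> k. w $ Transposition.transpose i j k"
  shows "distr lborel borel T = lborel"
proof (rule lborel_eqI[symmetric])
  have inv: "T (T w) = w" for w by (simp add: T_def vec_eq_iff)
  have inner: "T v \<bullet> w = v \<bullet> T w" for v w
    unfolding T_def inner_vec_def
    by (rule sum.reindex_bij_witness[of _ "Transposition.transpose i j" "Transposition.transpose i j"]) auto
  have Basis: "T b \<in> Basis" if b: "b \<in> Basis" for b
  proof -
    obtain k where k: "b = axis k 1" using b unfolding Basis_vec_def Basis_real_def by blast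
    then have "T b = axis (Transposition.transpose i j k) 1"
      unfolding k by (auto simp: T_def vec_eq_iff axis_def transpose_eq_iff)
    then show ?thesis by (simp add: axis_in_Basis_iff)
  qed
  have [measurable]: "T \<in> borel_measurable borel"
    unfolding T_def by (intro borel_measurable_continuous_onI continuous_intros)
  fix l u :: "real^'n" assume le: "\<And>b. b \<in> Basis \<Longrightarrow> l \<bullet> b \<le> u \<bullet> b"
  have "T -` box l u = box (T l) (T u)"
  proof (intro set_eqI iffI)
    fix w assume "w \<in> T -` box l u"
    then have *: "l \<bullet> b < T w \<bullet> b \<and> T w \<bullet> b < u \<bullet> b" if "b \<in> Basis" for b using that by (simp add: box_def)
    show "w \<in> box (T l) (T u)" unfolding box_def
      using *[OF Basis] by (auto simp: inner inv)
  next
    fix w assume "w \<in> box (T l) (T u)"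
    then have *: "T l \<bullet> b < w \<bullet> b \<and> w \<bullet> b < T u \<bullet> b" if "b \<in> Basis" for b using that by (simp add: box_def)
    show "w \<in> T -` box l u" unfolding box_def
      using *[OF Basis] by (auto simp: inner inv)
  qed
  then have "emeasure (distr lborel borel T) (box l u) = emeasure lborel (box (T l) (T u))"
    by (subst emeasure_distr) auto
  also have "\<dots> = (\<Prod>b\<in>Basis. (T u - T l) \<bullet> b)"
    using le[OF Basis] by (subst emeasure_lborel_box_eq) (auto simp: inner)
  also have "(\<Prod>b\<in>Basis. (T u - T l) \<bullet> b) = (\<Prod>b\<in>Basis. (u - l) \<bullet> b)"
    by (rule prod.reindex_bij_witness[of _ T T]) (auto simp: inv Basis inner inner_diff_left)
  finally show "emeasure (distr lborel borel T) (box l u) = (\<Prod>b\<in>Basis. (u - l) \<bullet> b)" .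
qed simp

lemma lborel_reflect_coordinate:
  fixes i :: "'n::finite"
  shows "distr lborel borel (\<lambda>w::real^'n. \<chi> k. if k = i then - w $ k else w $ k) = lborel"
proof -
  define c where "c b = (if b = axis i 1 then -1 else 1 :: real)" for b :: "real^'n"
  have "(\<lambda>w::real^'n. \<chi> k. if k = i then - w $ k else w $ k) = (\<lambda>x. 0 + (\<Sum>j\<in>Basis. (c j * (x \<bullet> j)) *\<^sub>R j))"
  proof
    fix w :: "real^'n"
    have "(\<chi> k. if k = i then - w $ k else w $ k) \<bullet> b = (0 + (\<Sum>j\<in>Basis. (c j * (w \<bullet> j)) *\<^sub>R j)) \<bullet> b"
      if b: "b \<in> Basis" for b
    proof -
      obtain k where k: "b = axis k 1" using b unfolding Basis_vec_def Basis_real_def by blast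
      have "(0 + (\<Sum>j\<in>Basis. (c j * (w \<bullet> j)) *\<^sub>R j)) \<bullet> b = c b * (w \<bullet> b)"
        using b by simp
      then show ?thesis by (simp add: k c_def inner_axis axis_eq_axis)
    qed
    then show "(\<chi> k. if k = i then - w $ k else w $ k) = 0 + (\<Sum>j\<in>Basis. (c j * (w \<bullet> j)) *\<^sub>R j)"
      by (rule euclidean_eqI)
  qed
  moreover have "lborel = density (distr lborel borel (\<lambda>x::real^'n. 0 + (\<Sum>j\<in>Basis. (c j * (x \<bullet> j)) *\<^sub>R j))) (\<lambda>_. (\<Prod>j\<in>Basis. \<bar>c j\<bar>))"
    by (rule lborel_affine_euclidean) (simp add: c_def)
  moreover have "(\<Prod>j\<in>Basis. \<bar>c j\<bar>) = 1" by (rule prod.neutral) (simp add: c_def)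
  ultimately show ?thesis by (simp add: density_1)
qed

text \<open>Expand the square. Reflecting one coordinate kills the mixed moments, and swapping two coordinates
  shows that the diagonal ones agree; what remains is the squared length of \<open>v\<close>.\<close>

lemma integral_inner_sq_ball:
  fixes v \<omega> :: "real^'n"
  defines "B \<equiv> \<lambda>v::real^'n. LBINT w. indicator (ball 0 1) w * ((v \<bullet> w) / norm w)\<^sup>2"
  assumes "norm \<omega> = 1"
  shows "integrable lborel (\<lambda>w. indicator (ball 0 1) w * ((v \<bullet> w) / norm w)\<^sup>2)"
    and "B v = (norm v)\<^sup>2 * B \<omega>"
proof -
  define m where "m i j w = indicator (ball 0 1) w * (w $ i * w $ j / (norm w)\<^sup>2)" for i j and w :: "real^'n"
  have [measurable]: "m i j \<in> borel_measurable borel" for i j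
    unfolding m_def by measurable
  have int: "integrable lborel (m i j)" for i j
  proof (rule Bochner_Integration.integrable_bound[where f="indicator (ball (0::real^'n) 1) :: _ \<Rightarrow> real"])
    show "integrable lborel (indicator (ball (0::real^'n) 1) :: _ \<Rightarrow> real)"
      using emeasure_lborel_ball_finite[of "0::real^'n" 1] by (intro integrable_real_indicator) simp_all
    show "AE w in lborel. norm (m i j w) \<le> norm (indicator (ball 0 1) w :: real)"
    proof (rule AE_I2)
      fix w :: "real^'n"
      have "\<bar>w $ i * w $ j\<bar> \<le> norm w * norm w"
        unfolding abs_mult by (intro mult_mono component_le_norm_cart) auto
      then have "\<bar>w $ i * w $ j / (norm w)\<^sup>2\<bar> \<le> 1"
        by (cases "w = 0") (auto simp: power2_eq_square divide_le_eq)
      then show "norm (m i j w) \<le> norm (indicator (ball 0 1) w :: real)"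
        by (auto simp: m_def split: split_indicator)
    qed
  qed simp
  have expand: "indicator (ball 0 1) w * ((v \<bullet> w) / norm w)\<^sup>2 = (\<Sum>i\<in>UNIV. \<Sum>j\<in>UNIV. v $ i * v $ j * m i j w)" for v w
    by (simp add: m_def power_divide inner_vec_def power2_eq_square sum_product sum_divide_distrib sum_distrib_left ac_simps)
  show "integrable lborel (\<lambda>w. indicator (ball 0 1) w * ((v \<bullet> w) / norm w)\<^sup>2)"
    unfolding expand by (intro Bochner_Integration.integrable_sum integrable_mult_right int)
  have off: "(LBINT w. m i j w) = 0" if "i \<noteq> j" for i j
  proof -
    let ?T = "\<lambda>w::real^'n. \<chi> k. if k = i then - w $ k else w $ k"
    have n: "norm (?T w) = norm w" for w
      unfolding norm_vec_def by (rule arg_cong2[where f=L2_set]) auto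
    have "continuous_on UNIV (\<lambda>w::real^'n. if k = i then - w $ k else w $ k)" for k
      by (cases "k = i") (auto intro!: continuous_intros)
    then have [measurable]: "?T \<in> borel_measurable borel"
      by (intro borel_measurable_continuous_onI continuous_on_vec_lambda)
    have "(LBINT w. m i j w) = (\<integral>w. m i j w \<partial>distr lborel borel ?T)"
      by (simp add: lborel_reflect_coordinate)
    also have "\<dots> = (LBINT w. m i j (?T w))" by (rule integral_distr) simp_all
    also have "\<dots> = (LBINT w. - m i j w)"
      using that n by (intro Bochner_Integration.integral_cong) (auto simp: m_def split: split_indicator)
    finally show ?thesis by simp
  qed
  have diag: "(LBINT w. m i i w) = (LBINT w. m j j w)" for i j
  proof -
    let ?T = "\<lambda>w::real^'n. \<chi> k. w $ Transposition.transpose i j k"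
    have n: "norm (?T w) = norm w" for w
    proof -
      have "(\<Sum>k\<in>UNIV. (w $ Transposition.transpose i j k)\<^sup>2) = (\<Sum>k\<in>UNIV. (w $ k)\<^sup>2)"
        by (rule sum.reindex_bij_witness[of _ "Transposition.transpose i j" "Transposition.transpose i j"]) auto
      then show ?thesis by (simp add: norm_vec_def L2_set_def)
    qed
    have [measurable]: "?T \<in> borel_measurable borel"
      by (intro borel_measurable_continuous_onI continuous_intros)
    have "(LBINT w. m i i w) = (\<integral>w. m i i w \<partial>distr lborel borel ?T)"
      by (simp add: lborel_swap_coordinates)
    also have "\<dots> = (LBINT w. m i i (?T w))" by (rule integral_distr) simp_all
    also have "\<dots> = (LBINT w. m j j w)"
      using n by (intro Bochner_Integration.integral_cong) (auto simp: m_def split: split_indicator)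
    finally show ?thesis .
  qed
  fix k :: 'n
  have B: "B v = (norm v)\<^sup>2 * (LBINT w. m k k w)" for v
  proof -
    have "B v = (\<Sum>i\<in>UNIV. \<Sum>j\<in>UNIV. v $ i * v $ j * (LBINT w. m i j w))"
      unfolding B_def expand using int
      by (simp add: Bochner_Integration.integral_sum)
    also have "\<dots> = (\<Sum>i\<in>UNIV. \<Sum>j\<in>UNIV. if j = i then v $ i * v $ i * (LBINT w. m k k w) else 0)"
      using off diag by (intro sum.cong refl) auto
    also have "\<dots> = (norm v)\<^sup>2 * (LBINT w. m k k w)"
      by (simp add: norm_vec_def L2_set_def sum_nonneg sum_distrib_right power2_eq_square)
    finally show ?thesis .
  qed
  show "B v = (norm v)\<^sup>2 * B \<omega>" using B[of v] B[of \<omega>] assms(2) by simp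
qed

lemma nn_integral_real_along_ball:
  fixes \<omega> v :: "real^'n"
  assumes "norm \<omega> = 1"
  shows "(NNINT w. indicator (ball 0 1) w * ennreal (real CARD('n) / 2 * ((v \<bullet> w) / norm w)\<^sup>2))
     = ennreal (Q \<omega> * (norm v)\<^sup>2)"
proof -
  let ?B = "\<lambda>v::real^'n. LBINT w. indicator (ball 0 1) w * ((v \<bullet> w) / norm w)\<^sup>2"
  have B: "(NNINT w. indicator (ball 0 1) w * ennreal (real CARD('n) / 2 * ((v \<bullet> w) / norm w)\<^sup>2))
     = ennreal (real CARD('n) / 2 * ?B v)" for v :: "real^'n"
  proof -
    have "(NNINT w. indicator (ball 0 1) w * ennreal (real CARD('n) / 2 * ((v \<bullet> w) / norm w)\<^sup>2))
      = (NNINT w. ennreal (real CARD('n) / 2 * (indicator (ball 0 1) w * ((v \<bullet> w) / norm w)\<^sup>2)))"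
      by (intro nn_integral_cong) (auto split: split_indicator)
    also have "\<dots> = ennreal (LBINT w. real CARD('n) / 2 * (indicator (ball 0 1) w * ((v \<bullet> w) / norm w)\<^sup>2))"
      using integral_inner_sq_ball(1)[OF assms, of v]
      by (intro nn_integral_eq_integral integrable_mult_right) auto
    finally show ?thesis by simp
  qed
  have "0 \<le> ?B \<omega>" by (rule Bochner_Integration.integral_nonneg) simp
  moreover have "ennreal (Q \<omega>) = ennreal (real CARD('n) / 2 * ?B \<omega>)"
    unfolding Q_eq_nn_integral[OF assms] B[symmetric] by (simp add: power_divide)
  ultimately have Q: "Q \<omega> = real CARD('n) / 2 * ?B \<omega>"
    using Q_nonneg[of \<omega>] by simp
  show ?thesis
    unfolding B integral_inner_sq_ball(2)[OF assms, of v] unfolding Q by (simp add: ac_simps)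
qed

text \<open>The limit of the rescaled functional: real and imaginary part of \<open>along z D\<close> are real linear forms
  in \<open>z\<close>, and their quadratic contributions add up to the squared norm of \<open>D\<close>.\<close>

lemma nn_integral_along_superlevel:
  fixes \<omega> :: "real^'n" and D :: "complex^'n"
  assumes "norm \<omega> = 1"
  shows "(NNINT z. indicator {z. 1 < norm (along z D)} z * ennreal (1 / norm z ^ (CARD('n) + 2)))
     = ennreal (Q \<omega> * (norm D)\<^sup>2)"
proof -
  let ?R = "\<chi> j. Re (D $ j)" and ?I = "\<chi> j. Im (D $ j)"
  have "(NNINT z. indicator {z. 1 < norm (along z D)} z * ennreal (1 / norm z ^ (CARD('n) + 2)))
   = (NNINT w. indicator (ball 0 1) w * ennreal (real CARD('n) / 2 * (norm (along w D) / norm w)\<^sup>2))"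
    using nn_integral_homogeneous_superlevel[of "\<lambda>z. norm (along z D)" 2] by (simp add: along_scale)
  also have "\<dots> = (NNINT w. indicator (ball 0 1) w * ennreal (real CARD('n) / 2 * ((?R \<bullet> w) / norm w)\<^sup>2)
       + indicator (ball 0 1) w * ennreal (real CARD('n) / 2 * ((?I \<bullet> w) / norm w)\<^sup>2))"
  proof (intro nn_integral_cong)
    fix w
    have "(norm (along w D))\<^sup>2 = (?R \<bullet> w)\<^sup>2 + (?I \<bullet> w)\<^sup>2"
      by (simp add: cmod_power2 Re_along Im_along)
    then have "real CARD('n) / 2 * (norm (along w D) / norm w)\<^sup>2 = 
       real CARD('n) / 2 * ((?R \<bullet> w) / norm w)\<^sup>2 + real CARD('n) / 2 * ((?I \<bullet> w) / norm w)\<^sup>2"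
      by (simp add: power_divide add_divide_distrib distrib_left)
    then show "indicator (ball 0 1) w * ennreal (real CARD('n) / 2 * (norm (along w D) / norm w)\<^sup>2) =
      indicator (ball 0 1) w * ennreal (real CARD('n) / 2 * ((?R \<bullet> w) / norm w)\<^sup>2)
       + indicator (ball 0 1) w * ennreal (real CARD('n) / 2 * ((?I \<bullet> w) / norm w)\<^sup>2)"
      by (simp add: ennreal_plus[symmetric] split: split_indicator del: ennreal_plus)
  qed
  also have "\<dots> = ennreal (Q \<omega> * (norm ?R)\<^sup>2) + ennreal (Q \<omega> * (norm ?I)\<^sup>2)"
    by (subst nn_integral_add) (simp_all only: nn_integral_real_along_ball[OF assms], measurable)
  also have "\<dots> = ennreal (Q \<omega> * (norm D)\<^sup>2)"
  proof -
    have "(norm D)\<^sup>2 = (norm ?R)\<^sup>2 + (norm ?I)\<^sup>2"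
      by (simp add: norm_vec_def L2_set_def sum_nonneg cmod_power2 sum.distrib)
    then show ?thesis by (simp add: Q_nonneg distrib_left del: ennreal_plus flip: ennreal_plus)
  qed
  finally show ?thesis .
qed

section \<open>The maximal function in a fixed direction\<close>

text \<open>The largest of the partial sums of length at most \<open>n\<close> of \<open>G - c\<close> along the orbit of the translation
  by \<open>a\<close>, the empty sum included. Truncated subtraction takes the maximum with zero.\<close>

primrec hopf_max :: "'a::real_vector \<Rightarrow> ('a \<Rightarrow> ennreal) \<Rightarrow> ennreal \<Rightarrow> nat \<Rightarrow> 'a \<Rightarrow> ennreal" where
  "hopf_max a G c 0 x = 0"
| "hopf_max a G c (Suc n) x = (G x + hopf_max a G c n (x + a)) - c"

lemma borel_measurable_hopf_max[measurable]:
  fixes G :: "'a::euclidean_space \<Rightarrow> ennreal"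
  assumes [measurable]: "G \<in> borel_measurable borel"
  shows "hopf_max a G c n \<in> borel_measurable borel"
proof (induction n)
  case 0 then show ?case by (simp add: hopf_max.simps(1)[abs_def])
next
  case (Suc n)
  then have [measurable]: "(\<lambda>x. hopf_max a G c n (x + a)) \<in> borel_measurable borel"
    by (rule measurable_compose[rotated]) simp
  have "hopf_max a G c (Suc n) = (\<lambda>x. (G x + hopf_max a G c n (x + a)) - c)" by (simp add: fun_eq_iff)
  also have "\<dots> \<in> borel_measurable borel" by measurable
  finally show ?case .
qed

lemma hopf_max_mono: "hopf_max a G c n x \<le> hopf_max a G c (Suc n) x"
proof (induction n arbitrary: x)
  case (Suc n)
  show ?case
    unfolding hopf_max.simps(2)[of a G c "Suc n"] hopf_max.simps(2)[of a G c n x]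
    by (intro ennreal_minus_mono add_mono Suc.IH order_refl)
qed simp

lemma ennreal_le_diff_add: "b \<le> b - c + (c::ennreal)"
  by (cases "c \<le> b") (auto simp: diff_add_cancel_ennreal intro: order_trans[of b c])

lemma hopf_max_ge: "k \<le> n \<Longrightarrow> (\<Sum>i<k. G (x + real i *\<^sub>R a)) \<le> hopf_max a G c n x + of_nat k * c"
proof (induction n arbitrary: x k)
  case (Suc n)
  show ?case
  proof (cases k)
    case (Suc k')
    have "(\<Sum>i<k. G (x + real i *\<^sub>R a)) = G x + (\<Sum>i<k'. G ((x + a) + real i *\<^sub>R a))"
      unfolding Suc by (subst sum.lessThan_Suc_shift) (simp add: scaleR_add_left add.assoc)
    also have "\<dots> \<le> G x + (hopf_max a G c n (x + a) + of_nat k' * c)"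
      using Suc.IH[of k' "x + a"] Suc.prems \<open>k = Suc k'\<close> by (intro add_left_mono) simp
    also have "\<dots> \<le> (G x + hopf_max a G c n (x + a) - c) + c + of_nat k' * c"
      unfolding add.assoc[symmetric] by (intro add_right_mono ennreal_le_diff_add)
    finally show ?thesis unfolding \<open>k = Suc k'\<close> by (simp add: ac_simps distrib_right distrib_left)
  qed simp
qed simp

lemma nn_integral_hopf_max_le:
  fixes G :: "'a::euclidean_space \<Rightarrow> ennreal"
  assumes [measurable]: "G \<in> borel_measurable borel"
  shows "(NNINT x. hopf_max a G c n x) \<le> of_nat n * (NNINT x. G x)"
proof (induction n)
  case (Suc n)
  have "(NNINT x. hopf_max a G c (Suc n) x) \<le> (NNINT x. G x + hopf_max a G c n (x + a))"
    by (intro nn_integral_mono) (simp add: diff_le_self_ennreal)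
  also have "\<dots> = (NNINT x. G x) + (NNINT x. hopf_max a G c n (x + a))"
    by (rule nn_integral_add) measurable
  also have "\<dots> = (NNINT x. G x) + (NNINT x. hopf_max a G c n x)"
    by (subst nn_integral_lborel_shift) auto
  also have "\<dots> \<le> of_nat (Suc n) * (NNINT x. G x)"
    using Suc by (simp add: distrib_right add_left_mono)
  finally show ?case .
qed simp

text \<open>Hopf's maximal ergodic inequality for a translation, with Garsia's argument. On the set \<open>E\<close> where the
  maximum \<open>M\<close> is positive, \<open>M x + c = G x + M' (x + a)\<close>, with \<open>M'\<close> the maximum over one term less, and
  \<open>M'\<close> is at most \<open>M\<close>. Integrate; the integrals of \<open>M\<close> and of its translate cancel. The argument
  takes place on the whole space, so the constant does not see the direction of the translation.\<close>

lemma hopf_maximal_inequality: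
  fixes G :: "'a::euclidean_space \<Rightarrow> ennreal"
  assumes [measurable]: "G \<in> borel_measurable borel"
  shows "ennreal c * emeasure lborel {x. \<exists>k\<le>n. of_nat k * ennreal c < (\<Sum>i<k. G (x + real i *\<^sub>R a))} \<le> (NNINT x. G x)"
proof (cases "(NNINT x. G x) = \<infinity>")
  case False
  let ?M = "hopf_max a G (ennreal c)"
  define E where "E = {x. 0 < ?M n x}"
  have [measurable]: "E \<in> sets borel" unfolding E_def by measurable
  have fin: "(NNINT x. ?M n x) < \<infinity>"
    using False
    by (intro le_less_trans[OF nn_integral_hopf_max_le])
       (simp_all add: ennreal_mult_less_top of_nat_less_top less_top)
  have "ennreal c * emeasure lborel E + (NNINT x. ?M n x) = (NNINT x. ennreal c * indicator E x + ?M n x)"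
    by (subst nn_integral_add) (auto simp: nn_integral_cmult_indicator)
  also have "\<dots> \<le> (NNINT x. G x + ?M n (x + a))"
  proof (intro nn_integral_mono)
    fix x
    show "ennreal c * indicator E x + ?M n x \<le> G x + ?M n (x + a)"
    proof (cases "x \<in> E")
      case True
      then obtain n' where n: "n = Suc n'" by (cases n) (auto simp: E_def)
      let ?b = "G x + ?M n' (x + a)"
      have "0 < ?b - ennreal c" using True by (simp add: E_def n)
      have "ennreal c \<le> ?b"
      proof (rule ccontr)
        assume "\<not> ennreal c \<le> ?b"
        then have lt: "?b < ennreal c" by (simp only: not_le)
        have "?b - ennreal c = 0"
          by (rule diff_eq_0_ennreal[OF less_trans[OF lt ennreal_less_top] less_imp_le[OF lt]])
        with \<open>0 < ?b - ennreal c\<close> show False by simp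
      qed
      then have "?b - ennreal c + ennreal c = ?b" by (rule diff_add_cancel_ennreal)
      then have "ennreal c * indicator E x + ?M n x = ?b" using True by (simp add: n add.commute)
      also have "\<dots> \<le> G x + ?M n (x + a)" unfolding n by (intro add_left_mono hopf_max_mono)
      finally show ?thesis .
    next
      case False
      then have "?M n x = 0" by (simp add: E_def)
      with False show ?thesis by simp
    qed
  qed
  also have "\<dots> = (NNINT x. G x) + (NNINT x. ?M n (x + a))"
    by (rule nn_integral_add) measurable
  also have "(NNINT x. ?M n (x + a)) = (NNINT x. ?M n x)"
    by (rule nn_integral_lborel_shift) measurable
  finally have "ennreal c * emeasure lborel E \<le> (NNINT x. G x)"
    using fin by (metis add.commute ennreal_add_left_cancel_le less_irrefl)
  moreover have "{x. \<exists>k\<le>n. of_nat k * ennreal c < (\<Sum>i<k. G (x + real i *\<^sub>R a))} \<subseteq> E"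
  proof safe
    fix x k assume k: "k \<le> n" "of_nat k * ennreal c < (\<Sum>i<k. G (x + real i *\<^sub>R a))"
    have "of_nat k * ennreal c < ?M n x + of_nat k * ennreal c"
      using hopf_max_ge[OF k(1), of G x a "ennreal c"] k(2) by (rule less_le_trans[rotated])
    then show "x \<in> E" by (cases "?M n x = 0") (auto simp: E_def zero_less_iff_neq_zero)
  qed
  then have "emeasure lborel {x. \<exists>k\<le>n. of_nat k * ennreal c < (\<Sum>i<k. G (x + real i *\<^sub>R a))} \<le> emeasure lborel E"
    by (rule emeasure_mono) simp
  ultimately show ?thesis
    by (meson mult_left_mono order_trans zero_le)
qed simp

definition line_integral :: "'a::real_vector \<Rightarrow> ('a \<Rightarrow> ennreal) \<Rightarrow> real \<Rightarrow> 'a \<Rightarrow> ennreal" where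
  "line_integral z F t x = (NNINT s. F (x + s *\<^sub>R z) * indicator {0..<t} s)"

text \<open>Dyadic times make the supremum in the maximal function countable, hence measurable, and they are
  nested grids, as the discrete inequality above requires.\<close>

definition dyadic :: "nat \<times> nat \<Rightarrow> real" where
  "dyadic p = real (Suc (fst p)) / 2 ^ snd p"

definition line_max :: "'a::real_vector \<Rightarrow> ('a \<Rightarrow> ennreal) \<Rightarrow> 'a \<Rightarrow> ennreal" where
  "line_max z F x = (SUP p. line_integral z F (dyadic p) x / ennreal (dyadic p))"

lemma dyadic_pos: "0 < dyadic p"
  by (simp add: dyadic_def)

lemma borel_measurable_line_integral[measurable (raw)]:
  fixes F :: "'a::euclidean_space \<Rightarrow> ennreal"
  assumes [measurable]: "F \<in> borel_measurable borel" "f \<in> borel_measurable M" "g \<in> borel_measurable M" "t \<in> borel_measurable M"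
  shows "(\<lambda>y. line_integral (f y) F (t y) (g y)) \<in> borel_measurable M"
proof -
  have [measurable]: "(\<lambda>p. indicator {0..<t (fst p)} (snd p) :: ennreal) \<in> borel_measurable (M \<Otimes>\<^sub>M lborel)"
  proof -
    have "(\<lambda>p. indicator {0..<t (fst p)} (snd p) :: ennreal) = (\<lambda>p. if 0 \<le> snd p \<and> snd p < t (fst p) then 1 else 0)"
      by (auto split: split_indicator)
    then show ?thesis by simp
  qed
  show ?thesis unfolding line_integral_def by measurable
qed

lemma borel_measurable_line_max[measurable (raw)]:
  fixes F :: "'a::euclidean_space \<Rightarrow> ennreal"
  assumes [measurable]: "F \<in> borel_measurable borel" "f \<in> borel_measurable M" "g \<in> borel_measurable M"
  shows "(\<lambda>y. line_max (f y) F (g y)) \<in> borel_measurable M"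
  unfolding line_max_def by measurable

lemma line_integral_mono:
  "(\<And>y. F y \<le> G y) \<Longrightarrow> s \<le> t \<Longrightarrow> line_integral z F s x \<le> line_integral z G t x"
  unfolding line_integral_def by (intro nn_integral_mono mult_mono) (auto split: split_indicator)

lemma dyadic_dense:
  assumes "0 < s" "s < t" shows "\<exists>p. s < dyadic p \<and> dyadic p < t"
proof -
  obtain m where m: "1 / (t - s) < 2 ^ m"
    using real_arch_pow[of 2 "1 / (t - s)"] by auto
  then have m': "1 < (t - s) * 2 ^ m" using assms by (simp add: field_simps)
  define k where "k = nat \<lfloor>s * 2 ^ m\<rfloor>"
  have "real k \<le> s * 2 ^ m" "s * 2 ^ m < real k + 1"
    using assms unfolding k_def by (auto simp: of_nat_floor)
  then have "s < dyadic (k, m)" "dyadic (k, m) < t"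
    using m' by (auto simp: dyadic_def field_simps)
  then show ?thesis by blast
qed

lemma ennreal_le_mult_of_divide_le:
  assumes "a / ennreal d \<le> b" "0 < d" shows "a \<le> ennreal d * b"
proof -
  have "a = ennreal d * (a / ennreal d)"
    using assms(2) by (simp add: ennreal_times_divide ennreal_mult_divide_eq mult.commute)
  also have "\<dots> \<le> ennreal d * b" by (rule mult_left_mono[OF assms(1)]) simp
  finally show ?thesis .
qed

text \<open>The supremum over dyadic times controls all times, because the integral is monotone in its length.\<close>

lemma line_integral_le_line_max:
  assumes t: "0 < t"
  shows "line_integral z F t x \<le> ennreal t * line_max z F x"
proof (cases "line_max z F x")
  case top then show ?thesis using t by (simp add: ennreal_mult_top)
next
  case (real m)
  have *: "line_integral z F t x \<le> ennreal (dyadic p * m)" if "t < dyadic p" for p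
  proof -
    have "line_integral z F t x \<le> line_integral z F (dyadic p) x"
      using that by (intro line_integral_mono) auto
    also have "line_integral z F (dyadic p) x / ennreal (dyadic p) \<le> line_max z F x"
      unfolding line_max_def by (rule SUP_upper) simp
    then have "line_integral z F (dyadic p) x \<le> ennreal (dyadic p) * line_max z F x"
      by (rule ennreal_le_mult_of_divide_le[OF _ dyadic_pos])
    finally show ?thesis using real dyadic_pos[of p] by (simp add: ennreal_mult)
  qed
  obtain p where "t < dyadic p" using dyadic_dense[of t "t + 1"] t by auto
  then obtain i where i: "line_integral z F t x = ennreal i" "0 \<le> i"
    using *[of p] by (cases "line_integral z F t x") (auto simp: top_unique)
  have "i \<le> t * m"
  proof (rule ccontr)
    assume "\<not> i \<le> t * m"
    then have lt: "t * m < i" by simp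
    show False
    proof (cases "m = 0")
      case True
      with lt *[OF \<open>t < dyadic p\<close>] i show False by simp
    next
      case False
      then have "0 < m" using real by simp
      then have "t < i / m" using lt by (simp add: field_simps)
      then obtain q where q: "t < dyadic q" "dyadic q < i / m" using dyadic_dense t by blast
      then have "i \<le> dyadic q * m" using *[of q] i real dyadic_pos[of q] by simp
      with q \<open>0 < m\<close> show False by (simp add: field_simps)
    qed
  qed
  then show ?thesis using i real t by (simp add: ennreal_mult[symmetric])
qed

lemma line_integral_of_nat_mult:
  fixes F :: "'a::euclidean_space \<Rightarrow> ennreal"
  assumes [measurable]: "F \<in> borel_measurable borel" and "0 < \<eta>"
  shows "line_integral z F (real k * \<eta>) x = (\<Sum>i<k. line_integral z F \<eta> (x + real i *\<^sub>R (\<eta> *\<^sub>R z)))"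
proof (induction k)
  case 0 then show ?case by (simp add: line_integral_def)
next
  case (Suc k)
  have "line_integral z F (real (Suc k) * \<eta>) x =
    (NNINT s. F (x + s *\<^sub>R z) * indicator {0..<real k * \<eta>} s + F (x + s *\<^sub>R z) * indicator {real k * \<eta>..<real (Suc k) * \<eta>} s)"
    unfolding line_integral_def
  proof (intro nn_integral_cong)
    fix s
    have "0 \<le> real k * \<eta>" "real (Suc k) * \<eta> = real k * \<eta> + \<eta>" using assms(2) by (auto simp: algebra_simps)
    then show "F (x + s *\<^sub>R z) * indicator {0..<real (Suc k) * \<eta>} s =
         F (x + s *\<^sub>R z) * indicator {0..<real k * \<eta>} s + F (x + s *\<^sub>R z) * indicator {real k * \<eta>..<real (Suc k) * \<eta>} s"
      using assms(2) order_trans[of 0 "real k * \<eta>" s] by (auto split: split_indicator)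
  qed
  also have "\<dots> = line_integral z F (real k * \<eta>) x + (NNINT s. F (x + s *\<^sub>R z) * indicator {real k * \<eta>..<real (Suc k) * \<eta>} s)"
    unfolding line_integral_def by (rule nn_integral_add) measurable
  also have "(NNINT s. F (x + s *\<^sub>R z) * indicator {real k * \<eta>..<real (Suc k) * \<eta>} s)
     = (NNINT s. F (x + (s + real k * \<eta>) *\<^sub>R z) * indicator {real k * \<eta>..<real (Suc k) * \<eta>} (s + real k * \<eta>))"
    by (rule nn_integral_lborel_shift[symmetric]) measurable
  also have "\<dots> = line_integral z F \<eta> (x + real k *\<^sub>R (\<eta> *\<^sub>R z))"
    unfolding line_integral_def
    by (intro nn_integral_cong) (auto split: split_indicator simp: algebra_simps)
  finally show ?case using Suc by simp
qed

lemma nn_integral_line_integral: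
  fixes F :: "'a::euclidean_space \<Rightarrow> ennreal"
  assumes [measurable]: "F \<in> borel_measurable borel" and "0 \<le> t"
  shows "(NNINT x. line_integral z F t x) = ennreal t * (NNINT x. F x)"
proof -
  have "(NNINT x. line_integral z F t x) = (NNINT s x. F (x + s *\<^sub>R z) * indicator {0..<t} s)"
    unfolding line_integral_def by (rule lborel_pair.Fubini') measurable
  also have "\<dots> = (NNINT s. (NNINT x. F x) * indicator {0..<t} s)"
    by (simp add: nn_integral_multc nn_integral_lborel_shift)
  also have "\<dots> = ennreal t * (NNINT x. F x)"
    using assms(2) by (subst nn_integral_cmult_indicator) (auto simp: mult.commute)
  finally show ?thesis .
qed

text \<open>On the grid of mesh \<open>1 / 2 ^ m\<close> the averages are ergodic averages of the integral over one cell, so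
  the discrete inequality applies with a bound that depends neither on \<open>m\<close> nor on the number of steps.
  The union over finer and finer grids is increasing.\<close>

lemma line_max_weak_type:
  fixes F :: "'a::euclidean_space \<Rightarrow> ennreal"
  assumes [measurable]: "F \<in> borel_measurable borel" and l: "0 < l"
  shows "ennreal l * emeasure lborel {x. ennreal l < line_max z F x} \<le> (NNINT x. F x)"
proof -
  define E where "E m n = {x. \<exists>k\<le>n. ennreal (l * (real k / 2 ^ m)) < line_integral z F (real k / 2 ^ m) x}" for m n :: nat
  have [measurable]: "E m n \<in> sets borel" for m n unfolding E_def by measurable
  have bd: "ennreal l * emeasure lborel (E m n) \<le> (NNINT x. F x)" for m n
  proof -
    define \<eta> :: real where "\<eta> = 1 / 2 ^ m"
    have \<eta>: "0 < \<eta>" by (simp add: \<eta>_def)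
    have "ennreal (l * \<eta>) * emeasure lborel {x. \<exists>k\<le>n. of_nat k * ennreal (l * \<eta>) < (\<Sum>i<k. line_integral z F \<eta> (x + real i *\<^sub>R (\<eta> *\<^sub>R z)))}
       \<le> (NNINT x. line_integral z F \<eta> x)"
      by (rule hopf_maximal_inequality) measurable
    also have "\<dots> = ennreal \<eta> * (NNINT x. F x)" using \<eta> by (intro nn_integral_line_integral) auto
    also have "{x. \<exists>k\<le>n. of_nat k * ennreal (l * \<eta>) < (\<Sum>i<k. line_integral z F \<eta> (x + real i *\<^sub>R (\<eta> *\<^sub>R z)))} = E m n"
    proof -
      have "of_nat k * ennreal (l * \<eta>) = ennreal (l * (real k / 2 ^ m))" for k
        using l by (simp add: \<eta>_def ennreal_of_nat_eq_real_of_nat ennreal_mult[symmetric] mult.commute)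
      moreover have "(\<Sum>i<k. line_integral z F \<eta> (x + real i *\<^sub>R (\<eta> *\<^sub>R z))) = line_integral z F (real k / 2 ^ m) x" for k x
        using line_integral_of_nat_mult[of F \<eta> z k x] \<eta> by (simp add: \<eta>_def)
      ultimately show ?thesis unfolding E_def by simp
    qed
    finally have "ennreal \<eta> * (ennreal l * emeasure lborel (E m n)) \<le> ennreal \<eta> * (NNINT x. F x)"
      using l \<eta> by (simp add: ennreal_mult ac_simps)
    then show ?thesis using \<eta> by (subst (asm) ennreal_mult_le_mult_iff) auto
  qed
  \<comment> \<open>Halving the mesh doubles the number of steps that reach the same time.\<close>
  have inc: "E m n \<subseteq> E (Suc m) (2 * n)" for m n
  proof
    fix x assume "x \<in> E m n"
    then obtain k where k: "k \<le> n" "ennreal (l * (real k / 2 ^ m)) < line_integral z F (real k / 2 ^ m) x"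
      unfolding E_def by auto
    have "real (2 * k) / 2 ^ Suc m = real k / 2 ^ m" by simp
    then have "ennreal (l * (real (2 * k) / 2 ^ Suc m)) < line_integral z F (real (2 * k) / 2 ^ Suc m) x"
      using k(2) by (simp only:)
    then show "x \<in> E (Suc m) (2 * n)" unfolding E_def using k(1) by (auto intro!: exI[of _ "2 * k"])
  qed
  have En: "E m n \<subseteq> E m n'" if "n \<le> n'" for m n n' using that unfolding E_def by (auto intro: order_trans)
  \<comment> \<open>Grid and time horizon grow together, so that the sets increase.\<close>
  define H where "H m = E m (m * 2 ^ m)" for m
  have [measurable]: "H m \<in> sets borel" for m by (simp add: H_def)
  have "incseq H"
  proof (rule incseq_SucI)
    fix m show "H m \<subseteq> H (Suc m)"
      unfolding H_def by (rule order_trans[OF inc En]) simp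
  qed
  have "{x. ennreal l < line_max z F x} \<subseteq> (\<Union>m. H m)"
  proof safe
    fix x assume "ennreal l < line_max z F x"
    then obtain p where p: "ennreal l < line_integral z F (dyadic p) x / ennreal (dyadic p)"
      unfolding line_max_def by (auto simp: less_SUP_iff)
    have "ennreal (l * dyadic p) < line_integral z F (dyadic p) x"
    proof (rule ccontr)
      assume "\<not> ?thesis"
      then have "line_integral z F (dyadic p) x \<le> ennreal l * ennreal (dyadic p)"
        using l dyadic_pos[of p] by (simp add: ennreal_mult)
      then have "line_integral z F (dyadic p) x / ennreal (dyadic p) \<le> ennreal l"
        using dyadic_pos[of p] by (intro divide_le_posI_ennreal) (auto simp: mult.commute)
      with p show False by simp
    qed
    then have x: "x \<in> E (snd p) (Suc (fst p))" unfolding E_def dyadic_def by auto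
    have up: "x \<in> E (snd p + j) (Suc (fst p) * 2 ^ j)" for j
    proof (induction j)
      case (Suc j)
      then have "x \<in> E (Suc (snd p + j)) (2 * (Suc (fst p) * 2 ^ j))" using inc by blast
      then show ?case by (simp add: ac_simps)
    qed (use x in simp)
    \<comment> \<open>Refine the grid until the horizon of the corresponding \<open>H\<close> exceeds the time of \<open>p\<close>.\<close>
    let ?j = "Suc (fst p)"
    have "Suc (fst p) * 2 ^ ?j \<le> (snd p + ?j) * 2 ^ (snd p + ?j)"
      by (intro mult_mono power_increasing) auto
    then have "x \<in> H (snd p + ?j)" unfolding H_def using up[of ?j] En by blast
    then show "x \<in> (\<Union>m. H m)" by blast
  qed
  then have "ennreal l * emeasure lborel {x. ennreal l < line_max z F x} \<le> ennreal l * emeasure lborel (\<Union>m. H m)"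
    by (intro mult_left_mono emeasure_mono) auto
  also have "emeasure lborel (\<Union>m. H m) = (SUP m. emeasure lborel (H m))"
    using \<open>incseq H\<close> by (intro SUP_emeasure_incseq[symmetric]) auto
  also have "ennreal l * \<dots> = (SUP m. ennreal l * emeasure lborel (H m))"
    by (rule SUP_mult_left_ennreal)
  also have "\<dots> \<le> (NNINT x. F x)"
    unfolding H_def by (intro SUP_least bd)
  finally show ?thesis .
qed

text \<open>The part of \<open>F\<close> below \<open>l / 2\<close> contributes at most \<open>l / 2\<close> to any average. Keeping only the large
  values of \<open>F\<close> on the right is what lets the level be integrated afterwards.\<close>

lemma line_max_weak_type_truncated:
  fixes F :: "'a::euclidean_space \<Rightarrow> real"
  assumes [measurable]: "F \<in> borel_measurable borel" and l: "0 < l" and F: "\<And>x. 0 \<le> F x"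
  shows "ennreal l * emeasure lborel {x. ennreal l < line_max z (\<lambda>x. ennreal (F x)) x}
    \<le> 2 * (NNINT x. ennreal (F x) * indicator {x. l / 2 < F x} x)"
proof -
  let ?F = "\<lambda>x. ennreal (F x)" and ?G = "\<lambda>x. ennreal (F x) * indicator {x. l / 2 < F x} x"
  have [measurable]: "?G \<in> borel_measurable borel" by measurable
  have le: "?F x \<le> ?G x + ennreal (l / 2)" for x
    by (auto split: split_indicator intro!: ennreal_leI)
  have "line_max z ?F x \<le> line_max z ?G x + ennreal (l / 2)" for x
    unfolding line_max_def[of z ?F]
  proof (rule SUP_least)
    fix p
    have pos: "0 < dyadic p" by (rule dyadic_pos)
    have "line_integral z ?F (dyadic p) x \<le> (NNINT s. ?G (x + s *\<^sub>R z) * indicator {0..<dyadic p} s + ennreal (l / 2) * indicator {0..<dyadic p} s)"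
      unfolding line_integral_def using le by (intro nn_integral_mono) (auto split: split_indicator)
    also have "\<dots> = line_integral z ?G (dyadic p) x + ennreal (l / 2) * ennreal (dyadic p)"
      unfolding line_integral_def
      by (subst nn_integral_add) (use pos in \<open>auto simp: nn_integral_cmult_indicator\<close>)
    finally have "line_integral z ?F (dyadic p) x / ennreal (dyadic p) \<le> (line_integral z ?G (dyadic p) x + ennreal (l / 2) * ennreal (dyadic p)) / ennreal (dyadic p)"
      by (rule divide_right_mono_ennreal)
    also have "\<dots> = line_integral z ?G (dyadic p) x / ennreal (dyadic p) + ennreal (l / 2)"
      using pos by (simp add: add_divide_distrib_ennreal ennreal_mult_divide_eq)
    also have "\<dots> \<le> line_max z ?G x + ennreal (l / 2)"
      unfolding line_max_def[of z ?G] by (intro add_right_mono SUP_upper) simp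
    finally show "line_integral z ?F (dyadic p) x / ennreal (dyadic p) \<le> line_max z ?G x + ennreal (l / 2)" .
  qed
  then have sub: "{x. ennreal l < line_max z ?F x} \<subseteq> {x. ennreal (l / 2) < line_max z ?G x}"
  proof safe
    fix x assume *: "\<And>x. line_max z ?F x \<le> line_max z ?G x + ennreal (l / 2)" and x: "ennreal l < line_max z ?F x"
    show "ennreal (l / 2) < line_max z ?G x"
    proof (rule ccontr)
      assume "\<not> ?thesis"
      then have "line_max z ?F x \<le> ennreal (l / 2) + ennreal (l / 2)" 
        by (intro order_trans[OF *] add_right_mono) simp
      also have "\<dots> = ennreal l" using l by (subst ennreal_plus[symmetric]) auto
      finally show False using x by simp
    qed
  qed
  have "ennreal l * emeasure lborel {x. ennreal l < line_max z ?F x} \<le> ennreal l * emeasure lborel {x. ennreal (l / 2) < line_max z ?G x}"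
    by (intro mult_left_mono emeasure_mono sub) auto
  also have "\<dots> = 2 * ennreal (l / 2) * emeasure lborel {x. ennreal (l / 2) < line_max z ?G x}"
    using l ennreal_mult[of 2 "l / 2"] by simp
  also have "2 * ennreal (l / 2) * emeasure lborel {x. ennreal (l / 2) < line_max z ?G x} \<le> 2 * (NNINT x. ?G x)"
    unfolding mult.assoc using l by (intro mult_left_mono line_max_weak_type) auto
  finally show ?thesis .
qed

text \<open>Marcinkiewicz interpolation carried out directly. For fixed \<open>z\<close> use the weak type inequality at level
  \<open>1 / norm z\<close>. Integrating in \<open>z\<close> first, the large values of \<open>F\<close> at \<open>x\<close> are those for which
  \<open>1 < 2 * F x * norm z\<close>, and the integral over this set of \<open>z\<close> is proportional to \<open>F x\<close>.\<close>

lemma line_max_strong_type: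
  fixes F :: "'a::euclidean_space \<Rightarrow> real"
  assumes [measurable]: "F \<in> borel_measurable borel" and F: "\<And>x. 0 \<le> F x"
  shows "(NNINT x z. indicator {z. 1 < ennreal (norm z) * line_max z (\<lambda>x. ennreal (F x)) x} z * ennreal (1 / norm z ^ (DIM('a) + 2)))
   \<le> ennreal (4 * (real DIM('a) * measure lborel (ball (0::'a) 1))) * (NNINT x. ennreal ((F x)\<^sup>2))"
proof -
  let ?F = "\<lambda>x. ennreal (F x)" and ?N = "DIM('a)"
  define K where "K = real DIM('a) * measure lborel (ball (0::'a) 1)"
  have "(NNINT x z. indicator {z. 1 < ennreal (norm z) * line_max z ?F x} z * ennreal (1 / norm z ^ (?N + 2)))
    = (NNINT z x. indicator {z. 1 < ennreal (norm z) * line_max z ?F x} z * ennreal (1 / norm z ^ (?N + 2)))"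
    by (rule lborel_pair.Fubini') measurable
  also have "\<dots> \<le> (NNINT (z::'a) x. ennreal (2 * F x) * (indicator {z. 1 < (2 * F x) * norm z} z * ennreal (1 / norm z ^ (?N + 1))))"
  proof (rule nn_integral_mono)
    fix z :: 'a
    show "(NNINT x. indicator {z. 1 < ennreal (norm z) * line_max z ?F x} z * ennreal (1 / norm z ^ (?N + 2)))
      \<le> (NNINT x. ennreal (2 * F x) * (indicator {z. 1 < (2 * F x) * norm z} z * ennreal (1 / norm z ^ (?N + 1))))"
    proof (cases "z = 0")
      case False
      define l where "l = 1 / norm z"
      have l: "0 < l" using False by (simp add: l_def)
      have iff: "1 < ennreal (norm z) * m \<longleftrightarrow> ennreal l < m" for m
      proof (cases m)
        case (real r)
        then show ?thesis using False by (simp add: l_def ennreal_mult[symmetric] field_simps ennreal_less_iff flip: ennreal_1)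
      qed (use False in \<open>simp add: l_def ennreal_mult_top\<close>)
      have "(NNINT x. indicator {z. 1 < ennreal (norm z) * line_max z ?F x} z * ennreal (1 / norm z ^ (?N + 2)))
         = (NNINT x. ennreal (1 / norm z ^ (?N + 2)) * indicator {x. ennreal l < line_max z ?F x} x)"
        by (intro nn_integral_cong) (simp add: iff split: split_indicator)
      also have "\<dots> = ennreal (1 / norm z ^ (?N + 2)) * emeasure lborel {x. ennreal l < line_max z ?F x}"
        by (rule nn_integral_cmult_indicator) measurable
      also have "\<dots> = ennreal (1 / norm z ^ (?N + 1)) * ennreal l * emeasure lborel {x. ennreal l < line_max z ?F x}"
        by (subst ennreal_mult[symmetric]) (auto simp: l_def ac_simps)
      also have "ennreal (1 / norm z ^ (?N + 1)) * ennreal l * emeasure lborel {x. ennreal l < line_max z ?F x}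
         \<le> ennreal (1 / norm z ^ (?N + 1)) * (2 * (NNINT x. ?F x * indicator {x. l / 2 < F x} x))"
        unfolding mult.assoc using F l by (intro mult_left_mono line_max_weak_type_truncated) auto
      also have "\<dots> = (NNINT x. ennreal (1 / norm z ^ (?N + 1)) * (2 * (?F x * indicator {x. l / 2 < F x} x)))"
        by (simp add: nn_integral_cmult)
      also have "\<dots> = (NNINT x. ennreal (2 * F x) * (indicator {z. 1 < (2 * F x) * norm z} z * ennreal (1 / norm z ^ (?N + 1))))"
      proof (intro nn_integral_cong)
        fix x
        have "l / 2 < F x \<longleftrightarrow> 1 < (2 * F x) * norm z" using False by (simp add: l_def field_simps)
        then show "ennreal (1 / norm z ^ (?N + 1)) * (2 * (?F x * indicator {x. l / 2 < F x} x)) =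
           ennreal (2 * F x) * (indicator {z. 1 < (2 * F x) * norm z} z * ennreal (1 / norm z ^ (?N + 1)))"
          using F[of x] by (simp add: ennreal_mult ac_simps split: split_indicator)
      qed
      finally show ?thesis .
    qed simp
  qed
  also have "\<dots> = (NNINT x (z::'a). ennreal (2 * F x) * (indicator {z. 1 < (2 * F x) * norm z} z * ennreal (1 / norm z ^ (?N + 1))))"
    by (rule lborel_pair.Fubini') measurable
  also have "\<dots> = (NNINT x. ennreal (4 * K) * ennreal ((F x)\<^sup>2))"
  proof (intro nn_integral_cong)
    fix x
    have "(NNINT z. ennreal (2 * F x) * (indicator {z::'a. 1 < (2 * F x) * norm z} z * ennreal (1 / norm z ^ (?N + 1))))
      = ennreal (2 * F x) * (NNINT z. indicator {z::'a. 1 < (2 * F x) * norm z} z * ennreal (1 / norm z ^ (?N + 1)))"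
      by (rule nn_integral_cmult) measurable
    also have "\<dots> = ennreal (2 * F x) * ennreal ((2 * F x) ^ 1 * (real DIM('a) / real 1 * measure lborel (ball (0::'a) 1)))"
      using F[of x] by (subst nn_integral_norm_superlevel) auto
    also have "\<dots> = ennreal (4 * K) * ennreal ((F x)\<^sup>2)"
      using F[of x] by (simp add: ennreal_mult[symmetric] K_def power2_eq_square ac_simps)
    finally show "(NNINT z. ennreal (2 * F x) * (indicator {z::'a. 1 < (2 * F x) * norm z} z * ennreal (1 / norm z ^ (?N + 1))))
      = ennreal (4 * K) * ennreal ((F x)\<^sup>2)" .
  qed
  also have "\<dots> = ennreal (4 * K) * (NNINT x. ennreal ((F x)\<^sup>2))"
    by (rule nn_integral_cmult) measurable
  finally show ?thesis unfolding K_def .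
qed

section \<open>Smooth approximations of boxes\<close>

text \<open>Powers of \<open>t\<close> in the denominator are included so that the family is closed under differentiation.\<close>

definition bump :: "real \<Rightarrow> nat \<Rightarrow> real \<Rightarrow> real" where
  "bump c k t = (if 0 < t then exp (- c / t) / t ^ k else 0)"

lemma bump_tendsto_0:
  assumes "0 < c" shows "(bump c k \<longlongrightarrow> 0) (at 0)"
proof -
  have "((\<lambda>y::real. y ^ k / exp y) \<longlongrightarrow> 0) at_top" by (rule tendsto_power_div_exp_0)
  then have "((\<lambda>y. 1 / c ^ k * (y ^ k / exp y)) \<longlongrightarrow> 1 / c ^ k * 0) at_top"
    by (intro tendsto_intros)
  moreover have "filterlim (\<lambda>t. c * inverse t) at_top (at_right (0::real))"
    using assms by (intro filterlim_tendsto_pos_mult_at_top[OF tendsto_const] filterlim_inverse_at_top_right)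
  ultimately have "((\<lambda>t. 1 / c ^ k * ((c * inverse t) ^ k / exp (c * inverse t))) \<longlongrightarrow> 0) (at_right 0)"
    by (auto dest: filterlim_compose)
  then have "(bump c k \<longlongrightarrow> 0) (at_right 0)"
  proof (rule Lim_transform_eventually)
    show "\<forall>\<^sub>F t in at_right 0. 1 / c ^ k * ((c * inverse t) ^ k / exp (c * inverse t)) = bump c k t"
      using eventually_at_right_less[of 0]
    proof eventually_elim
      case (elim t)
      then show ?case using assms by (simp add: bump_def exp_minus field_simps)
    qed
  qed
  moreover have "(bump c k \<longlongrightarrow> 0) (at_left 0)"
  proof (rule Lim_transform_eventually[OF tendsto_const])
    show "\<forall>\<^sub>F t in at_left 0. 0 = bump c k t"
      unfolding eventually_at_left_field by (rule exI[of _ "-1"]) (auto simp: bump_def)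
  qed
  ultimately show ?thesis by (simp add: filterlim_at_split)
qed

lemma DERIV_bump:
  assumes "0 < c"
  shows "(bump c k has_real_derivative (c * bump c (k + 2) t - real k * bump c (k + 1) t)) (at t)"
proof (cases t "0::real" rule: linorder_cases)
  case less
  have "(bump c k has_real_derivative 0) (at t)"
  proof (rule DERIV_cong_ev[THEN iffD1, OF refl _ refl DERIV_const])
    show "\<forall>\<^sub>F x in nhds t. 0 = bump c k x"
      using less by (auto simp: eventually_nhds bump_def intro!: exI[of _ "{..<0}"])
  qed
  then show ?thesis using less by (simp add: bump_def)
next
  case equal
  have "(\<lambda>h. (bump c k (0 + h) - bump c k 0) / h) = bump c (k + 1)"
    by (auto simp: bump_def fun_eq_iff)
  then have "(bump c k has_real_derivative 0) (at 0)"
    unfolding DERIV_def using bump_tendsto_0[OF assms, of "k + 1"] by simp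
  then show ?thesis using equal by (simp add: bump_def)
next
  case greater
  have "((\<lambda>t. exp (- c / t) / t ^ k) has_real_derivative (c * bump c (k + 2) t - real k * bump c (k + 1) t)) (at t)"
  proof -
    have "((\<lambda>t. exp (- c / t)) has_real_derivative exp (- c / t) * (c / t\<^sup>2)) (at t)"
      using greater by (auto intro!: derivative_eq_intros simp: field_simps power2_eq_square)
    moreover have "((\<lambda>t. t ^ k) has_real_derivative real k * t ^ (k - 1)) (at t)"
      using DERIV_pow[of k t] by simp
    ultimately have "((\<lambda>t. exp (- c / t) / t ^ k) has_real_derivative
        (exp (- c / t) * (c / t\<^sup>2) * t ^ k - exp (- c / t) * (real k * t ^ (k - 1))) / (t ^ k * t ^ k)) (at t)"
      using greater by (intro DERIV_divide) auto
    also have "(exp (- c / t) * (c / t\<^sup>2) * t ^ k - exp (- c / t) * (real k * t ^ (k - 1))) / (t ^ k * t ^ k)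
       = c * bump c (k + 2) t - real k * bump c (k + 1) t"
      using greater by (cases k) (simp_all add: bump_def field_simps power2_eq_square)
    finally show ?thesis .
  qed
  then show ?thesis
  proof (rule DERIV_cong_ev[THEN iffD1, OF refl _ refl, rotated])
    show "\<forall>\<^sub>F x in nhds t. exp (- c / x) / x ^ k = bump c k x"
      using greater by (auto simp: eventually_nhds bump_def intro!: exI[of _ "{0<..}"])
  qed
qed

text \<open>A class that contains the bumps and all their iterated partial derivatives, since each generator has
  partial derivatives that are again in the class.\<close>

inductive_set smooth_class :: "(real^'n \<Rightarrow> real) set" where
  const: "(\<lambda>x. a) \<in> smooth_class"
| coord: "(\<lambda>x. x $ i) \<in> smooth_class"
| add: "f \<in> smooth_class \<Longrightarrow> g \<in> smooth_class \<Longrightarrow> (\<lambda>x. f x + g x) \<in> smooth_class"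
| mult: "f \<in> smooth_class \<Longrightarrow> g \<in> smooth_class \<Longrightarrow> (\<lambda>x. f x * g x) \<in> smooth_class"
| bump: "f \<in> smooth_class \<Longrightarrow> 0 < c \<Longrightarrow> (\<lambda>x. bump c k (f x)) \<in> smooth_class"

lemma smooth_class_derivative:
  fixes f :: "real^'n \<Rightarrow> real"
  assumes "f \<in> smooth_class"
  shows "\<exists>d::'n \<Rightarrow> _. (\<forall>j. d j \<in> smooth_class) \<and> (\<forall>x. (f has_derivative (\<lambda>h. \<Sum>j\<in>UNIV. d j x * h $ j)) (at x))"
  using assms
proof induction
  case (const a)
  show ?case by (rule exI[of _ "\<lambda>j x. 0"]) (auto intro: smooth_class.const)
next
  case (coord i)
  have eq: "(\<Sum>j\<in>UNIV. (if j = i then 1 else 0) * h $ j) = h $ i" for h :: "real^'n"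
    by (simp add: if_distrib[of "\<lambda>a. a * _"] cong: if_cong)
  show ?case
    by (rule exI[of _ "\<lambda>j x. if j = i then 1 else 0"])
       (auto intro: smooth_class.const simp: eq intro!: bounded_linear_imp_has_derivative bounded_linear_vec_nth)
next
  case (add f g)
  then obtain d e where d: "\<And>j. d j \<in> smooth_class" "\<And>x. (f has_derivative (\<lambda>h. \<Sum>j\<in>UNIV. d j x * h $ j)) (at x)"
    and e: "\<And>j. e j \<in> smooth_class" "\<And>x. (g has_derivative (\<lambda>h. \<Sum>j\<in>UNIV. e j x * h $ j)) (at x)" by blast
  show ?case
  proof (intro exI[of _ "\<lambda>j x. d j x + e j x"] conjI allI)
    show "((\<lambda>x. f x + g x) has_derivative (\<lambda>h. \<Sum>j\<in>UNIV. (d j x + e j x) * h $ j)) (at x)" for x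
      using has_derivative_add[OF d(2) e(2), of x] by (simp add: distrib_right sum.distrib)
  qed (intro smooth_class.add d e)
next
  case (mult f g)
  then obtain d e where d: "\<And>j. d j \<in> smooth_class" "\<And>x. (f has_derivative (\<lambda>h. \<Sum>j\<in>UNIV. d j x * h $ j)) (at x)"
    and e: "\<And>j. e j \<in> smooth_class" "\<And>x. (g has_derivative (\<lambda>h. \<Sum>j\<in>UNIV. e j x * h $ j)) (at x)" by blast
  show ?case
  proof (intro exI[of _ "\<lambda>j x. f x * e j x + d j x * g x"] conjI allI)
    show "((\<lambda>x. f x * g x) has_derivative (\<lambda>h. \<Sum>j\<in>UNIV. (f x * e j x + d j x * g x) * h $ j)) (at x)" for x
      using has_derivative_mult[OF d(2) e(2), of x]
      by (simp add: distrib_right distrib_left sum.distrib sum_distrib_left sum_distrib_right ac_simps)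
  qed (intro smooth_class.add smooth_class.mult d e mult.hyps)
next
  case (bump f c k)
  then obtain d where d: "\<And>j. d j \<in> smooth_class" "\<And>x. (f has_derivative (\<lambda>h. \<Sum>j\<in>UNIV. d j x * h $ j)) (at x)" by blast
  let ?b = "\<lambda>x. c * bump c (k + 2) (f x) + (- real k) * bump c (k + 1) (f x)"
  show ?case
  proof (intro exI[of _ "\<lambda>j x. ?b x * d j x"] conjI allI)
    show "((\<lambda>x. bump c k (f x)) has_derivative (\<lambda>h. \<Sum>j\<in>UNIV. (?b x * d j x) * h $ j)) (at x)" for x
      using has_derivative_compose[OF d(2)[of x] DERIV_bump[OF \<open>0 < c\<close>, of k "f x", THEN has_field_derivative_imp_has_derivative]]
      by (simp add: sum_distrib_left sum_distrib_right ac_simps)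
  qed (intro smooth_class.add smooth_class.mult smooth_class.const smooth_class.bump d bump.hyps)
qed

lemma smooth_class_partial:
  fixes f :: "real^'n \<Rightarrow> real"
  assumes "f \<in> smooth_class"
  shows "partial_deriv j f \<in> smooth_class" "f differentiable (at x)"
    "(f has_derivative (\<lambda>h. \<Sum>j\<in>UNIV. partial_deriv j f x * h $ j)) (at x)"
proof -
  obtain d where d: "\<And>j. d j \<in> smooth_class" "\<And>x. (f has_derivative (\<lambda>h. \<Sum>j\<in>UNIV. d j x * h $ j)) (at x)"
    using smooth_class_derivative[OF assms] by blast
  have "frechet_derivative f (at x) = (\<lambda>h. \<Sum>j\<in>UNIV. d j x * h $ j)" for x
    using frechet_derivative_at[OF d(2)[of x]] by simp
  then have p: "partial_deriv j f = d j" for j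
    by (auto simp: partial_deriv_def fun_eq_iff axis_def if_distrib[of "\<lambda>a. _ * a"] cong: if_cong)
  show "partial_deriv j f \<in> smooth_class" "(f has_derivative (\<lambda>h. \<Sum>j\<in>UNIV. partial_deriv j f x * h $ j)) (at x)"
    using d by (simp_all add: p)
  show "f differentiable (at x)" using d(2) by (auto simp: differentiable_def)
qed

lemma smooth_class_C_k: "f \<in> smooth_class \<Longrightarrow> C_k k f"
proof (induction k arbitrary: f)
  case 0
  then show ?case
    using smooth_class_partial(2)[OF 0]
    by (auto intro!: continuous_at_imp_continuous_on differentiable_imp_continuous_within)
next
  case (Suc k)
  then show ?case
    using smooth_class_partial by (auto simp: differentiable_on_def intro: differentiable_at_withinI)
qed

lemma smooth_class_prod:
  "finite I \<Longrightarrow> (\<And>i. i \<in> I \<Longrightarrow> f i \<in> smooth_class) \<Longrightarrow> (\<lambda>x. \<Prod>i\<in>I. f i x) \<in> smooth_class"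
  by (induction I rule: finite_induct) (auto intro: smooth_class.intros)

text \<open>On the box each factor is \<open>exp (- 1 / (n + 1) / t)\<close> with \<open>t > 0\<close>, so the product increases to \<open>1\<close>
  there as \<open>n\<close> grows. If one difference is negative, the other one is positive, and the factor is \<open>0\<close>.\<close>

definition box_bump :: "real^'n \<Rightarrow> real^'n \<Rightarrow> nat \<Rightarrow> real^'n \<Rightarrow> real" where
  "box_bump a b n x = (\<Prod>i\<in>UNIV. bump (1 / real (Suc n)) 0 ((x $ i - a $ i) * (b $ i - x $ i)))"

lemma box_bump_smooth:
  fixes a b :: "real^'n"
  shows "box_bump a b n \<in> smooth_class"
proof -
  have "(\<lambda>x. (x $ i - a $ i) * (b $ i - x $ i)) \<in> (smooth_class :: (real^'n \<Rightarrow> real) set)" for i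
  proof -
    have "(\<lambda>x. (x $ i + (- (a $ i))) * (b $ i + (-1) * x $ i)) \<in> (smooth_class :: (real^'n \<Rightarrow> real) set)"
      by (intro smooth_class.intros)
    then show ?thesis by simp
  qed
  then show ?thesis
    unfolding box_bump_def[abs_def] by (intro smooth_class_prod smooth_class.bump) auto
qed

lemma box_bump_outside:
  assumes "box a b \<noteq> {}" "x \<notin> box a b" shows "box_bump a b n x = 0"
proof -
  from assms(2) obtain i where i: "\<not> (a $ i < x $ i \<and> x $ i < b $ i)" by (auto simp: mem_box_cart)
  have ab: "a $ i < b $ i" using assms(1) by (auto simp: mem_box_cart) (meson less_trans)
  have "(x $ i - a $ i) * (b $ i - x $ i) \<le> 0"
    using i ab by (auto simp: mult_le_0_iff)
  then have "bump (1 / real (Suc n)) 0 ((x $ i - a $ i) * (b $ i - x $ i)) = 0" by (simp add: bump_def)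
  then show ?thesis unfolding box_bump_def by (intro prod_zero) auto
qed

lemma box_bump_bounds: "0 \<le> box_bump a b n x" "box_bump a b n x \<le> 1"
  unfolding box_bump_def by (auto intro!: prod_nonneg prod_le_1 simp: bump_def)

lemma box_bump_tendsto:
  fixes a b :: "real^'n"
  assumes "box a b \<noteq> {}"
  shows "(\<lambda>n. box_bump a b n x) \<longlonglongrightarrow> indicator (box a b) x"
proof (cases "x \<in> box a b")
  case True
  have "(\<lambda>n. \<Prod>i\<in>UNIV. bump (1 / real (Suc n)) 0 ((x $ i - a $ i) * (b $ i - x $ i))) \<longlonglongrightarrow> (\<Prod>i\<in>(UNIV::'n set). 1)"
  proof (rule tendsto_prod)
    fix i
    have pos: "0 < (x $ i - a $ i) * (b $ i - x $ i)" using True by (simp add: mem_box_cart)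
    have "(\<lambda>n. exp (- (1 / real (Suc n)) / ((x $ i - a $ i) * (b $ i - x $ i)))) \<longlonglongrightarrow> exp (- 0 / ((x $ i - a $ i) * (b $ i - x $ i)))"
      using pos by (intro tendsto_intros LIMSEQ_Suc[OF lim_1_over_n]) auto
    then show "(\<lambda>n. bump (1 / real (Suc n)) 0 ((x $ i - a $ i) * (b $ i - x $ i))) \<longlonglongrightarrow> 1"
      using pos by (simp add: bump_def)
  qed
  then show ?thesis using True by (simp add: box_bump_def)
next
  case False
  then show ?thesis using assms by (simp add: box_bump_outside)
qed

lemma test_function_box_bump:
  assumes "box a b \<noteq> {}" shows "test_function (box_bump a b n)"
proof -
  have "{x. box_bump a b n x \<noteq> 0} \<subseteq> box a b" using box_bump_outside[OF assms] by auto
  then have "closure {x. box_bump a b n x \<noteq> 0} \<subseteq> cbox a b"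
    by (meson box_subset_cbox closed_cbox closure_minimal order_trans)
  then have "compact (closure {x. box_bump a b n x \<noteq> 0})"
    unfolding compact_eq_bounded_closed by (simp add: bounded_subset[OF bounded_cbox])
  then show ?thesis
    by (auto simp: test_function_def box_bump_smooth smooth_class_C_k)
qed

lemma box_bump_shift: "box_bump a b n (x - z) = box_bump (a + z) (b + z) n x"
  by (simp add: box_bump_def algebra_simps)

section \<open>Local integrability\<close>

text \<open>Local integrability as finiteness of integrals over balls, the form in which it is produced and
  consumed by estimates.\<close>

definition loc_int :: "('a::euclidean_space \<Rightarrow> 'b::real_normed_vector) \<Rightarrow> bool" where
  "loc_int f \<longleftrightarrow> (\<forall>R. (NNINT x. ennreal (norm (f x)) * indicator (cball 0 R) x) < \<infinity>)"

lemma pred_borel_cball[measurable]: "Measurable.pred borel (\<lambda>x::'a::euclidean_space. x \<in> cball 0 R)"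
  by (simp add: pred_def)

lemma locally_integrable_imp_loc_int:
  assumes [measurable]: "f \<in> borel_measurable borel" and "locally_integrable f"
  shows "loc_int f"
  unfolding loc_int_def
proof
  fix R
  have "set_integrable lebesgue (cball 0 R) f" using assms(2) by (simp add: locally_integrable_def)
  then have "integrable lborel (\<lambda>x. indicator (cball 0 R) x *\<^sub>R f x)"
    unfolding set_integrable_def by (subst (asm) integrable_completion) auto
  then have "(NNINT x. ennreal (norm (indicator (cball 0 R) x *\<^sub>R f x))) < \<infinity>"
    by (simp add: integrable_iff_bounded)
  also have "(NNINT x. ennreal (norm (indicator (cball 0 R) x *\<^sub>R f x))) = (NNINT x. ennreal (norm (f x)) * indicator (cball 0 R) x)"
    by (intro nn_integral_cong) (auto split: split_indicator)
  finally show "(NNINT x. ennreal (norm (f x)) * indicator (cball 0 R) x) < \<infinity>" .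
qed

lemma loc_int_bounded_support:
  fixes f :: "'a::euclidean_space \<Rightarrow> 'b::real_normed_vector" and h :: "'a \<Rightarrow> 'c::{banach, second_countable_topology}"
  assumes "loc_int f" "h \<in> borel_measurable borel" "0 \<le> C"
    and bd: "\<And>x. norm (h x) \<le> C * norm (f x)" and supp: "\<And>x. R < norm x \<Longrightarrow> h x = 0"
    and [measurable]: "f \<in> borel_measurable borel"
  shows "(NNINT x. ennreal (norm (h x))) \<le> ennreal C * (NNINT x. ennreal (norm (f x)) * indicator (cball 0 R) x)"
    and "integrable lborel h"
proof -
  have "(NNINT x. ennreal (norm (h x))) \<le> (NNINT x. ennreal C * (ennreal (norm (f x)) * indicator (cball 0 R) x))"
  proof (intro nn_integral_mono)
    fix x show "ennreal (norm (h x)) \<le> ennreal C * (ennreal (norm (f x)) * indicator (cball 0 R) x)"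
    proof (cases "R < norm x")
      case False
      then show ?thesis using bd[of x] assms(3) by (simp add: ennreal_mult[symmetric] ennreal_leI)
    qed (simp add: supp)
  qed
  also have "\<dots> = ennreal C * (NNINT x. ennreal (norm (f x)) * indicator (cball 0 R) x)"
    by (rule nn_integral_cmult) measurable
  finally show le: "(NNINT x. ennreal (norm (h x))) \<le> ennreal C * (NNINT x. ennreal (norm (f x)) * indicator (cball 0 R) x)" .
  show "integrable lborel h"
  proof (rule integrableI_bounded)
    show "(NNINT x. ennreal (norm (h x))) < \<infinity>"
      using assms(1) by (intro le_less_trans[OF le]) (auto simp: loc_int_def ennreal_mult_less_top)
  qed (use assms(2) in simp)
qed

lemma integral_lborel_shift:
  fixes f :: "'a::euclidean_space \<Rightarrow> 'b::{banach, second_countable_topology}"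
  assumes [measurable]: "f \<in> borel_measurable borel"
  shows "(LBINT x. f (x + t)) = (LBINT x. f x)"
proof -
  have "(LBINT x. f x) = (\<integral>x. f x \<partial>distr lborel borel ((+) t))" by (simp add: lborel_distr_plus)
  also have "\<dots> = (LBINT x. f (t + x))" by (rule integral_distr) auto
  finally show ?thesis by (simp add: add.commute)
qed

lemma integrable_lborel_shift:
  fixes f :: "'a::euclidean_space \<Rightarrow> 'b::{banach, second_countable_topology}"
  assumes [measurable]: "f \<in> borel_measurable borel"
  shows "integrable lborel (\<lambda>x. f (x + t)) \<longleftrightarrow> integrable lborel f"
proof -
  have "(NNINT x. ennreal (norm (f (x + t)))) = (NNINT x. ennreal (norm (f x)))"
    by (rule nn_integral_lborel_shift) measurable
  moreover have "(\<lambda>x. f (x + t)) \<in> borel_measurable lborel" "f \<in> borel_measurable lborel" using assms by simp_all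
  ultimately show ?thesis unfolding integrable_iff_bounded by (simp only:)
qed

lemma AE_lborel_affine:
  fixes P :: "'a::euclidean_space \<Rightarrow> bool"
  assumes "AE x in lborel. P x" and c: "c \<noteq> 0"
  shows "AE x in lborel. P (t + c *\<^sub>R x)"
proof -
  obtain N where N: "\<And>x. x \<in> space lborel - N \<Longrightarrow> P x" "N \<in> null_sets lborel"
    using AE_E3[OF assms(1)] by blast
  then have [measurable]: "N \<in> sets borel" by (auto simp: null_sets_def)
  have "0 = (NNINT x. indicator N x)" using N by (simp add: null_sets_def)
  also have "\<dots> = ennreal (\<bar>c\<bar> ^ DIM('a)) * (NNINT x. indicator N (t + c *\<^sub>R x))"
    by (rule nn_integral_lborel_affine[OF _ c]) measurable
  finally have "(NNINT x. indicator N (t + c *\<^sub>R x)) = 0" using c by simp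
  then have "AE x in lborel. indicator N (t + c *\<^sub>R x) = (0::ennreal)"
    by (subst (asm) nn_integral_0_iff_AE) auto
  then show ?thesis by eventually_elim (rule N(1), auto split: split_indicator_asm)
qed

lemma integrable_pairI:
  fixes f :: "'a::euclidean_space \<Rightarrow> 'b::euclidean_space \<Rightarrow> 'c::{banach, second_countable_topology}"
  assumes [measurable]: "(\<lambda>(x, s). f x s) \<in> borel_measurable (lborel \<Otimes>\<^sub>M lborel)"
    and fin: "(NNINT s x. ennreal (norm (f x s))) < \<infinity>"
  shows "integrable (lborel \<Otimes>\<^sub>M lborel) (\<lambda>(x, s). f x s)"
proof (rule integrableI_bounded)
  have "(\<integral>\<^sup>+p. ennreal (norm (case p of (x, s) \<Rightarrow> f x s)) \<partial>(lborel \<Otimes>\<^sub>M lborel)) = (NNINT s x. ennreal (norm (f x s)))"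
    by (subst lborel_pair.nn_integral_snd[symmetric]) auto
  with fin show "(\<integral>\<^sup>+p. ennreal (norm (case p of (x, s) \<Rightarrow> f x s)) \<partial>(lborel \<Otimes>\<^sub>M lborel)) < \<infinity>" by simp
qed measurable

lemma continuous_partial_box_bump: "continuous_on UNIV (partial_deriv j (box_bump a b n))"
  using smooth_class_C_k[OF smooth_class_partial(1)[OF box_bump_smooth], of 0 j a b n] by simp

lemma borel_measurable_box_bump[measurable]:
  "box_bump a b n \<in> borel_measurable borel" "partial_deriv j (box_bump a b n) \<in> borel_measurable borel"
  using smooth_class_C_k[OF box_bump_smooth, of 0 a b n] continuous_partial_box_bump
  by (auto intro!: borel_measurable_continuous_onI)

text \<open>The fundamental lemma of the calculus of variations. Letting \<open>n\<close> tend to infinity, all integrals over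
  boxes vanish, and almost every value of \<open>f\<close> is a limit of averages over small boxes.\<close>

lemma loc_int_AE_zero_of_box_bump:
  fixes f :: "real^'n \<Rightarrow> complex"
  assumes [measurable]: "f \<in> borel_measurable borel" and f: "loc_int f"
    and zero: "\<And>a b n. box a b \<noteq> {} \<Longrightarrow> (LBINT x. box_bump a b n x *\<^sub>R f x) = 0"
  shows "AE x in lborel. f x = 0"
proof -
  have cboxR: "\<exists>R. cbox a b \<subseteq> cball 0 R" for a b :: "real^'n"
    using bounded_cbox[of a b] by (auto simp: bounded_iff subset_eq)
  have int: "integrable lborel (\<lambda>x. indicator (cbox a b) x *\<^sub>R f x)" for a b
  proof -
    obtain R where "cbox a b \<subseteq> cball 0 R" using cboxR by blast
    then show ?thesis
      by (intro loc_int_bounded_support(2)[OF f, where C=1 and R=R]) (auto split: split_indicator)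
  qed
  have box0: "(LBINT x. indicator (box a b) x *\<^sub>R f x) = 0" for a b
  proof (cases "box a b = {}")
    case False
    have "(\<lambda>n. LBINT x. box_bump a b n x *\<^sub>R f x) \<longlonglongrightarrow> (LBINT x. indicator (box a b) x *\<^sub>R f x)"
    proof (rule integral_dominated_convergence[where w="\<lambda>x. norm (indicator (cbox a b) x *\<^sub>R f x)"])
      show "AE x in lborel. (\<lambda>n. box_bump a b n x *\<^sub>R f x) \<longlonglongrightarrow> indicator (box a b) x *\<^sub>R f x"
        by (intro AE_I2 tendsto_scaleR box_bump_tendsto[OF False] tendsto_const)
      show "AE x in lborel. norm (box_bump a b n x *\<^sub>R f x) \<le> norm (indicator (cbox a b) x *\<^sub>R f x)" for n
      proof (rule AE_I2)
        fix x
        show "norm (box_bump a b n x *\<^sub>R f x) \<le> norm (indicator (cbox a b) x *\<^sub>R f x)"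
        proof (cases "x \<in> box a b")
          case True
          then have "x \<in> cbox a b" using box_subset_cbox by blast
          then show ?thesis using box_bump_bounds[of a b n x] by (simp add: mult_left_le_one_le)
        qed (simp add: box_bump_outside[OF False])
      qed
      show "integrable lborel (\<lambda>x. norm (indicator (cbox a b) x *\<^sub>R f x))"
        using int by (rule integrable_norm)
    qed measurable
    then show ?thesis using zero[OF False] by (simp add: LIMSEQ_const_iff)
  qed simp
  have HK: "f integrable_on cbox a b \<and> integral (cbox a b) f = 0" for a b
  proof -
    have si: "set_integrable lborel (cbox a b) f" using int by (simp add: set_integrable_def)
    have "integral (cbox a b) f = (LINT x:cbox a b|lborel. f x)"
      using set_borel_integral_eq_integral(2)[OF si] by simp
    also have "\<dots> = (LBINT x. indicator (box a b) x *\<^sub>R f x)"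
      unfolding set_lebesgue_integral_def
    proof (rule integral_cong_AE)
      have "AE x in lborel. x \<notin> cbox a b - box a b"
      proof (rule AE_not_in)
        have "negligible (cbox a b - box a b)" by (rule negligible_frontier_interval)
        then show "cbox a b - box a b \<in> null_sets lborel"
          by (simp add: negligible_iff_null_sets null_sets_completion_iff)
      qed
      then show "AE x in lborel. indicat_real (cbox a b) x *\<^sub>R f x = indicat_real (box a b) x *\<^sub>R f x"
        by eventually_elim (use box_subset_cbox[of a b] in \<open>auto split: split_indicator\<close>)
    qed measurable
    finally show ?thesis using set_borel_integral_eq_integral(1)[OF si] box0 by simp
  qed
  obtain N where N: "negligible N" "\<And>x e. \<lbrakk>x \<notin> N; 0 < e\<rbrakk> \<Longrightarrow>
       \<exists>d>0. \<forall>h. 0 < h \<and> h < d \<longrightarrow> norm (integral (cbox x (x + h *\<^sub>R One)) f /\<^sub>R h ^ DIM(real^'n) - f x) < e"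
    using integrable_ccontinuous_explicit[of f] HK by blast
  have "f x = 0" if xN: "x \<notin> N" for x
  proof (rule ccontr)
    assume "f x \<noteq> 0"
    then obtain d where "d > 0" "\<And>h. 0 < h \<and> h < d \<longrightarrow> norm (integral (cbox x (x + h *\<^sub>R One)) f /\<^sub>R h ^ DIM(real^'n) - f x) < norm (f x)"
      using N(2)[OF xN, of "norm (f x)"] by auto
    from this(2)[of "d / 2"] \<open>d > 0\<close> show False using HK by simp
  qed
  moreover have "AE x in lebesgue. x \<notin> N" using N(1) by (intro AE_not_in) (simp add: negligible_iff_null_sets)
  ultimately have "AE x in lebesgue. f x = 0" by (auto elim: eventually_mono)
  then show ?thesis by (simp add: AE_completion_iff)
qed

section \<open>Weakly differentiable functions on lines\<close>

definition path_int :: "real^'n \<Rightarrow> (real^'n \<Rightarrow> complex^'n) \<Rightarrow> real \<Rightarrow> real^'n \<Rightarrow> complex" where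
  "path_int z g h x = (LBINT s:{0..h}. along z (g (x + s *\<^sub>R z)))"

lemma borel_measurable_path_int[measurable (raw)]:
  fixes g :: "real^'n \<Rightarrow> complex^'n"
  assumes [measurable]: "g \<in> borel_measurable borel" "z \<in> borel_measurable M" "x \<in> borel_measurable M" "h \<in> borel_measurable M"
  shows "(\<lambda>y. path_int (z y) g (h y) (x y)) \<in> borel_measurable M"
proof -
  have [measurable]: "(\<lambda>p. indicator {0..h (fst p)} (snd p) :: real) \<in> borel_measurable (M \<Otimes>\<^sub>M lborel)"
  proof -
    have "(\<lambda>p. indicator {0..h (fst p)} (snd p) :: real) = (\<lambda>p. if 0 \<le> snd p \<and> snd p \<le> h (fst p) then 1 else 0)"
      by (auto split: split_indicator)
    then show ?thesis by simp
  qed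
  show ?thesis unfolding path_int_def set_lebesgue_integral_def by measurable
qed

lemma weak_gradient_shifted:
  fixes u :: "real^'n \<Rightarrow> complex"
  assumes [measurable]: "u \<in> borel_measurable borel" "g \<in> borel_measurable borel"
    and wg: "weak_gradient u g" and ne: "box a b \<noteq> {}"
  shows "(LBINT x. partial_deriv j (box_bump a b n) (x - t) *\<^sub>R u x) = - (LBINT x. box_bump a b n (x - t) *\<^sub>R (g x $ j))"
proof -
  let ?\<phi> = "box_bump (a + t) (b + t) n"
  have sh: "?\<phi> = (\<lambda>x. box_bump a b n (x - t))" by (simp add: box_bump_shift fun_eq_iff)
  have pd: "partial_deriv j ?\<phi> x = partial_deriv j (box_bump a b n) (x - t)" for x
  proof -
    have "((\<lambda>x. box_bump a b n (x - t)) has_derivative (\<lambda>h. \<Sum>j\<in>UNIV. partial_deriv j (box_bump a b n) (x - t) * h $ j)) (at x)"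
      by (rule has_derivative_compose[OF _ smooth_class_partial(3)[OF box_bump_smooth]])
         (auto intro!: derivative_eq_intros)
    then have "frechet_derivative ?\<phi> (at x) = (\<lambda>h. \<Sum>j\<in>UNIV. partial_deriv j (box_bump a b n) (x - t) * h $ j)"
      unfolding sh by (rule frechet_derivative_at[symmetric])
    then show ?thesis
      by (simp add: partial_deriv_def[of j ?\<phi>] axis_def if_distrib[of "\<lambda>a. _ * a"] cong: if_cong)
  qed
  have tf: "test_function ?\<phi>"
  proof (rule test_function_box_bump)
    obtain y where "y \<in> box a b" using ne by auto
    then have "y + t \<in> box (a + t) (b + t)" by (simp add: mem_box_cart)
    then show "box (a + t) (b + t) \<noteq> {}" by blast
  qed
  have "(\<integral>x. partial_deriv j ?\<phi> x *\<^sub>R u x \<partial>lebesgue) = - (\<integral>x. ?\<phi> x *\<^sub>R (g x $ j) \<partial>lebesgue)"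
    using wg tf unfolding weak_gradient_def by blast
  then have eq: "(\<integral>x. partial_deriv j (box_bump a b n) (x - t) *\<^sub>R u x \<partial>lebesgue) = - (\<integral>x. box_bump a b n (x - t) *\<^sub>R (g x $ j) \<partial>lebesgue)"
    by (simp add: pd box_bump_shift)
  from eq show ?thesis by (simp add: integral_completion)
qed

lemma box_bump_derivative_bounded:
  assumes "box a b \<noteq> {}"
  shows "\<exists>C\<ge>0. \<forall>j x. \<bar>partial_deriv j (box_bump a b n) x\<bar> \<le> C"
    and "x \<notin> cbox a b \<Longrightarrow> partial_deriv j (box_bump a b n) x = 0"
proof -
  show out: "partial_deriv j (box_bump a b n) x = 0" if x: "x \<notin> cbox a b" for j x
  proof -
    have "(box_bump a b n has_derivative (\<lambda>h. 0)) (at x)"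
    proof (rule has_derivative_transform_within_open[of "\<lambda>x. 0"])
      show "open (- cbox a b)" by (simp add: open_Compl closed_cbox)
      show "0 = box_bump a b n y" if "y \<in> - cbox a b" for y
        using that box_subset_cbox[of a b] box_bump_outside[OF assms, of y n] by auto
    qed (use x in auto)
    then have "frechet_derivative (box_bump a b n) (at x) = (\<lambda>h. 0)" by (rule frechet_derivative_at[symmetric])
    then show ?thesis by (simp add: partial_deriv_def)
  qed
  have "\<exists>C\<ge>0. \<forall>x. \<bar>partial_deriv j (box_bump a b n) x\<bar> \<le> C" for j
  proof -
    have "continuous_on (cbox a b) (partial_deriv j (box_bump a b n))"
      by (rule continuous_on_subset[OF continuous_partial_box_bump]) simp
    then have "bounded (partial_deriv j (box_bump a b n) ` cbox a b)"
      by (intro compact_imp_bounded compact_continuous_image) auto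
    then obtain C where C: "\<And>x. x \<in> cbox a b \<Longrightarrow> \<bar>partial_deriv j (box_bump a b n) x\<bar> \<le> C"
      by (auto simp: bounded_iff)
    show ?thesis
    proof (intro exI[of _ "max C 0"] conjI allI)
      fix x show "\<bar>partial_deriv j (box_bump a b n) x\<bar> \<le> max C 0"
        using C[of x] out[of x j] by (cases "x \<in> cbox a b") auto
    qed simp
  qed
  then obtain C where C: "\<And>j. 0 \<le> C j" "\<And>j x. \<bar>partial_deriv j (box_bump a b n) x\<bar> \<le> C j" by metis
  show "\<exists>C\<ge>0. \<forall>j x. \<bar>partial_deriv j (box_bump a b n) x\<bar> \<le> C"
  proof (intro exI[of _ "\<Sum>j\<in>UNIV. C j"] conjI allI)
    fix j x
    have "C j \<le> (\<Sum>j\<in>UNIV. C j)" by (rule member_le_sum) (auto simp: C)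
    then show "\<bar>partial_deriv j (box_bump a b n) x\<bar> \<le> (\<Sum>j\<in>UNIV. C j)" using C(2)[of j x] by simp
  qed (simp add: sum_nonneg C)
qed

lemma loc_int_gradient:
  fixes u :: "real^'n \<Rightarrow> complex" and g :: "real^'n \<Rightarrow> complex^'n"
  assumes [measurable]: "u \<in> borel_measurable borel" "g \<in> borel_measurable borel"
    and wg: "weak_gradient u g"
  shows "loc_int u" "loc_int g"
proof -
  show "loc_int u" using wg by (intro locally_integrable_imp_loc_int) (auto simp: weak_gradient_def)
  have gj: "loc_int (\<lambda>x. g x $ j)" for j
    using wg by (intro locally_integrable_imp_loc_int) (auto simp: weak_gradient_def)
  show "loc_int g" unfolding loc_int_def
  proof
    fix R
    have "(NNINT x. ennreal (norm (g x)) * indicator (cball 0 R) x)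
       \<le> (NNINT x. (\<Sum>j\<in>UNIV. ennreal (norm (g x $ j)) * indicator (cball 0 R) x))"
    proof (intro nn_integral_mono)
      fix x
      have "norm (g x) \<le> (\<Sum>j\<in>UNIV. norm (g x $ j))" unfolding norm_vec_def by (rule L2_set_le_sum) simp
      then show "ennreal (norm (g x)) * indicator (cball 0 R) x \<le> (\<Sum>j\<in>UNIV. ennreal (norm (g x $ j)) * indicator (cball 0 R) x)"
        unfolding sum_distrib_right[symmetric] by (intro mult_right_mono) (auto simp: ennreal_leI sum_ennreal)
    qed
    also have "\<dots> = (\<Sum>j\<in>UNIV. NNINT x. ennreal (norm (g x $ j)) * indicator (cball 0 R) x)"
      by (rule nn_integral_sum) measurable
    also have "\<dots> < \<infinity>" using gj by (auto simp: loc_int_def)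
    finally show "(NNINT x. ennreal (norm (g x)) * indicator (cball 0 R) x) < \<infinity>" .
  qed
qed

lemma loc_int_along:
  fixes g :: "real^'n \<Rightarrow> complex^'n"
  assumes [measurable]: "g \<in> borel_measurable borel" and g: "loc_int g"
  shows "loc_int (\<lambda>x. along z (g x))"
  unfolding loc_int_def
proof
  fix R
  have "(NNINT x. ennreal (norm (along z (g x))) * indicator (cball 0 R) x)
     = (NNINT x. ennreal (norm (indicator (cball 0 R) x *\<^sub>R along z (g x))))"
    by (intro nn_integral_cong) (auto split: split_indicator)
  also have "\<dots> \<le> ennreal (norm z) * (NNINT x. ennreal (norm (g x)) * indicator (cball 0 R) x)"
    by (rule loc_int_bounded_support(1)[OF g]) (auto simp: norm_along_le split: split_indicator)
  also have "\<dots> < \<infinity>" using g by (auto simp: loc_int_def ennreal_mult_less_top)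
  finally show "(NNINT x. ennreal (norm (along z (g x))) * indicator (cball 0 R) x) < \<infinity>" .
qed

text \<open>Both Fubini arguments below concern a compactly supported function times a locally integrable one,
  with one of the factors transported along \<open>z\<close>.\<close>

lemma integrable_moving_product:
  fixes f :: "'a::euclidean_space \<Rightarrow> complex" and a :: "'a \<Rightarrow> real"
  assumes [measurable]: "f \<in> borel_measurable borel" "a \<in> borel_measurable borel"
    and f: "loc_int f" and bd: "\<And>x. \<bar>a x\<bar> \<le> C" and supp: "\<And>x. R < norm x \<Longrightarrow> a x = 0"
  shows "integrable (lborel \<Otimes>\<^sub>M lborel) (\<lambda>(x, s). indicator {0..1} s *\<^sub>R a (x + s *\<^sub>R y) *\<^sub>R f (x + s *\<^sub>R z))"
    (is "integrable _ (\<lambda>(x, s). ?H x s)")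
proof (rule integrable_pairI)
  let ?I = "NNINT x. ennreal (norm (f x)) * indicator (cball 0 (R + norm z + norm y)) x"
  have C: "0 \<le> C" using bd[of undefined] by simp
  have "(NNINT s x. ennreal (norm (?H x s))) \<le> (NNINT s. (ennreal C * ?I) * indicator {0..1::real} s)"
  proof (intro nn_integral_mono)
    fix s :: real
    show "(NNINT x. ennreal (norm (?H x s))) \<le> (ennreal C * ?I) * indicator {0..1::real} s"
    proof (cases "s \<in> {0..1}")
      case True
      then have sz: "norm (s *\<^sub>R w) \<le> norm w" for w :: 'a by (simp add: mult_left_le_one_le)
      let ?h = "\<lambda>x. a (x - s *\<^sub>R z + s *\<^sub>R y) *\<^sub>R f x"
      have "(NNINT x. ennreal (norm (?H x s))) = (NNINT x. ennreal (norm (?h (x + s *\<^sub>R z))))" using True by simp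
      also have "\<dots> = (NNINT x. ennreal (norm (?h x)))" by (rule nn_integral_lborel_shift) measurable
      also have "\<dots> \<le> ennreal C * ?I"
      proof (rule loc_int_bounded_support(1)[OF f _ C])
        show "norm (?h x) \<le> C * norm (f x)" for x
          using bd[of "x - s *\<^sub>R z + s *\<^sub>R y"] by (simp add: mult_right_mono)
        show "?h x = 0" if "R + norm z + norm y < norm x" for x
        proof -
          have "norm x \<le> norm (x - s *\<^sub>R z + s *\<^sub>R y) + norm (s *\<^sub>R z) + norm (s *\<^sub>R y)"
            using norm_triangle_ineq4[of "x - s *\<^sub>R z + s *\<^sub>R y" "s *\<^sub>R y"] norm_triangle_ineq[of "x - s *\<^sub>R z" "s *\<^sub>R z"] by simp
          then have "R < norm (x - s *\<^sub>R z + s *\<^sub>R y)" using that sz[of z] sz[of y] by linarith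
          then show ?thesis by (simp add: supp)
        qed
      qed measurable
      finally show ?thesis using True by simp
    qed simp
  qed
  also have "\<dots> = ennreal C * ?I" by (simp add: nn_integral_cmult_indicator)
  also have "\<dots> < \<infinity>" using f by (auto simp: loc_int_def ennreal_mult_less_top)
  finally show "(NNINT s x. ennreal (norm (?H x s))) < \<infinity>" .
qed measurable

text \<open>Move the increment onto the test function, write the increment of the test function as an integral
  of its derivative along the segment, and apply the definition of the weak gradient to each
  translate. The remaining claims are the integrability needed to split such integrals.\<close>

lemma weak_gradient_line_increment_tested:
  fixes u :: "real^'n \<Rightarrow> complex" and g :: "real^'n \<Rightarrow> complex^'n"
  assumes [measurable]: "u \<in> borel_measurable borel" "g \<in> borel_measurable borel"
    and wg: "weak_gradient u g" and ne: "box a b \<noteq> {}"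
  shows "(LBINT x. box_bump a b n x *\<^sub>R (u (x + z) - u x)) = (LBINT x. box_bump a b n x *\<^sub>R path_int z g 1 x)"
    and "integrable lborel (\<lambda>x. box_bump a b n x *\<^sub>R u (x + z))"
    and "integrable lborel (\<lambda>x. box_bump a b n x *\<^sub>R u x)"
    and "integrable lborel (\<lambda>x. box_bump a b n x *\<^sub>R path_int z g 1 x)"
proof -
  let ?\<phi> = "box_bump a b n" and ?d = "\<lambda>j. partial_deriv j (box_bump a b n)"
  note li = loc_int_gradient[OF assms(1,2) wg]
  obtain R where R: "cbox a b \<subseteq> cball 0 R" using bounded_cbox[of a b] by (auto simp: bounded_iff subset_eq)
  have \<phi>0: "?\<phi> x = 0" if "R < norm x" for x
  proof (rule box_bump_outside[OF ne])
    show "x \<notin> box a b" using R that box_subset_cbox[of a b] by force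
  qed
  have d0: "?d j x = 0" if "R < norm x" for j x
  proof (rule box_bump_derivative_bounded(2)[OF ne])
    show "x \<notin> cbox a b" using R that by force
  qed
  obtain C where C: "0 \<le> C" "\<And>j x. \<bar>?d j x\<bar> \<le> C" using box_bump_derivative_bounded(1)[OF ne] by blast
  have \<phi>1: "\<bar>?\<phi> x\<bar> \<le> 1" for x using box_bump_bounds[of a b n x] by simp
  have far: "R < norm (x - y)" if "R + norm y < norm x" for x y :: "real^'n"
    using that norm_triangle_ineq2[of x y] by linarith
  have int_shift: "integrable lborel (\<lambda>x. ?\<phi> (x - y) *\<^sub>R u x)" for y
    using \<phi>1 by (intro loc_int_bounded_support(2)[OF li(1), where C=1 and R="R + norm y"])
       (auto simp: \<phi>0 far mult_left_le_one_le)
  show i1: "integrable lborel (\<lambda>x. ?\<phi> x *\<^sub>R u (x + z))"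
    using int_shift[of z] integrable_lborel_shift[of "\<lambda>x. ?\<phi> (x - z) *\<^sub>R u x" z] by simp
  show i2: "integrable lborel (\<lambda>x. ?\<phi> x *\<^sub>R u x)" using int_shift[of 0] by simp
  have "integrable (lborel \<Otimes>\<^sub>M lborel) (\<lambda>(x, s). indicator {0..1} s *\<^sub>R ?\<phi> (x + s *\<^sub>R 0) *\<^sub>R along z (g (x + s *\<^sub>R z)))"
    by (rule integrable_moving_product[OF _ _ loc_int_along[OF _ li(2)] \<phi>1 \<phi>0]) measurable
  then have pint: "integrable (lborel \<Otimes>\<^sub>M lborel) (\<lambda>(x, s). indicator {0..1} s *\<^sub>R ?\<phi> x *\<^sub>R along z (g (x + s *\<^sub>R z)))" by simp
  have path: "?\<phi> x *\<^sub>R path_int z g 1 x = (LBINT s. indicator {0..1} s *\<^sub>R ?\<phi> x *\<^sub>R along z (g (x + s *\<^sub>R z)))" for x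
    unfolding path_int_def set_lebesgue_integral_def
    by (subst Bochner_Integration.integral_scaleR_right[symmetric]) (simp add: mult.commute)
  show "integrable lborel (\<lambda>x. ?\<phi> x *\<^sub>R path_int z g 1 x)"
    unfolding path using lborel_pair.integrable_fst[OF pint] by simp
  let ?D = "\<lambda>x s. indicator {0..1} s *\<^sub>R (\<Sum>j\<in>UNIV. (z $ j * ?d j (x - s *\<^sub>R z))) *\<^sub>R u x"
  have D_int: "integrable (lborel \<Otimes>\<^sub>M lborel) (\<lambda>(x, s). ?D x s)"
  proof -
    have "\<bar>\<Sum>j\<in>UNIV. z $ j * ?d j x\<bar> \<le> (\<Sum>j\<in>UNIV. \<bar>z $ j\<bar> * C)" for x
      using C by (intro order_trans[OF sum_abs] sum_mono) (auto simp: abs_mult intro!: mult_left_mono)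
    then have "integrable (lborel \<Otimes>\<^sub>M lborel) (\<lambda>(x, s). indicator {0..1} s *\<^sub>R (\<Sum>j\<in>UNIV. z $ j * ?d j (x + s *\<^sub>R (- z))) *\<^sub>R u (x + s *\<^sub>R 0))"
      by (intro integrable_moving_product[where a="\<lambda>x. \<Sum>j\<in>UNIV. z $ j * ?d j x" and R=R] li(1)) (auto simp: d0)
    then show ?thesis by simp
  qed
  have cont: "continuous_on {0..1} (\<lambda>s. \<Sum>j\<in>UNIV. z $ j * ?d j (x - s *\<^sub>R z))" for x
  proof -
    have "continuous_on {0..1} (\<lambda>s. ?d j (x - s *\<^sub>R z))" for j
      by (rule continuous_on_compose2[OF continuous_partial_box_bump]) (auto intro!: continuous_intros)
    then show ?thesis by (intro continuous_intros)
  qed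
  have FTC: "?\<phi> (x - z) - ?\<phi> x = - (LBINT s. indicator {0..1} s *\<^sub>R (\<Sum>j\<in>UNIV. z $ j * ?d j (x - s *\<^sub>R z)))" for x
  proof -
    have "(LBINT s. indicator {0..1} s *\<^sub>R (- (\<Sum>j\<in>UNIV. z $ j * ?d j (x - s *\<^sub>R z)))) = ?\<phi> (x - 1 *\<^sub>R z) - ?\<phi> (x - 0 *\<^sub>R z)"
    proof (rule integral_FTC_atLeastAtMost)
      fix s :: real
      have "((\<lambda>s. ?\<phi> (x - s *\<^sub>R z)) has_derivative (\<lambda>h. \<Sum>j\<in>UNIV. ?d j (x - s *\<^sub>R z) * (- (h *\<^sub>R z)) $ j)) (at s)"
        by (rule has_derivative_compose[OF _ smooth_class_partial(3)[OF box_bump_smooth]])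
           (auto intro!: derivative_eq_intros)
      then have "((\<lambda>s. ?\<phi> (x - s *\<^sub>R z)) has_vector_derivative - (\<Sum>j\<in>UNIV. z $ j * ?d j (x - s *\<^sub>R z))) (at s)"
        unfolding has_vector_derivative_def by (simp add: sum_negf sum_distrib_left ac_simps)
      then show "((\<lambda>s. ?\<phi> (x - s *\<^sub>R z)) has_vector_derivative - (\<Sum>j\<in>UNIV. z $ j * ?d j (x - s *\<^sub>R z))) (at s within {0..1})"
        by (rule has_vector_derivative_at_within)
    next
      show "continuous_on {0..1} (\<lambda>s. - (\<Sum>j\<in>UNIV. z $ j * ?d j (x - s *\<^sub>R z)))"
        by (intro continuous_on_minus cont)
    qed simp
    then show ?thesis by simp
  qed
  have d_int: "integrable lborel (\<lambda>x. ?d j (x - y) *\<^sub>R u x)" for j y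
    using C by (intro loc_int_bounded_support(2)[OF li(1), where C=C and R="R + norm y"])
       (auto simp: d0 far mult_right_mono)
  have g_int: "integrable lborel (\<lambda>x. ?\<phi> (x - y) *\<^sub>R (g x $ j))" for j y
  proof (rule loc_int_bounded_support(2)[OF li(2), where C=1 and R="R + norm y"])
    fix x
    have "norm (g x $ j) \<le> norm (g x)" by (rule Finite_Cartesian_Product.norm_nth_le)
    then show "norm (?\<phi> (x - y) *\<^sub>R (g x $ j)) \<le> 1 * norm (g x)"
      using \<phi>1[of "x - y"] mult_mono[of "\<bar>?\<phi> (x - y)\<bar>" 1 "norm (g x $ j)" "norm (g x)"] by simp
  qed (auto simp: \<phi>0 far)
  have "(LBINT x. ?\<phi> x *\<^sub>R (u (x + z) - u x)) = (LBINT x. ?\<phi> x *\<^sub>R u (x + z)) - (LBINT x. ?\<phi> x *\<^sub>R u x)"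
    using i1 i2 by (simp add: scaleR_diff_right)
  also have "(LBINT x. ?\<phi> x *\<^sub>R u (x + z)) = (LBINT x. ?\<phi> (x - z) *\<^sub>R u x)"
    using integral_lborel_shift[of "\<lambda>x. ?\<phi> (x - z) *\<^sub>R u x" z] by simp
  also have "\<dots> - (LBINT x. ?\<phi> x *\<^sub>R u x) = (LBINT x. (?\<phi> (x - z) - ?\<phi> x) *\<^sub>R u x)"
    using int_shift[of z] i2 by (simp add: scaleR_diff_left)
  also have "\<dots> = (LBINT x. - (LBINT s. ?D x s))"
  proof (rule Bochner_Integration.integral_cong[OF refl])
    fix x
    have "(LBINT s. ?D x s) = (LBINT s. (indicator {0..1} s *\<^sub>R (\<Sum>j\<in>UNIV. (z $ j * ?d j (x - s *\<^sub>R z)))) *\<^sub>R u x)"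
      by simp
    also have "\<dots> = (LBINT s. indicator {0..1} s *\<^sub>R (\<Sum>j\<in>UNIV. (z $ j * ?d j (x - s *\<^sub>R z)))) *\<^sub>R u x"
      by (rule Bochner_Integration.integral_scaleR_left)
         (use borel_integrable_atLeastAtMost'[OF cont] in \<open>simp add: set_integrable_def\<close>)
    finally show "(?\<phi> (x - z) - ?\<phi> x) *\<^sub>R u x = - (LBINT s. ?D x s)" unfolding FTC by simp
  qed
  also have "\<dots> = - (LBINT s. LBINT x. ?D x s)"
    using lborel_pair.Fubini_integral[OF D_int] by simp
  also have "\<dots> = (LBINT s. - (LBINT x. ?D x s))"
    by (rule Bochner_Integration.integral_minus[symmetric])
  also have "\<dots> = (LBINT s. LBINT x. indicator {0..1} s *\<^sub>R ?\<phi> x *\<^sub>R along z (g (x + s *\<^sub>R z)))"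
  proof (rule Bochner_Integration.integral_cong[OF refl])
    fix s :: real
    have "(LBINT x. ?D x s) = indicator {0..1} s *\<^sub>R (LBINT x. (\<Sum>j\<in>UNIV. z $ j *\<^sub>R (?d j (x - s *\<^sub>R z) *\<^sub>R u x)))"
      by (simp add: scaleR_sum_left)
    also have "(LBINT x. (\<Sum>j\<in>UNIV. z $ j *\<^sub>R (?d j (x - s *\<^sub>R z) *\<^sub>R u x))) = (\<Sum>j\<in>UNIV. z $ j *\<^sub>R (LBINT x. ?d j (x - s *\<^sub>R z) *\<^sub>R u x))"
      using d_int by (subst Bochner_Integration.integral_sum) (simp_all del: scaleR_scaleR)
    also have "\<dots> = - (\<Sum>j\<in>UNIV. z $ j *\<^sub>R (LBINT x. ?\<phi> (x - s *\<^sub>R z) *\<^sub>R (g x $ j)))"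
      using weak_gradient_shifted[OF assms(1,2) wg ne, of _ n "s *\<^sub>R z"] by (simp add: sum_negf)
    also have "(\<Sum>j\<in>UNIV. z $ j *\<^sub>R (LBINT x. ?\<phi> (x - s *\<^sub>R z) *\<^sub>R (g x $ j))) = (LBINT x. (\<Sum>j\<in>UNIV. z $ j *\<^sub>R (?\<phi> (x - s *\<^sub>R z) *\<^sub>R (g x $ j))))"
      using g_int by (subst Bochner_Integration.integral_sum) (simp_all del: scaleR_scaleR)
    also have "\<dots> = (LBINT x. ?\<phi> (x - s *\<^sub>R z) *\<^sub>R along z (g x))"
      unfolding along_def by (simp add: scaleR_sum_right mult.commute)
    also have "\<dots> = (LBINT x. ?\<phi> x *\<^sub>R along z (g (x + s *\<^sub>R z)))"
      using integral_lborel_shift[of "\<lambda>x. ?\<phi> (x - s *\<^sub>R z) *\<^sub>R along z (g x)" "s *\<^sub>R z"] by simp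
    finally show "- (LBINT x. ?D x s) = (LBINT x. indicator {0..1} s *\<^sub>R ?\<phi> x *\<^sub>R along z (g (x + s *\<^sub>R z)))"
      by (simp split: split_indicator)
  qed
  also have "\<dots> = (LBINT x. ?\<phi> x *\<^sub>R path_int z g 1 x)"
    unfolding path using lborel_pair.Fubini_integral[OF pint] by simp
  finally show "(LBINT x. ?\<phi> x *\<^sub>R (u (x + z) - u x)) = (LBINT x. ?\<phi> x *\<^sub>R path_int z g 1 x)" .
qed

lemma loc_int_shift:
  fixes u :: "'a::euclidean_space \<Rightarrow> 'b::{banach, second_countable_topology}"
  assumes [measurable]: "u \<in> borel_measurable borel" and u: "loc_int u"
  shows "loc_int (\<lambda>x. u (x + z))"
  unfolding loc_int_def
proof
  fix R
  have "(NNINT x. ennreal (norm (u (x + z))) * indicator (cball 0 R) x)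
     = (NNINT x. ennreal (norm (u (x + z))) * indicator (cball 0 R) ((x + z) - z))" by simp
  also have "\<dots> = (NNINT x. ennreal (norm (u x)) * indicator (cball 0 R) (x - z))"
    by (rule nn_integral_lborel_shift) measurable
  also have "\<dots> \<le> (NNINT x. ennreal (norm (u x)) * indicator (cball 0 (R + norm z)) x)"
  proof (intro nn_integral_mono mult_left_mono)
    fix x
    have "norm x \<le> R + norm z" if "norm (x - z) \<le> R" using that norm_triangle_sub[of x z] by linarith
    then show "indicator (cball 0 R) (x - z) \<le> (indicator (cball 0 (R + norm z)) x :: ennreal)"
      by (auto split: split_indicator)
  qed simp
  also have "\<dots> < \<infinity>" using u by (simp add: loc_int_def)
  finally show "(NNINT x. ennreal (norm (u (x + z))) * indicator (cball 0 R) x) < \<infinity>" .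
qed

lemma loc_int_diff:
  fixes f g :: "'a::euclidean_space \<Rightarrow> 'b::{banach, second_countable_topology}"
  assumes [measurable]: "f \<in> borel_measurable borel" "g \<in> borel_measurable borel" and "loc_int f" "loc_int g"
  shows "loc_int (\<lambda>x. f x - g x)"
  unfolding loc_int_def
proof
  fix R
  have "(NNINT x. ennreal (norm (f x - g x)) * indicator (cball 0 R) x)
    \<le> (NNINT x. ennreal (norm (f x)) * indicator (cball 0 R) x + ennreal (norm (g x)) * indicator (cball 0 R) x)"
    by (intro nn_integral_mono)
       (auto split: split_indicator simp flip: ennreal_plus intro!: ennreal_leI norm_triangle_ineq4)
  also have "\<dots> < \<infinity>"
    using assms(3,4) by (subst nn_integral_add) (auto simp: loc_int_def)
  finally show "(NNINT x. ennreal (norm (f x - g x)) * indicator (cball 0 R) x) < \<infinity>" .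
qed

text \<open>Both sides have the same integral against every bump.\<close>

lemma weak_gradient_line_increment:
  fixes u :: "real^'n \<Rightarrow> complex" and g :: "real^'n \<Rightarrow> complex^'n"
  assumes [measurable]: "u \<in> borel_measurable borel" "g \<in> borel_measurable borel"
    and wg: "weak_gradient u g"
  shows "AE x in lborel. u (x + z) = u x + path_int z g 1 x"
proof -
  note li = loc_int_gradient[OF assms(1,2) wg]
  let ?f = "\<lambda>x. u (x + z) - u x - path_int z g 1 x"
  have "loc_int (\<lambda>x. path_int z g 1 x)"
    unfolding loc_int_def
  proof
    fix R :: real
    let ?v = "indicator (cball 0 R) :: real^'n \<Rightarrow> real"
    have "integrable (lborel \<Otimes>\<^sub>M lborel) (\<lambda>(x, s). indicator {0..1} s *\<^sub>R ?v (x + s *\<^sub>R 0) *\<^sub>R along z (g (x + s *\<^sub>R z)))"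
      by (rule integrable_moving_product[OF _ _ loc_int_along[OF _ li(2)], where C=1 and R=R]) (auto split: split_indicator)
    then have pint: "integrable (lborel \<Otimes>\<^sub>M lborel) (\<lambda>(x, s). indicator {0..1} s *\<^sub>R ?v x *\<^sub>R along z (g (x + s *\<^sub>R z)))" by simp
    have "?v x *\<^sub>R path_int z g 1 x = (LBINT s. indicator {0..1} s *\<^sub>R ?v x *\<^sub>R along z (g (x + s *\<^sub>R z)))" for x
      unfolding path_int_def set_lebesgue_integral_def by (cases "x \<in> cball 0 R") simp_all
    then have "integrable lborel (\<lambda>x. ?v x *\<^sub>R path_int z g 1 x)"
      using lborel_pair.integrable_fst[OF pint] by simp
    then have "(NNINT x. ennreal (norm (?v x *\<^sub>R path_int z g 1 x))) < \<infinity>"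
      by (simp add: integrable_iff_bounded)
    also have "(NNINT x. ennreal (norm (?v x *\<^sub>R path_int z g 1 x))) = (NNINT x. ennreal (norm (path_int z g 1 x)) * indicator (cball 0 R) x)"
      by (intro nn_integral_cong) (auto split: split_indicator)
    finally show "(NNINT x. ennreal (norm (path_int z g 1 x)) * indicator (cball 0 R) x) < \<infinity>" .
  qed
  then have "loc_int ?f" by (intro loc_int_diff loc_int_shift li) measurable
  moreover have "(LBINT x. box_bump a b n x *\<^sub>R ?f x) = 0" if "box a b \<noteq> {}" for a b n
  proof -
    note t = weak_gradient_line_increment_tested[OF assms(1,2) wg that]
    show ?thesis
      using t(1)[of n z] t(2)[of n z] t(3)[of n] t(4)[of n z] by (simp add: scaleR_diff_right)
  qed
  ultimately have "AE x in lborel. ?f x = 0" by (intro loc_int_AE_zero_of_box_bump) measurable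
  then show ?thesis by eventually_elim (simp add: algebra_simps)
qed

text \<open>Every exceptional set is first found for a fixed direction; the points \<open>x\<close> are what has to be good
  for almost all directions simultaneously.\<close>

lemma AE_all_swap:
  fixes P :: "'a::euclidean_space \<Rightarrow> 'b::euclidean_space \<Rightarrow> bool"
  assumes [measurable]: "Measurable.pred (lborel \<Otimes>\<^sub>M lborel) (\<lambda>(x, w). P x w)"
    and "\<And>w. AE x in lborel. P x w"
  shows "AE x in lborel. AE w in lborel. P x w"
proof -
  have "{p \<in> space (lborel \<Otimes>\<^sub>M lborel). P (fst p) (snd p)} \<in> sets (lborel \<Otimes>\<^sub>M lborel)"
    using assms(1) by (simp only: pred_def case_prod_beta')
  from lborel_pair.AE_commute[OF this] show ?thesis using assms(2) by simp
qed

section \<open>Differentiation along lines\<close>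

text \<open>The product rule for the smooth phase \<open>cis (- (s * \<alpha>))\<close> and the primitive of an integrable function,
  in integrated form. It is Fubini's theorem on the triangle \<open>0 \<le> r \<le> s \<le> h\<close>, since the
  derivative of the phase integrates explicitly.\<close>

lemma gauge_product_rule:
  fixes \<gamma> :: "real \<Rightarrow> complex"
  assumes h: "0 \<le> h" and [measurable]: "\<gamma> \<in> borel_measurable borel" and int: "set_integrable lborel {0..h} \<gamma>"
  shows "cis (- (h * \<alpha>)) * (c + (LBINT s:{0..h}. \<gamma> s)) - c
     = (LBINT s:{0..h}. cis (- (s * \<alpha>)) * (\<gamma> s - \<i> * \<alpha> * (c + (LBINT r:{0..s}. \<gamma> r))))"
proof -
  define \<kappa> where "\<kappa> s = \<i> * complex_of_real \<alpha> * cis (- (s * \<alpha>))" for s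
  have cis_cont: "continuous_on S (\<lambda>s. cis (- (s * \<alpha>)))" for S
    unfolding cis_conv_exp by (intro continuous_intros)
  then have \<kappa>_cont: "continuous_on S \<kappa>" for S unfolding \<kappa>_def by (intro continuous_intros)
  have [measurable]: "(\<lambda>s. cis (- (s * \<alpha>))) \<in> borel_measurable borel" "\<kappa> \<in> borel_measurable borel"
    by (intro borel_measurable_continuous_onI cis_cont \<kappa>_cont)+
  have n\<kappa>: "norm (\<kappa> s) = \<bar>\<alpha>\<bar>" for s by (simp add: \<kappa>_def norm_mult)
  have FTC: "(LBINT s:{a..b}. \<kappa> s) = cis (- (a * \<alpha>)) - cis (- (b * \<alpha>))" if "a \<le> b" for a b
  proof -
    have "(LBINT s. indicator {a..b} s *\<^sub>R \<kappa> s) = - cis (- (b * \<alpha>)) - - cis (- (a * \<alpha>))"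
    proof (rule integral_FTC_atLeastAtMost[OF that _ \<kappa>_cont])
      fix s
      have "((\<lambda>s. - cis (- (s * \<alpha>))) has_vector_derivative \<kappa> s) (at s)"
        unfolding cis_conv_exp \<kappa>_def
        by (auto intro!: derivative_eq_intros has_vector_derivative_real_field simp: algebra_simps)
      then show "((\<lambda>s. - cis (- (s * \<alpha>))) has_vector_derivative \<kappa> s) (at s within {a..b})"
        by (rule has_vector_derivative_at_within)
    qed
    then show ?thesis by (simp add: set_lebesgue_integral_def)
  qed
  \<comment> \<open>The integrand on the triangle, extended by zero.\<close>
  define K where "K r s = (if 0 \<le> r \<and> r \<le> s \<and> s \<le> h then \<kappa> s * \<gamma> r else 0)" for r s
  have K_int: "integrable (lborel \<Otimes>\<^sub>M lborel) (\<lambda>(r, s). K r s)"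
  proof (rule integrable_pairI)
    let ?I = "NNINT r. ennreal (norm (indicator {0..h} r *\<^sub>R \<gamma> r))"
    have fin: "?I < \<infinity>" using int by (simp add: set_integrable_def integrable_iff_bounded)
    have "(NNINT s r. ennreal (norm (K r s)))
       \<le> (NNINT s r. (ennreal \<bar>\<alpha>\<bar> * ennreal (norm (indicator {0..h} r *\<^sub>R \<gamma> r))) * indicator {0..h} s)"
      by (intro nn_integral_mono) (auto simp: K_def norm_mult n\<kappa> ennreal_mult[symmetric] split: split_indicator)
    also have "\<dots> = (NNINT s. (ennreal \<bar>\<alpha>\<bar> * ?I) * indicator {0..h} s)"
      by (simp add: nn_integral_multc nn_integral_cmult)
    also have "\<dots> = ennreal \<bar>\<alpha>\<bar> * ?I * ennreal h" using h by (subst nn_integral_cmult_indicator) auto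
    also have "\<dots> < \<infinity>" using fin by (simp add: ennreal_mult_less_top)
    finally show "(NNINT s r. ennreal (norm (K r s))) < \<infinity>" .
  qed (unfold K_def, measurable)
  have inner_r: "(LBINT r. K r s) = indicator {0..h} s *\<^sub>R (\<kappa> s * (LBINT r:{0..s}. \<gamma> r))" for s
  proof (cases "s \<le> h")
    case True
    have "(LBINT r. K r s) = (LBINT r. \<kappa> s * (indicator {0..s} r *\<^sub>R \<gamma> r))"
      using True by (intro Bochner_Integration.integral_cong) (auto simp: K_def split: split_indicator)
    also have "\<dots> = \<kappa> s * (LBINT r:{0..s}. \<gamma> r)"
      unfolding set_lebesgue_integral_def by (rule integral_mult_right_zero)
    finally show ?thesis using True by (auto simp: set_lebesgue_integral_def split: split_indicator)
  qed (simp add: K_def)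
  have inner_s: "(LBINT s. K r s) = indicator {0..h} r *\<^sub>R (\<gamma> r * (cis (- (r * \<alpha>)) - cis (- (h * \<alpha>))))" for r
  proof (cases "r \<in> {0..h}")
    case True
    have "(LBINT s. K r s) = (LBINT s. \<gamma> r * (indicator {r..h} s *\<^sub>R \<kappa> s))"
      using True by (intro Bochner_Integration.integral_cong) (auto simp: K_def split: split_indicator)
    also have "\<dots> = \<gamma> r * (LBINT s:{r..h}. \<kappa> s)"
      unfolding set_lebesgue_integral_def by (rule integral_mult_right_zero)
    finally show ?thesis using True by (simp add: FTC)
  next
    case False
    then have "K r s = 0" for s by (auto simp: K_def)
    then show ?thesis using False by simp
  qed
  have i1: "set_integrable lborel {0..h} (\<lambda>s. cis (- (s * \<alpha>)) * \<gamma> s)"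
  proof -
    have "integrable lborel (\<lambda>s. indicator {0..h} s *\<^sub>R \<gamma> s)" using int by (simp add: set_integrable_def)
    then show ?thesis unfolding set_integrable_def
      by (rule Bochner_Integration.integrable_bound) (auto simp: norm_mult intro!: AE_I2)
  qed
  have i2: "set_integrable lborel {0..h} (\<lambda>s. \<kappa> s * c)"
    using \<kappa>_cont by (intro borel_integrable_atLeastAtMost' continuous_intros)
  have i3: "set_integrable lborel {0..h} (\<lambda>s. \<kappa> s * (LBINT r:{0..s}. \<gamma> r))"
    using lborel_pair.integrable_snd[OF K_int] unfolding inner_r set_integrable_def by simp
  have "(LBINT s:{0..h}. \<kappa> s * (LBINT r:{0..s}. \<gamma> r)) = (LBINT s. LBINT r. K r s)"
    unfolding inner_r by (simp add: set_lebesgue_integral_def)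
  also have "\<dots> = (LBINT r. LBINT s. K r s)"
    by (rule lborel_pair.Fubini_integral[OF K_int])
  also have "\<dots> = (LBINT r:{0..h}. cis (- (r * \<alpha>)) * \<gamma> r - cis (- (h * \<alpha>)) * \<gamma> r)"
    unfolding inner_s set_lebesgue_integral_def by (simp add: algebra_simps)
  also have "\<dots> = (LBINT r:{0..h}. cis (- (r * \<alpha>)) * \<gamma> r) - cis (- (h * \<alpha>)) * (LBINT r:{0..h}. \<gamma> r)"
    using i1 int by (subst set_integral_diff(2)) auto
  finally have E: "(LBINT s:{0..h}. \<kappa> s * (LBINT r:{0..s}. \<gamma> r)) = (LBINT r:{0..h}. cis (- (r * \<alpha>)) * \<gamma> r) - cis (- (h * \<alpha>)) * (LBINT r:{0..h}. \<gamma> r)" .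
  have "(LBINT s:{0..h}. cis (- (s * \<alpha>)) * (\<gamma> s - \<i> * \<alpha> * (c + (LBINT r:{0..s}. \<gamma> r))))
    = (LBINT s:{0..h}. cis (- (s * \<alpha>)) * \<gamma> s - (\<kappa> s * c + \<kappa> s * (LBINT r:{0..s}. \<gamma> r)))"
    by (simp add: \<kappa>_def algebra_simps)
  also have "\<dots> = (LBINT s:{0..h}. cis (- (s * \<alpha>)) * \<gamma> s) - ((LBINT s:{0..h}. \<kappa> s * c) + (LBINT s:{0..h}. \<kappa> s * (LBINT r:{0..s}. \<gamma> r)))"
    using i1 i2 i3 by (subst set_integral_diff(2) | subst set_integral_add(2) | rule set_integral_add(1) | simp)+
  also have "(LBINT s:{0..h}. \<kappa> s * c) = (1 - cis (- (h * \<alpha>))) * c"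
    using FTC[OF h] by simp
  finally show ?thesis unfolding E by (simp add: algebra_simps)
qed

lemma AE_line_integrable:
  fixes g :: "'a::euclidean_space \<Rightarrow> 'b::{banach, second_countable_topology}"
  assumes [measurable]: "g \<in> borel_measurable borel" and g: "loc_int g"
  shows "AE x in lborel. \<forall>M::nat. (NNINT s. ennreal (norm (g (x + s *\<^sub>R z))) * indicator {- real M..real M} s) < \<infinity>"
proof -
  let ?S = "\<lambda>M x. NNINT s. ennreal (norm (g (x + s *\<^sub>R z))) * indicator {- real M..real M} s"
  have "AE x in lborel. x \<in> cball 0 (real R) \<longrightarrow> ?S M x < \<infinity>" for M R :: nat
  proof -
    let ?R' = "real R + real M * norm z"
    let ?I = "NNINT x. ennreal (norm (g x)) * indicator (cball 0 ?R') x"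
    have "(NNINT x. ?S M x * indicator (cball 0 (real R)) x)
       = (NNINT x s. ennreal (norm (g (x + s *\<^sub>R z))) * indicator {- real M..real M} s * indicator (cball 0 (real R)) x)"
      by (intro nn_integral_cong nn_integral_multc[symmetric]) measurable
    also have "\<dots> = (NNINT s x. ennreal (norm (g (x + s *\<^sub>R z))) * indicator {- real M..real M} s * indicator (cball 0 (real R)) x)"
      by (rule lborel_pair.Fubini') measurable
    also have "\<dots> \<le> (NNINT s. ?I * indicator {- real M..real M} s)"
    proof (intro nn_integral_mono)
      fix s :: real
      show "(NNINT x. ennreal (norm (g (x + s *\<^sub>R z))) * indicator {- real M..real M} s * indicator (cball 0 (real R)) x) \<le> ?I * indicator {- real M..real M} s"
      proof (cases "s \<in> {- real M..real M}")
        case True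
        then have sz: "norm (s *\<^sub>R z) \<le> real M * norm z" by (auto intro!: mult_right_mono)
        have "(NNINT x. ennreal (norm (g (x + s *\<^sub>R z))) * indicator {- real M..real M} s * indicator (cball 0 (real R)) x)
          \<le> (NNINT x. ennreal (norm (g (x + s *\<^sub>R z))) * indicator (cball 0 ?R') (x + s *\<^sub>R z))"
        proof (intro nn_integral_mono)
          fix x :: 'a
          have "norm (x + s *\<^sub>R z) \<le> ?R'" if "norm x \<le> real R"
            using that sz norm_triangle_ineq[of x "s *\<^sub>R z"] by linarith
          then show "ennreal (norm (g (x + s *\<^sub>R z))) * indicator {- real M..real M} s * indicator (cball 0 (real R)) x \<le> ennreal (norm (g (x + s *\<^sub>R z))) * indicator (cball 0 ?R') (x + s *\<^sub>R z)"
            by (auto split: split_indicator)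
        qed
        also have "\<dots> = ?I" by (rule nn_integral_lborel_shift) measurable
        finally show ?thesis using True by simp
      qed simp
    qed
    also have "\<dots> = ?I * ennreal (2 * real M)" by (subst nn_integral_cmult_indicator) auto
    also have "\<dots> < \<infinity>" using g by (auto simp: loc_int_def ennreal_mult_less_top)
    finally have "AE x in lborel. ?S M x * indicator (cball 0 (real R)) x \<noteq> \<infinity>"
      by (intro nn_integral_noteq_infinite) auto
    then show ?thesis by eventually_elim (auto simp: less_top split: split_indicator_asm)
  qed
  then have "AE x in lborel. \<forall>M R::nat. x \<in> cball 0 (real R) \<longrightarrow> ?S M x < \<infinity>"
    by (intro AE_all_countable[THEN iffD2] allI)
  then show ?thesis
  proof eventually_elim
    case (elim x)
    obtain R :: nat where "norm x \<le> real R" using real_arch_simple by blast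
    then show ?case using elim by auto
  qed
qed

lemma set_integrable_line:
  fixes g :: "real^'n \<Rightarrow> complex^'n"
  assumes [measurable]: "g \<in> borel_measurable borel"
    and fin: "\<forall>M::nat. (NNINT s. ennreal (norm (g (x + s *\<^sub>R z))) * indicator {- real M..real M} s) < \<infinity>"
  shows "set_integrable lborel {a..b} (\<lambda>s. along z (g (x + s *\<^sub>R z)))"
  unfolding set_integrable_def
proof (rule integrableI_bounded)
  obtain M :: nat where M: "max \<bar>a\<bar> \<bar>b\<bar> \<le> real M" using real_arch_simple by blast
  have "(NNINT s. ennreal (norm (indicat_real {a..b} s *\<^sub>R along z (g (x + s *\<^sub>R z)))))
    \<le> (NNINT s. ennreal (norm z) * (ennreal (norm (g (x + s *\<^sub>R z))) * indicator {- real M..real M} s))"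
    using M norm_along_le by (intro nn_integral_mono) (auto simp: ennreal_mult[symmetric] intro!: ennreal_leI split: split_indicator)
  also have "\<dots> = ennreal (norm z) * (NNINT s. ennreal (norm (g (x + s *\<^sub>R z))) * indicator {- real M..real M} s)"
    by (rule nn_integral_cmult) measurable
  also have "\<dots> < \<infinity>" using fin by (simp add: ennreal_mult_less_top)
  finally show "(NNINT s. ennreal (norm (indicat_real {a..b} s *\<^sub>R along z (g (x + s *\<^sub>R z))))) < \<infinity>" .
qed measurable

lemma path_int_scale:
  fixes g :: "real^'n \<Rightarrow> complex^'n"
  assumes "0 < h"
  shows "path_int (h *\<^sub>R z) g 1 x = path_int z g h x"
proof -
  have "path_int z g h x = \<bar>h\<bar> *\<^sub>R (LBINT s. indicator {0..h} (0 + h * s) *\<^sub>R along z (g (x + (0 + h * s) *\<^sub>R z)))"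
    unfolding path_int_def set_lebesgue_integral_def using assms by (intro lborel_integral_real_affine) simp
  also have "\<dots> = (LBINT s. h *\<^sub>R (indicator {0..h} (0 + h * s) *\<^sub>R along z (g (x + (0 + h * s) *\<^sub>R z))))"
    using assms by (simp del: scaleR_scaleR)
  also have "\<dots> = path_int (h *\<^sub>R z) g 1 x"
    unfolding path_int_def set_lebesgue_integral_def
    using assms by (intro Bochner_Integration.integral_cong) (auto simp: along_scale mult.commute mult_le_cancel_left1 zero_le_mult_iff split: split_indicator)
  finally show ?thesis ..
qed

text \<open>The averages of the directional derivative over short segments starting at \<open>x\<close> converge to its value.
  Only dyadic lengths enter, which makes this a measurable condition on \<open>z\<close> and \<open>x\<close>; continuity of the
  integral in its endpoint extends the convergence to all lengths.\<close>

definition right_lebesgue_point :: "(real^'n \<Rightarrow> complex^'n) \<Rightarrow> real^'n \<Rightarrow> real^'n \<Rightarrow> bool" where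
  "right_lebesgue_point g z x \<longleftrightarrow> (\<forall>k::nat. \<exists>m::nat. \<forall>p. dyadic p < 1 / real (Suc m) \<longrightarrow>
     norm (path_int z g (dyadic p) x /\<^sub>R dyadic p - along z (g x)) \<le> 1 / real (Suc k))"

lemma pred_right_lebesgue_point[measurable (raw)]:
  fixes g :: "real^'n \<Rightarrow> complex^'n"
  assumes [measurable]: "g \<in> borel_measurable borel" "z \<in> borel_measurable M" "x \<in> borel_measurable M"
  shows "Measurable.pred M (\<lambda>y. right_lebesgue_point g (z y) (x y))"
  unfolding right_lebesgue_point_def by measurable

lemma AE_right_derivative_integral:
  fixes f :: "real \<Rightarrow> complex"
  assumes "\<And>a b. set_integrable lborel {a..b} f"
  shows "AE s in lborel. ((\<lambda>h. (LBINT r:{s..s + h}. f r) /\<^sub>R h) \<longlongrightarrow> f s) (at_right 0)"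
proof -
  have HK: "f integrable_on cbox a b" for a b
    using set_borel_integral_eq_integral(1)[OF assms[of a b]] by (simp add: cbox_interval)
  obtain N where N: "negligible N" "\<And>x e. \<lbrakk>x \<notin> N; 0 < e\<rbrakk> \<Longrightarrow>
       \<exists>d>0. \<forall>h. 0 < h \<and> h < d \<longrightarrow> norm (integral (cbox x (x + h *\<^sub>R One)) f /\<^sub>R h ^ DIM(real) - f x) < e"
    using integrable_ccontinuous_explicit[of f] HK by blast
  have "((\<lambda>h. (LBINT r:{s..s + h}. f r) /\<^sub>R h) \<longlongrightarrow> f s) (at_right 0)" if s: "s \<notin> N" for s
  proof (rule tendstoI)
    fix e :: real assume e: "0 < e"
    obtain d where d: "d > 0" "\<And>h. 0 < h \<Longrightarrow> h < d \<Longrightarrow> norm (integral (cbox s (s + h *\<^sub>R One)) f /\<^sub>R h ^ DIM(real) - f s) < e"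
      using N(2)[OF s e] by blast
    have "dist ((LBINT r:{s..s + h}. f r) /\<^sub>R h) (f s) < e" if "0 < h" "h < d" for h
      using d(2)[OF that] set_borel_integral_eq_integral(2)[OF assms[of s "s + h"]]
      by (simp add: dist_norm cbox_interval)
    then show "\<forall>\<^sub>F h in at_right 0. dist ((LBINT r:{s..s + h}. f r) /\<^sub>R h) (f s) < e"
      unfolding eventually_at_right_field using d(1) by blast
  qed
  moreover have "AE x in lebesgue. x \<notin> N" using N(1) by (intro AE_not_in) (simp add: negligible_iff_null_sets)
  ultimately have "AE s in lebesgue. ((\<lambda>h. (LBINT r:{s..s + h}. f r) /\<^sub>R h) \<longlongrightarrow> f s) (at_right 0)"
    by (auto elim: eventually_mono)
  then show ?thesis by (simp add: AE_completion_iff)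
qed

text \<open>On almost every line almost every point has the property, by differentiation of integrals in one
  variable. Hence there is a single shift along \<open>z\<close> for which almost every shifted point has it, and
  translations preserve null sets.\<close>

lemma AE_right_lebesgue_point:
  fixes g :: "real^'n \<Rightarrow> complex^'n"
  assumes [measurable]: "g \<in> borel_measurable borel" and g: "loc_int g"
  shows "AE x in lborel. right_lebesgue_point g z x"
proof -
  have "AE x in lborel. AE s in lborel. right_lebesgue_point g z (x + s *\<^sub>R z)"
    using AE_line_integrable[OF assms, of z]
  proof eventually_elim
    case (elim x)
    let ?f = "\<lambda>s. along z (g (x + s *\<^sub>R z))"
    have "AE s in lborel. ((\<lambda>h. (LBINT r:{s..s + h}. ?f r) /\<^sub>R h) \<longlongrightarrow> ?f s) (at_right 0)"
      by (rule AE_right_derivative_integral) (rule set_integrable_line[OF assms(1) elim])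
    then show ?case
    proof eventually_elim
      case (elim s)
      have path: "path_int z g h (x + s *\<^sub>R z) = (LBINT r:{s..s + h}. ?f r)" for h
      proof -
        have "(LBINT r:{s..s + h}. ?f r) = \<bar>1\<bar> *\<^sub>R (LBINT r. indicator {s..s + h} (s + 1 * r) *\<^sub>R ?f (s + 1 * r))"
          unfolding set_lebesgue_integral_def by (rule lborel_integral_real_affine) simp
        also have "\<dots> = path_int z g h (x + s *\<^sub>R z)"
          unfolding path_int_def set_lebesgue_integral_def
          by (simp, intro Bochner_Integration.integral_cong) (auto simp: algebra_simps split: split_indicator)
        finally show ?thesis ..
      qed
      show ?case unfolding right_lebesgue_point_def
      proof
        fix k :: nat
        have "\<forall>\<^sub>F h in at_right 0. dist ((LBINT r:{s..s + h}. ?f r) /\<^sub>R h) (?f s) < 1 / real (Suc k)"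
          using elim by (rule tendstoD) simp
        then obtain d where d: "0 < d" "\<And>h. 0 < h \<Longrightarrow> h < d \<Longrightarrow> dist ((LBINT r:{s..s + h}. ?f r) /\<^sub>R h) (?f s) < 1 / real (Suc k)"
          unfolding eventually_at_right_field by blast
        obtain m where m: "1 / real (Suc m) < d" using d(1) nat_approx_posE by blast
        show "\<exists>m. \<forall>p. dyadic p < 1 / real (Suc m) \<longrightarrow>
          norm (path_int z g (dyadic p) (x + s *\<^sub>R z) /\<^sub>R dyadic p - along z (g (x + s *\<^sub>R z))) \<le> 1 / real (Suc k)"
        proof (intro exI[of _ m] allI impI)
          fix p assume "dyadic p < 1 / real (Suc m)"
          then have "dist ((LBINT r:{s..s + dyadic p}. ?f r) /\<^sub>R dyadic p) (?f s) < 1 / real (Suc k)"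
            using m by (intro d(2) dyadic_pos) simp
          then show "norm (path_int z g (dyadic p) (x + s *\<^sub>R z) /\<^sub>R dyadic p - along z (g (x + s *\<^sub>R z))) \<le> 1 / real (Suc k)"
            unfolding path dist_norm by simp
        qed
      qed
    qed
  qed
  then have "AE s in lborel. AE x in lborel. right_lebesgue_point g z (x + s *\<^sub>R z)"
    by (subst lborel_pair.AE_commute[symmetric]) (simp_all only: pred_def[symmetric], measurable)
  moreover have "ae_filter (lborel :: real measure) \<noteq> bot" by (simp add: ae_filter_eq_bot_iff)
  ultimately have "\<exists>s. AE x in lborel. right_lebesgue_point g z (x + s *\<^sub>R z)"
    by (metis (no_types, lifting) eventually_happens')
  then obtain s where "AE x in lborel. right_lebesgue_point g z (x + s *\<^sub>R z)" by blast
  from AE_lborel_affine[OF this, of 1 "- (s *\<^sub>R z)"] show ?thesis by simp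
qed

lemma right_lebesgue_point_tendsto:
  fixes g :: "real^'n \<Rightarrow> complex^'n"
  assumes "\<And>a b. set_integrable lborel {a..b} (\<lambda>s. along z (g (x + s *\<^sub>R z)))"
    and rlp: "right_lebesgue_point g z x"
  shows "((\<lambda>h. path_int z g h x /\<^sub>R h) \<longlongrightarrow> along z (g x)) (at_right 0)"
proof (rule tendstoI)
  fix e :: real assume e: "0 < e"
  obtain k where k: "1 / real (Suc k) < e" using e nat_approx_posE by blast
  obtain m where m: "\<And>p. dyadic p < 1 / real (Suc m) \<Longrightarrow>
     norm (path_int z g (dyadic p) x /\<^sub>R dyadic p - along z (g x)) \<le> 1 / real (Suc k)"
    using rlp unfolding right_lebesgue_point_def by blast
  let ?\<psi> = "\<lambda>h. norm (path_int z g h x /\<^sub>R h - along z (g x))"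
  have cont: "continuous_on {0<..} ?\<psi>"
  proof -
    have eq: "path_int z g h x = integral {0..h} (\<lambda>s. along z (g (x + s *\<^sub>R z)))" for h
      unfolding path_int_def using set_borel_integral_eq_integral(2)[OF assms(1)] .
    have "continuous_on {0..b} (\<lambda>h. path_int z g h x)" for b
      unfolding eq by (rule indefinite_integral_continuous_1) (rule set_borel_integral_eq_integral(1)[OF assms(1)])
    then have "isCont (\<lambda>h. path_int z g h x) t" if "0 < t" for t
      using that by (intro continuous_on_interior[of "{0..t+1}"]) (auto simp: interior_atLeastAtMost_real)
    then have "continuous_on {0<..} (\<lambda>h. path_int z g h x)"
      by (auto intro: continuous_at_imp_continuous_on)
    then show ?thesis by (intro continuous_intros) auto
  qed
  have "?\<psi> h \<le> 1 / real (Suc k)" if h: "0 < h" "h < 1 / real (Suc m)" for h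
  proof (rule ccontr)
    assume "\<not> ?\<psi> h \<le> 1 / real (Suc k)"
    then have "0 < ?\<psi> h - 1 / real (Suc k)" by simp
    moreover have "isCont ?\<psi> h" using cont h(1) by (simp add: continuous_on_eq_continuous_at)
    ultimately obtain d where d: "0 < d" "\<And>h'. \<bar>h' - h\<bar> < d \<Longrightarrow> \<bar>?\<psi> h' - ?\<psi> h\<bar> < ?\<psi> h - 1 / real (Suc k)"
      unfolding continuous_at_eps_delta dist_real_def by metis
    have "h < min (h + d) (1 / real (Suc m))" using d(1) h by simp
    then obtain p where p: "h < dyadic p" "dyadic p < min (h + d) (1 / real (Suc m))"
      using dyadic_dense h(1) by blast
    then have "\<bar>dyadic p - h\<bar> < d" by simp
    from d(2)[OF this] m[of p] p(2) show False by linarith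
  qed
  then show "\<forall>\<^sub>F h in at_right 0. dist (path_int z g h x /\<^sub>R h) (along z (g x)) < e"
    unfolding eventually_at_right_field dist_norm using k
    by (intro exI[of _ "1 / real (Suc m)"]) (auto intro: le_less_trans)
qed

text \<open>Pairs of a direction and a time are treated as one variable, so that one exchange of quantifiers
  suffices.\<close>

lemma AE_line_absolutely_continuous:
  fixes u :: "real^'n \<Rightarrow> complex" and g :: "real^'n \<Rightarrow> complex^'n"
  assumes [measurable]: "u \<in> borel_measurable borel" "g \<in> borel_measurable borel"
    and wg: "weak_gradient u g"
  shows "AE x in lborel. AE z in lborel. AE s in lborel. 0 < s \<longrightarrow> u (x + s *\<^sub>R z) = u x + path_int z g s x"
proof -
  let ?P = "\<lambda>x (z, s). 0 < s \<longrightarrow> u (x + s *\<^sub>R z) = u x + path_int z g s x"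
  have "AE x in lborel. AE w in lborel. ?P x w"
  proof (rule AE_all_swap)
    show "Measurable.pred (lborel \<Otimes>\<^sub>M lborel) (\<lambda>(x, w). ?P x w)"
      unfolding lborel_prod[symmetric] by measurable
  next
    fix w :: "(real^'n) \<times> real"
    obtain z s where w: "w = (z, s)" by force
    show "AE x in lborel. ?P x w"
    proof (cases "0 < s")
      case True
      from weak_gradient_line_increment[OF assms, of "s *\<^sub>R z"] show ?thesis
        unfolding w path_int_scale[OF True] by (auto elim: eventually_mono)
    qed (simp add: w)
  qed
  then show ?thesis
  proof eventually_elim
    case (elim x)
    have "AE w in lborel \<Otimes>\<^sub>M lborel. ?P x w" using elim by (simp only: lborel_prod)
    from lborel_pair.AE_pair[OF this] show ?case by simp
  qed
qed

section \<open>Increments of the gauged function\<close>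

lemma norm_cis_diff_le: "norm (cis a - cis b) \<le> \<bar>a - b\<bar>"
proof -
  have "cis a - cis b = cis b * (cis (a - b) - 1)" by (simp add: cis_mult algebra_simps)
  then have "norm (cis a - cis b) = norm (exp (\<i> * complex_of_real (a - b)) - 1)"
    by (simp add: norm_mult cis_conv_exp)
  also have "\<dots> = 2 * \<bar>sin ((a - b) / 2)\<bar>"
    using dist_exp_i_1[of "a - b"] by simp
  also have "\<dots> \<le> \<bar>a - b\<bar>" using abs_sin_x_le_abs_x[of "(a - b) / 2"] by simp
  finally show ?thesis .
qed

lemma norm_integral_le_nn_integral:
  fixes f :: "'a \<Rightarrow> 'b::{banach, second_countable_topology}"
  shows "ennreal (norm (\<integral>x. f x \<partial>M)) \<le> (\<integral>\<^sup>+x. ennreal (norm (f x)) \<partial>M)"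
  by (cases "integrable M f") (simp_all add: integral_norm_bound_ennreal not_integrable_integral_eq)

text \<open>Dominated convergence is a statement about sequences.\<close>

lemma tendsto_at_right_0I_sequentially:
  fixes f :: "real \<Rightarrow> 'a::topological_space"
  assumes "\<And>X. (\<And>i::nat. 0 < X i) \<Longrightarrow> X \<longlonglongrightarrow> 0 \<Longrightarrow> (\<lambda>i. f (X i)) \<longlonglongrightarrow> l"
  shows "(f \<longlongrightarrow> l) (at_right 0)"
  unfolding tendsto_at_iff_sequentially using assms by (auto simp: o_def)

text \<open>The setting for Borel representatives: exchanging quantifiers and integrals needs measurability with
  respect to product measures, which may fail for functions that are merely Lebesgue measurable.\<close>

locale borel_magnetic =
  fixes A :: "real^'n \<Rightarrow> real^'n" and L :: real
    and u :: "real^'n \<Rightarrow> complex" and g :: "real^'n \<Rightarrow> complex^'n"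
  assumes A: "L-lipschitz_on UNIV A"
    and u_borel[measurable]: "u \<in> borel_measurable borel"
    and g_borel[measurable]: "g \<in> borel_measurable borel"
    and wg: "weak_gradient u g"
    and u_L2: "(NNINT x. ennreal ((norm (u x))\<^sup>2)) < \<infinity>"
    and D_L2: "(NNINT x. ennreal ((norm (magnetic_grad A u g x))\<^sup>2)) < \<infinity>"
begin

abbreviation D :: "real^'n \<Rightarrow> complex^'n" where "D \<equiv> magnetic_grad A u g"

text \<open>With the potential frozen at the starting point, \<open>norm z * F\<close> bounds the derivative of the gauged
  function along a segment in direction \<open>z\<close> of length at most \<open>1\<close>.\<close>

definition F :: "real^'n \<Rightarrow> real" where "F y = norm (D y) + L * norm (u y)"

text \<open>What \<open>Psi A u x (x + h z)\<close> becomes when \<open>u (x + h z)\<close> is replaced by the primitive of its derivative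
  along the line. This is defined for every \<open>h\<close> at once and continuous in \<open>h\<close> along almost every line,
  while for fixed \<open>x\<close> and \<open>z\<close> the values of \<open>u\<close> along the line agree with it only for almost every \<open>h\<close>.\<close>

definition gauged :: "real^'n \<Rightarrow> real^'n \<Rightarrow> real \<Rightarrow> complex" where
  "gauged x z h = cis (- (h * (z \<bullet> A (x + (h / 2) *\<^sub>R z)))) * (u x + path_int z g h x)"

definition weight :: "real^'n \<Rightarrow> ennreal" where
  "weight z = ennreal (1 / norm z ^ (CARD('n) + 2))"

definition regular_pair :: "real^'n \<Rightarrow> real^'n \<Rightarrow> bool" where
  "regular_pair x z \<longleftrightarrow> (\<forall>a b. set_integrable lborel {a..b} (\<lambda>s. along z (g (x + s *\<^sub>R z)))) \<and>
     (AE s in lborel. 0 < s \<longrightarrow> u (x + s *\<^sub>R z) = u x + path_int z g s x) \<and> right_lebesgue_point g z x"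

lemma L_nonneg: "0 \<le> L"
  using A by (rule lipschitz_on_nonneg)

lemma A_lipschitz: "norm (A x - A y) \<le> L * norm (x - y)"
  using lipschitz_onD[OF A, of x y] by (simp add: dist_norm)

lemma A_continuous: "continuous_on S A"
  using lipschitz_on_continuous_on[OF A] by (rule continuous_on_subset) simp

lemma A_borel[measurable]: "A \<in> borel_measurable borel"
  by (intro borel_measurable_continuous_onI A_continuous)

lemma D_borel[measurable]: "D \<in> borel_measurable borel"
proof -
  have "(\<lambda>x. D x \<bullet> b) \<in> borel_measurable borel" if b: "b \<in> Basis" for b
  proof -
    obtain j c where "b = axis j c" using b unfolding Basis_vec_def by blast
    then have "D x \<bullet> b = (g x $ j - \<i> * complex_of_real (A x $ j) * u x) \<bullet> c" for x
      by (simp add: inner_axis magnetic_grad_def)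
    then show ?thesis by simp
  qed
  then show ?thesis by (subst borel_measurable_euclidean_space) blast
qed

lemma F_borel[measurable]: "F \<in> borel_measurable borel"
  unfolding F_def[abs_def] by measurable

lemma F_nonneg: "0 \<le> F y"
  using L_nonneg by (simp add: F_def)

lemma weight_borel[measurable]: "weight \<in> borel_measurable borel"
  unfolding weight_def[abs_def] by measurable

lemma gauged_borel[measurable (raw)]:
  assumes [measurable]: "x \<in> borel_measurable M" "z \<in> borel_measurable M" "h \<in> borel_measurable M"
  shows "(\<lambda>y. gauged (x y) (z y) (h y)) \<in> borel_measurable M"
proof -
  have [measurable]: "cis \<in> borel_measurable borel"
    unfolding cis_conv_exp[abs_def] by (intro borel_measurable_continuous_onI continuous_intros)
  show ?thesis unfolding gauged_def by measurable
qed

lemma along_magnetic_grad: "along z (D y) = along z (g y) - \<i> * complex_of_real (z \<bullet> A y) * u y"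
proof -
  have "along z (D y) = (\<Sum>j\<in>UNIV. z $ j *\<^sub>R g y $ j - (\<i> * complex_of_real (z $ j * A y $ j)) * u y)"
    unfolding along_def magnetic_grad_def by (intro sum.cong) (auto simp: scaleR_conv_of_real algebra_simps)
  also have "\<dots> = along z (g y) - \<i> * complex_of_real (z \<bullet> A y) * u y"
    by (simp add: sum_subtractf along_def inner_vec_def sum_distrib_left sum_distrib_right)
  finally show ?thesis .
qed

lemma AE_regular_pair: "AE x in lborel. AE z in lborel. regular_pair x z"
proof -
  note li = loc_int_gradient[OF u_borel g_borel wg]
  have 1: "AE x in lborel. AE z in lborel. \<forall>M::nat. (NNINT s. ennreal (norm (g (x + s *\<^sub>R z))) * indicator {- real M..real M} s) < \<infinity>"
    by (rule AE_all_swap[OF _ AE_line_integrable[OF g_borel li(2)]]) measurable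
  have 2: "AE x in lborel. AE z in lborel. right_lebesgue_point g z x"
    by (rule AE_all_swap[OF _ AE_right_lebesgue_point[OF g_borel li(2)]]) measurable
  show ?thesis
    using 1 2 AE_line_absolutely_continuous[OF u_borel g_borel wg]
  proof eventually_elim
    case (elim x)
    from elim(1) elim(2) elim(3) show ?case
    proof eventually_elim
      case (elim z)
      then show ?case unfolding regular_pair_def using set_integrable_line[OF g_borel] by blast
    qed
  qed
qed

text \<open>With the phase frozen at \<open>A x\<close>, the derivative along the line is \<open>along z (D y)\<close> plus an error
  \<open>z \<bullet> (A y - A x)\<close> times \<open>u y\<close>, up to a factor of modulus one. As \<open>A\<close> is Lipschitz and the
  segment has length at most \<open>1\<close>, the error is at most \<open>L * norm z * norm (u y)\<close>.\<close>

lemma linear_gauge_increment: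
  assumes h: "0 < h" "h * norm z \<le> 1" and reg: "regular_pair x z"
  shows "ennreal (norm (cis (- (h * (z \<bullet> A x))) * (u x + path_int z g h x) - u x))
     \<le> ennreal (norm z) * line_integral z (\<lambda>y. ennreal (F y)) h x"
proof -
  let ?\<alpha> = "z \<bullet> A x" and ?\<gamma> = "\<lambda>s. along z (g (x + s *\<^sub>R z))"
  let ?I = "\<lambda>s. indicator {0..h} s *\<^sub>R (cis (- (s * ?\<alpha>)) * (?\<gamma> s - \<i> * ?\<alpha> * (u x + path_int z g s x)))"
  have rule: "cis (- (h * ?\<alpha>)) * (u x + path_int z g h x) - u x = (LBINT s. ?I s)"
    using gauge_product_rule[of h ?\<gamma> ?\<alpha> "u x"] reg h
    unfolding regular_pair_def path_int_def set_lebesgue_integral_def by simp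
  have "ennreal (norm (cis (- (h * ?\<alpha>)) * (u x + path_int z g h x) - u x)) \<le> (NNINT s. ennreal (norm (?I s)))"
    unfolding rule by (rule norm_integral_le_nn_integral)
  also have "\<dots> \<le> (NNINT s. ennreal (norm z) * (ennreal (F (x + s *\<^sub>R z)) * indicator {0..<h} s))"
  proof (rule nn_integral_mono_AE)
    have "AE s in lborel. 0 < s \<longrightarrow> u (x + s *\<^sub>R z) = u x + path_int z g s x"
      using reg by (simp add: regular_pair_def)
    then show "AE s in lborel. ennreal (norm (?I s)) \<le> ennreal (norm z) * (ennreal (F (x + s *\<^sub>R z)) * indicator {0..<h} s)"
      using AE_lborel_singleton[of 0] AE_lborel_singleton[of h]
    proof eventually_elim
      case (elim s)
      show ?case
      proof (cases "s \<in> {0..h}")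
        case True
        then have s: "0 < s" "s < h" using elim by auto
        let ?y = "x + s *\<^sub>R z"
        have U: "u x + path_int z g s x = u ?y" using elim(1) s by simp
        have eq: "?\<gamma> s - \<i> * ?\<alpha> * u ?y = along z (D ?y) + \<i> * complex_of_real (z \<bullet> (A ?y - A x)) * u ?y"
          unfolding along_magnetic_grad by (simp add: inner_diff_right algebra_simps)
        have sz: "s * norm z \<le> 1" using s h by (meson mult_right_mono norm_ge_zero order_trans less_imp_le)
        have "\<bar>z \<bullet> (A ?y - A x)\<bar> \<le> norm z * norm (A ?y - A x)" by (rule Cauchy_Schwarz_ineq2)
        also have "\<dots> \<le> norm z * (L * (s * norm z))"
          using A_lipschitz[of ?y x] s by (intro mult_left_mono) auto
        also have "\<dots> \<le> norm z * (L * 1)"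
          using sz L_nonneg by (intro mult_left_mono) auto
        finally have b: "\<bar>z \<bullet> (A ?y - A x)\<bar> \<le> norm z * L" by simp
        have "norm (?\<gamma> s - \<i> * ?\<alpha> * u ?y) \<le> norm (along z (D ?y)) + \<bar>z \<bullet> (A ?y - A x)\<bar> * norm (u ?y)"
          unfolding eq by (rule order_trans[OF norm_triangle_ineq]) (simp add: norm_mult)
        also have "\<dots> \<le> norm z * norm (D ?y) + norm z * L * norm (u ?y)"
          using b by (intro add_mono norm_along_le mult_right_mono) auto
        also have "\<dots> = norm z * F ?y" by (simp add: F_def algebra_simps)
        finally have "norm (?\<gamma> s - \<i> * ?\<alpha> * u ?y) \<le> norm z * F ?y" .
        then show ?thesis using True s F_nonneg[of ?y] unfolding U
          by (simp add: norm_mult ennreal_mult[symmetric] ennreal_leI)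
      qed simp
    qed
  qed
  also have "\<dots> = ennreal (norm z) * line_integral z (\<lambda>y. ennreal (F y)) h x"
    unfolding line_integral_def by (rule nn_integral_cmult) measurable
  finally show ?thesis .
qed

text \<open>Replacing the midpoint phase by the frozen one costs at most \<open>L / 2 * (h * norm z)^2\<close> times the modulus
  of the function, which in turn is at most \<open>norm (u x)\<close> plus the frozen increment. If neither of the
  two alternatives held, the contributions of \<open>norm (u x)\<close> and of the frozen increment would be at most
  \<open>h / 2\<close> each; this is what the factor \<open>2 + L\<close> is for.\<close>

lemma gauged_increment_bound:
  assumes h: "0 < h" "h * norm z \<le> 1" and reg: "regular_pair x z"
    and big: "h < norm (gauged x z h - u x)"
  shows "1 < ennreal (norm z) * line_max z (\<lambda>y. ennreal ((2 + L) * F y)) x \<or> 1 < (L * norm (u x)) * norm z"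
proof (rule ccontr)
  assume "\<not> ?thesis"
  then have M: "ennreal (norm z) * line_max z (\<lambda>y. ennreal ((2 + L) * F y)) x \<le> 1"
    and ux: "(L * norm (u x)) * norm z \<le> 1" by auto
  let ?w = "cis (- (h * (z \<bullet> A x))) * (u x + path_int z g h x)"
  define b where "b = norm (?w - u x)"
  have "ennreal ((2 + L) * b) = ennreal (2 + L) * ennreal b"
    using L_nonneg by (intro ennreal_mult) (auto simp: b_def)
  also have "\<dots> \<le> ennreal (2 + L) * (ennreal (norm z) * line_integral z (\<lambda>y. ennreal (F y)) h x)"
    using linear_gauge_increment[OF h reg] unfolding b_def by (intro mult_left_mono) auto
  also have "\<dots> = ennreal (norm z) * (ennreal (2 + L) * line_integral z (\<lambda>y. ennreal (F y)) h x)"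
    by (simp add: ac_simps)
  also have "ennreal (2 + L) * line_integral z (\<lambda>y. ennreal (F y)) h x = line_integral z (\<lambda>y. ennreal ((2 + L) * F y)) h x"
    unfolding line_integral_def using L_nonneg F_nonneg
    by (subst nn_integral_cmult[symmetric]) (auto simp: ennreal_mult mult.assoc)
  also have "ennreal (norm z) * \<dots> \<le> ennreal (norm z) * (ennreal h * line_max z (\<lambda>y. ennreal ((2 + L) * F y)) x)"
    using h by (intro mult_left_mono line_integral_le_line_max) auto
  also have "\<dots> = ennreal h * (ennreal (norm z) * line_max z (\<lambda>y. ennreal ((2 + L) * F y)) x)"
    by (simp add: ac_simps)
  also have "\<dots> \<le> ennreal h * 1" by (intro mult_left_mono M) simp
  finally have b: "(2 + L) * b \<le> h" using h by simp
  let ?\<theta> = "\<lambda>v. - (h * (z \<bullet> A v))" and ?m = "x + (h / 2) *\<^sub>R z"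
  have "\<bar>?\<theta> ?m - ?\<theta> x\<bar> = h * \<bar>z \<bullet> (A ?m - A x)\<bar>"
  proof -
    have "?\<theta> ?m - ?\<theta> x = - (h * (z \<bullet> (A ?m - A x)))" by (simp add: inner_diff_right right_diff_distrib)
    then show ?thesis using h(1) by (simp add: abs_mult)
  qed
  also have "\<dots> \<le> h * (norm z * (L * (h / 2 * norm z)))"
  proof -
    have "norm (A ?m - A x) \<le> L * (h / 2 * norm z)" using A_lipschitz[of ?m x] h by simp
    then have "norm z * norm (A ?m - A x) \<le> norm z * (L * (h / 2 * norm z))" by (intro mult_left_mono) auto
    then show ?thesis using Cauchy_Schwarz_ineq2[of z "A ?m - A x"] h by (intro mult_left_mono) auto
  qed
  also have "\<dots> = (L / 2) * (h * norm z) * (h * norm z)" by (simp add: field_simps)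
  finally have phase: "norm (cis (?\<theta> ?m) - cis (?\<theta> x)) \<le> (L / 2) * (h * norm z) * (h * norm z)"
    using norm_cis_diff_le order_trans by blast
  have nU: "norm (u x + path_int z g h x) \<le> norm (u x) + b"
  proof -
    have "norm (u x + path_int z g h x) = norm ?w" by (simp add: norm_mult)
    also have "\<dots> \<le> norm (u x) + b" unfolding b_def using norm_triangle_sub[of ?w "u x"] by simp
    finally show ?thesis .
  qed
  have "gauged x z h - u x = (cis (?\<theta> ?m) - cis (?\<theta> x)) * (u x + path_int z g h x) + (?w - u x)"
    unfolding gauged_def by (simp add: algebra_simps)
  then have "norm (gauged x z h - u x) \<le> norm ((cis (?\<theta> ?m) - cis (?\<theta> x)) * (u x + path_int z g h x)) + b"
    unfolding b_def using norm_triangle_ineq by metis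
  also have "\<dots> \<le> (L / 2) * (h * norm z) * (h * norm z) * (norm (u x) + b) + b"
    unfolding norm_mult using L_nonneg h by (intro add_right_mono mult_mono phase nU) auto
  also have "\<dots> \<le> h / 2 + (L / 2) * b + b"
  proof -
    define t where "t = h * norm z"
    have t: "0 \<le> t" "t \<le> 1" using h by (auto simp: t_def)
    have "L / 2 * t * t * norm (u x) \<le> L / 2 * t * 1 * norm (u x)"
      using t L_nonneg by (intro mult_right_mono mult_left_mono) auto
    also have "\<dots> = h / 2 * ((L * norm (u x)) * norm z)" by (simp add: t_def field_simps)
    also have "\<dots> \<le> h / 2 * 1" using h by (intro mult_left_mono ux) auto
    finally have 1: "L / 2 * t * t * norm (u x) \<le> h / 2" by simp
    have "t * t \<le> 1 * 1" using t by (intro mult_mono) auto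
    then have "L / 2 * (t * t) * b \<le> L / 2 * 1 * b"
      using L_nonneg by (intro mult_right_mono mult_left_mono) (auto simp: b_def)
    with 1 show ?thesis unfolding t_def[symmetric] by (simp add: algebra_simps)
  qed
  also have "\<dots> \<le> h" using b by (simp add: algebra_simps)
  finally show False using big by simp
qed

text \<open>The phase is differentiable at \<open>h = 0\<close> because \<open>A\<close> is continuous at \<open>x\<close>, and the primitive is because
  \<open>x\<close> is a Lebesgue point along \<open>z\<close>.\<close>

lemma gauged_difference_quotient:
  assumes reg: "regular_pair x z"
  shows "((\<lambda>h. (gauged x z h - u x) /\<^sub>R h) \<longlongrightarrow> along z (D x)) (at_right 0)"
proof -
  let ?\<alpha> = "\<lambda>h. z \<bullet> A (x + (h / 2) *\<^sub>R z)"
  let ?c = "\<lambda>h. cis (- (h * ?\<alpha> h))"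
  have path: "((\<lambda>h. path_int z g h x /\<^sub>R h) \<longlongrightarrow> along z (g x)) (at_right 0)"
    using reg unfolding regular_pair_def by (intro right_lebesgue_point_tendsto) auto
  have "isCont (\<lambda>h. A (x + (h / 2) *\<^sub>R z)) 0"
  proof -
    have "isCont A (x + (0 / 2) *\<^sub>R z)" using A_continuous[of UNIV] by (simp add: continuous_on_eq_continuous_at)
    then show ?thesis by (intro continuous_within_compose3[where f="\<lambda>h. x + (h / 2) *\<^sub>R z" and g=A]) (auto intro!: continuous_intros)
  qed
  then have \<alpha>: "(?\<alpha> \<longlongrightarrow> z \<bullet> A x) (at_right 0)"
    by (auto simp: isCont_def intro!: tendsto_intros dest: tendsto_within_subset[where S=UNIV and T="{0<..}"])
  have cis1: "(?c \<longlongrightarrow> cis (- (0 * (z \<bullet> A x)))) (at_right 0)"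
    unfolding cis_conv_exp by (intro tendsto_intros \<alpha>)
  have lin: "((\<lambda>h. (cis (- (h * (z \<bullet> A x))) - 1) /\<^sub>R h) \<longlongrightarrow> - (\<i> * complex_of_real (z \<bullet> A x))) (at_right 0)"
  proof -
    have "((\<lambda>s. cis (- (s * (z \<bullet> A x)))) has_vector_derivative - (\<i> * complex_of_real (z \<bullet> A x)) * cis (- (0 * (z \<bullet> A x)))) (at 0 within {0<..})"
      unfolding cis_conv_exp
      by (auto intro!: derivative_eq_intros has_vector_derivative_real_field simp: algebra_simps)
    then have "((\<lambda>h. (1 / norm h) *\<^sub>R (cis (- (h * (z \<bullet> A x))) - (1 + h *\<^sub>R (- (\<i> * complex_of_real (z \<bullet> A x)))))) \<longlongrightarrow> 0) (at_right 0)"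
      unfolding has_vector_derivative_def has_derivative_within by simp
    then have "((\<lambda>h. (cis (- (h * (z \<bullet> A x))) - 1) /\<^sub>R h - - (\<i> * complex_of_real (z \<bullet> A x))) \<longlongrightarrow> 0) (at_right 0)"
    proof (rule Lim_transform_eventually)
      show "\<forall>\<^sub>F h in at_right 0. (1 / norm h) *\<^sub>R (cis (- (h * (z \<bullet> A x))) - (1 + h *\<^sub>R (- (\<i> * complex_of_real (z \<bullet> A x)))))
         = (cis (- (h * (z \<bullet> A x))) - 1) /\<^sub>R h - - (\<i> * complex_of_real (z \<bullet> A x))"
        using eventually_at_right_less[of "0::real"]
        by eventually_elim (simp add: scaleR_diff_right scaleR_add_right divide_inverse)
    qed
    then show ?thesis by (rule LIM_zero_cancel)
  qed
  have "((\<lambda>h. (?c h - cis (- (h * (z \<bullet> A x)))) /\<^sub>R h) \<longlongrightarrow> 0) (at_right 0)"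
  proof (rule Lim_null_comparison)
    show "\<forall>\<^sub>F h in at_right 0. norm ((?c h - cis (- (h * (z \<bullet> A x)))) /\<^sub>R h) \<le> \<bar>?\<alpha> h - z \<bullet> A x\<bar>"
      using eventually_at_right_less[of "0::real"]
    proof eventually_elim
      case (elim h)
      have "- (h * ?\<alpha> h) - - (h * (z \<bullet> A x)) = - h * (?\<alpha> h - z \<bullet> A x)" by (simp add: algebra_simps)
      then have "\<bar>- (h * ?\<alpha> h) - - (h * (z \<bullet> A x))\<bar> = h * \<bar>?\<alpha> h - z \<bullet> A x\<bar>"
        using elim by (simp only: abs_mult abs_minus_cancel abs_of_pos)
      then have m: "norm (?c h - cis (- (h * (z \<bullet> A x)))) \<le> h * \<bar>?\<alpha> h - z \<bullet> A x\<bar>"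
        using norm_cis_diff_le[of "- (h * ?\<alpha> h)" "- (h * (z \<bullet> A x))"] by (simp only:)
      have "norm ((?c h - cis (- (h * (z \<bullet> A x)))) /\<^sub>R h) = inverse h * norm (?c h - cis (- (h * (z \<bullet> A x))))"
        unfolding norm_scaleR using elim by (simp only: abs_of_pos positive_imp_inverse_positive)
      also have "\<dots> \<le> inverse h * (h * \<bar>?\<alpha> h - z \<bullet> A x\<bar>)"
        using elim by (intro mult_left_mono m) simp
      also have "\<dots> = \<bar>?\<alpha> h - z \<bullet> A x\<bar>" using elim by simp
      finally show ?case .
    qed
    show "((\<lambda>h. \<bar>?\<alpha> h - z \<bullet> A x\<bar>) \<longlongrightarrow> 0) (at_right 0)"
      using tendsto_rabs[OF tendsto_diff[OF \<alpha> tendsto_const[of "z \<bullet> A x"]]] by simp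
  qed
  from tendsto_add[OF this lin]
  have phase: "((\<lambda>h. (?c h - 1) /\<^sub>R h) \<longlongrightarrow> - (\<i> * complex_of_real (z \<bullet> A x))) (at_right 0)"
    by (simp add: scaleR_diff_right)
  have "((\<lambda>h. ?c h * (path_int z g h x /\<^sub>R h) + ((?c h - 1) /\<^sub>R h) * u x) \<longlongrightarrow>
     cis (- (0 * (z \<bullet> A x))) * along z (g x) + - (\<i> * complex_of_real (z \<bullet> A x)) * u x) (at_right 0)"
    by (intro tendsto_intros cis1 path phase)
  then show ?thesis
    unfolding gauged_def along_magnetic_grad by (simp add: algebra_simps scaleR_add_right scaleR_diff_right)
qed

section \<open>Convergence of the functional\<close>

lemma Psi_borel[measurable (raw)]:
  assumes [measurable]: "x \<in> borel_measurable M" "y \<in> borel_measurable M"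
  shows "(\<lambda>w. Psi A u (x w) (y w)) \<in> borel_measurable M"
proof -
  have [measurable]: "exp \<in> borel_measurable (borel :: complex measure)"
    by (intro borel_measurable_continuous_onI continuous_intros)
  show ?thesis unfolding Psi_def by measurable
qed

lemma norm_Psi: "norm (Psi A u x y) = norm (u y)"
  by (simp add: Psi_def norm_mult)

lemma Psi_diag: "Psi A u x x = u x"
  by (simp add: Psi_def)

text \<open>The substitution \<open>y = x + \<delta> z\<close> removes \<open>\<delta>\<close> from the weight.\<close>

lemma J_rescaled:
  assumes d: "0 < \<delta>"
  shows "J A \<delta> u x = (NNINT z. indicator {z. \<delta> < norm (Psi A u x (x + \<delta> *\<^sub>R z) - u x)} z * weight z)"
proof -
  let ?f = "\<lambda>y. ennreal (\<delta>\<^sup>2 / norm (x - y) ^ (CARD('n) + 2)) * indicator {y. \<delta> < norm (Psi A u x y - u x)} y"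
  have [measurable]: "?f \<in> borel_measurable borel" by measurable
  have "J A \<delta> u x = (NNINT y. ?f y)"
    unfolding J_def Psi_diag by (simp add: nn_integral_completion)
  also have "\<dots> = ennreal (\<bar>\<delta>\<bar> ^ DIM(real^'n)) * (NNINT z. ?f (x + \<delta> *\<^sub>R z))"
    using d by (intro nn_integral_lborel_affine) auto
  also have "\<dots> = (NNINT z. ennreal (\<bar>\<delta>\<bar> ^ DIM(real^'n)) * ?f (x + \<delta> *\<^sub>R z))"
    by (rule nn_integral_cmult[symmetric]) measurable
  also have "\<dots> = (NNINT z. indicator {z. \<delta> < norm (Psi A u x (x + \<delta> *\<^sub>R z) - u x)} z * weight z)"
  proof (intro nn_integral_cong)
    fix z
    have "ennreal (\<bar>\<delta>\<bar> ^ DIM(real^'n)) * ennreal (\<delta>\<^sup>2 / norm (x - (x + \<delta> *\<^sub>R z)) ^ (CARD('n) + 2)) = weight z"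
      unfolding weight_def using d
      by (simp add: ennreal_mult[symmetric] power_mult_distrib power_add power2_eq_square)
    then show "ennreal (\<bar>\<delta>\<bar> ^ DIM(real^'n)) * ?f (x + \<delta> *\<^sub>R z) = indicator {z. \<delta> < norm (Psi A u x (x + \<delta> *\<^sub>R z) - u x)} z * weight z"
      by (auto split: split_indicator)
  qed
  finally show ?thesis .
qed

lemma J_borel[measurable]: "0 < \<delta> \<Longrightarrow> (\<lambda>x. J A \<delta> u x) \<in> borel_measurable borel"
proof -
  assume d: "0 < \<delta>"
  have "(\<lambda>(x, z). (if \<delta> < norm (Psi A u x (x + \<delta> *\<^sub>R z) - u x) then 1 else 0) * weight z) \<in> borel_measurable (borel \<Otimes>\<^sub>M lborel)"
    by measurable
  then have "(\<lambda>x. NNINT z. (if \<delta> < norm (Psi A u x (x + \<delta> *\<^sub>R z) - u x) then 1 else 0) * weight z) \<in> borel_measurable borel"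
    by (rule lborel.borel_measurable_nn_integral)
  moreover have "J A \<delta> u x = (NNINT z. (if \<delta> < norm (Psi A u x (x + \<delta> *\<^sub>R z) - u x) then 1 else 0) * weight z)" for x
    unfolding J_rescaled[OF d] by (intro nn_integral_cong) (auto split: split_indicator)
  ultimately show ?thesis by simp
qed

definition regular_point :: "real^'n \<Rightarrow> bool" where
  "regular_point x \<longleftrightarrow> (AE z in lborel. regular_pair x z) \<and> (AE z in lborel. u (x + z) = u x + path_int z g 1 x)"

lemma AE_regular_point: "AE x in lborel. regular_point x"
proof -
  have "AE x in lborel. AE z in lborel. u (x + z) = u x + path_int z g 1 x"
    by (rule AE_all_swap[OF _ weak_gradient_line_increment[OF u_borel g_borel wg]]) measurable
  with AE_regular_pair show ?thesis unfolding regular_point_def by eventually_elim simp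
qed

text \<open>The identity holds for almost every end point, and dilations preserve null sets. So a point that is
  good at scale \<open>1\<close> is good at every scale, and the exceptional set of \<open>x\<close> does not depend on \<open>\<delta>\<close>.\<close>

lemma AE_Psi_eq_gauged:
  assumes "regular_point x" and d: "0 < \<delta>"
  shows "AE z in lborel. Psi A u x (x + \<delta> *\<^sub>R z) = gauged x z \<delta>"
proof -
  have "AE z in lborel. u (x + z) = u x + path_int z g 1 x"
    using assms(1) by (simp add: regular_point_def)
  from AE_lborel_affine[OF this, of \<delta> 0] d
  have "AE z in lborel. u (x + \<delta> *\<^sub>R z) = u x + path_int z g \<delta> x"
    by (simp add: path_int_scale)
  then show ?thesis
  proof eventually_elim
    case (elim z)
    have "(1 / 2) *\<^sub>R (x + (x + \<delta> *\<^sub>R z)) = x + (\<delta> / 2) *\<^sub>R z"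
      by (simp add: scaleR_add_right[symmetric] vec_eq_iff field_simps)
    moreover have "(x - (x + \<delta> *\<^sub>R z)) \<bullet> v = - (\<delta> * (z \<bullet> v))" for v by simp
    ultimately show ?case unfolding Psi_def gauged_def cis_conv_exp elim by simp
  qed
qed

text \<open>Cut at \<open>\<delta> * norm z = 1\<close>, that is at distance \<open>1\<close> from \<open>x\<close>: the Lipschitz bound on \<open>A\<close> is useful only
  for short segments.\<close>

definition near :: "real \<Rightarrow> real^'n \<Rightarrow> ennreal" where
  "near \<delta> x = (NNINT z. indicator {z. \<delta> < norm (gauged x z \<delta> - u x) \<and> \<delta> * norm z \<le> 1} z * weight z)"

definition far :: "real \<Rightarrow> real^'n \<Rightarrow> ennreal" where
  "far \<delta> x = (NNINT z. indicator {z. \<delta> < norm (Psi A u x (x + \<delta> *\<^sub>R z) - u x) \<and> 1 < \<delta> * norm z} z * weight z)"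

lemma J_eq_near_plus_far:
  assumes x: "regular_point x" and d: "0 < \<delta>"
  shows "J A \<delta> u x = near \<delta> x + far \<delta> x"
proof -
  have "J A \<delta> u x = (NNINT z. indicator {z. \<delta> < norm (gauged x z \<delta> - u x) \<and> \<delta> * norm z \<le> 1} z * weight z
     + indicator {z. \<delta> < norm (Psi A u x (x + \<delta> *\<^sub>R z) - u x) \<and> 1 < \<delta> * norm z} z * weight z)"
    unfolding J_rescaled[OF d]
    using AE_Psi_eq_gauged[OF x d]
    by (intro nn_integral_cong_AE) (auto elim!: eventually_mono split: split_indicator)
  also have "\<dots> = near \<delta> x + far \<delta> x"
    unfolding near_def far_def by (rule nn_integral_add) measurable
  finally show ?thesis .
qed

definition weight_mass :: real where
  "weight_mass = real CARD('n) / 2 * measure lborel (ball (0::real^'n) 1)"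

lemma weight_mass_nonneg: "0 \<le> weight_mass"
  by (simp add: weight_mass_def)

lemma weight_superlevel:
  assumes "0 \<le> c"
  shows "(NNINT z. indicator {z. 1 < c * norm z} z * weight z) = ennreal (c\<^sup>2 * weight_mass)"
  using nn_integral_norm_superlevel[OF assms, of 2, where 'a="real^'n"] by (simp add: weight_def weight_mass_def)

definition maximal_weight :: "real^'n \<Rightarrow> real^'n \<Rightarrow> ennreal" where
  "maximal_weight x z = indicator {z. 1 < ennreal (norm z) * line_max z (\<lambda>y. ennreal ((2 + L) * F y)) x} z * weight z"

lemma maximal_weight_borel[measurable (raw)]:
  assumes [measurable]: "x \<in> borel_measurable M" "z \<in> borel_measurable M"
  shows "(\<lambda>y. maximal_weight (x y) (z y)) \<in> borel_measurable M"
proof -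
  have "maximal_weight (x y) (z y) = (if 1 < ennreal (norm (z y)) * line_max (z y) (\<lambda>y. ennreal ((2 + L) * F y)) (x y) then weight (z y) else 0)" for y
    by (auto simp: maximal_weight_def split: split_indicator)
  then show ?thesis by simp
qed

definition near_majorant :: "real^'n \<Rightarrow> ennreal" where
  "near_majorant x = (NNINT z. maximal_weight x z) + ennreal ((L * norm (u x))\<^sup>2 * weight_mass)"

text \<open>Chebyshev's inequality: an increment larger than \<open>\<delta>\<close> forces
  \<open>\<delta>^2 < 2 * ((norm (u x))^2 + (norm (u y))^2)\<close>.\<close>

definition far_majorant :: "real^'n \<Rightarrow> ennreal" where
  "far_majorant x = 2 * (ennreal ((norm (u x))\<^sup>2 * weight_mass) + (NNINT z. indicator {z. 1 < norm z} z * weight z * ennreal ((norm (u (x + z)))\<^sup>2)))"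

lemma near_majorant_borel[measurable]: "near_majorant \<in> borel_measurable borel"
  unfolding near_majorant_def[abs_def] by measurable

lemma far_majorant_borel[measurable]: "far_majorant \<in> borel_measurable borel"
  unfolding far_majorant_def[abs_def] by measurable

lemma near_integrand_le:
  assumes "regular_pair x z" "0 < \<delta>"
  shows "indicator {z. \<delta> < norm (gauged x z \<delta> - u x) \<and> \<delta> * norm z \<le> 1} z * weight z
    \<le> maximal_weight x z + indicator {z. 1 < (L * norm (u x)) * norm z} z * weight z"
  using gauged_increment_bound[OF assms(2) _ assms(1)] by (auto simp: maximal_weight_def split: split_indicator)

lemma near_majorant_eq:
  "near_majorant x = (NNINT z. maximal_weight x z + indicator {z. 1 < (L * norm (u x)) * norm z} z * weight z)"
proof -
  have "near_majorant x = (NNINT z. maximal_weight x z) + (NNINT z. indicator {z. 1 < (L * norm (u x)) * norm z} z * weight z)"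
    unfolding near_majorant_def using L_nonneg by (subst weight_superlevel) auto
  also have "\<dots> = (NNINT z. maximal_weight x z + indicator {z. 1 < (L * norm (u x)) * norm z} z * weight z)"
    by (rule nn_integral_add[symmetric]) measurable
  finally show ?thesis .
qed

lemma near_le:
  assumes "regular_point x" "0 < \<delta>" shows "near \<delta> x \<le> near_majorant x"
  unfolding near_def near_majorant_eq
proof (rule nn_integral_mono_AE)
  have "AE z in lborel. regular_pair x z" using assms(1) by (simp add: regular_point_def)
  then show "AE z in lborel. indicator {z. \<delta> < norm (gauged x z \<delta> - u x) \<and> \<delta> * norm z \<le> 1} z * weight z
    \<le> maximal_weight x z + indicator {z. 1 < (L * norm (u x)) * norm z} z * weight z"
    by eventually_elim (rule near_integrand_le[OF _ assms(2)])
qed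

text \<open>For each \<open>x\<close> the far part disappears in the limit, because the weight is integrable at infinity.\<close>

lemma far_le_small:
  assumes d: "0 < \<delta>" shows "far \<delta> x \<le> ennreal (\<delta>\<^sup>2 * weight_mass)"
proof -
  have "far \<delta> x \<le> (NNINT z. indicator {z. 1 < \<delta> * norm z} z * weight z)"
    unfolding far_def by (intro nn_integral_mono) (auto split: split_indicator)
  also have "\<dots> = ennreal (\<delta>\<^sup>2 * weight_mass)" using d by (intro weight_superlevel) simp
  finally show ?thesis .
qed

text \<open>After Chebyshev's inequality, the two terms scale back to distance \<open>1\<close> with exactly the factor
  \<open>\<delta>^2\<close> that cancels.\<close>

lemma far_le:
  assumes d: "0 < \<delta>" shows "far \<delta> x \<le> far_majorant x"
proof -
  let ?c = "2 / \<delta>\<^sup>2" and ?E = "{z::real^'n. 1 < \<delta> * norm z}"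
  have "far \<delta> x \<le> (NNINT z. ennreal (?c * (norm (u x))\<^sup>2) * (indicator ?E z * weight z)
     + ennreal ?c * (indicator ?E z * weight z * ennreal ((norm (u (x + \<delta> *\<^sub>R z)))\<^sup>2)))"
    unfolding far_def
  proof (intro nn_integral_mono)
    fix z
    let ?a = "norm (u x)" and ?b = "norm (u (x + \<delta> *\<^sub>R z))"
    show "indicator {z. \<delta> < norm (Psi A u x (x + \<delta> *\<^sub>R z) - u x) \<and> 1 < \<delta> * norm z} z * weight z
      \<le> ennreal (?c * ?a\<^sup>2) * (indicator ?E z * weight z) + ennreal ?c * (indicator ?E z * weight z * ennreal (?b\<^sup>2))"
    proof (cases "\<delta> < norm (Psi A u x (x + \<delta> *\<^sub>R z) - u x) \<and> 1 < \<delta> * norm z")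
      case True
      have "\<delta> < ?b + ?a" using True norm_triangle_ineq4[of "Psi A u x (x + \<delta> *\<^sub>R z)" "u x"] by (simp add: norm_Psi)
      then have "\<delta>\<^sup>2 \<le> (?b + ?a)\<^sup>2" using d by (intro power_mono) auto
      also have "\<dots> \<le> 2 * (?a\<^sup>2 + ?b\<^sup>2)"
        using sum_squares_bound[of ?b ?a] by (simp add: power2_sum)
      finally have "1 \<le> ?c * ?a\<^sup>2 + ?c * ?b\<^sup>2" using d by (simp add: field_simps)
      then have "1 \<le> ennreal (?c * ?a\<^sup>2) + ennreal ?c * ennreal (?b\<^sup>2)"
        by (simp add: ennreal_mult[symmetric] ennreal_plus[symmetric] del: ennreal_plus)
      then have "1 * weight z \<le> (ennreal (?c * ?a\<^sup>2) + ennreal ?c * ennreal (?b\<^sup>2)) * weight z"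
        by (intro mult_right_mono) auto
      then show ?thesis using True by (simp add: distrib_right distrib_left ac_simps)
    qed simp
  qed
  also have "\<dots> = ennreal (?c * (norm (u x))\<^sup>2) * (NNINT z. indicator ?E z * weight z)
     + ennreal ?c * (NNINT z. indicator ?E z * weight z * ennreal ((norm (u (x + \<delta> *\<^sub>R z)))\<^sup>2))"
    by (simp add: nn_integral_add nn_integral_cmult)
  also have "(NNINT z. indicator ?E z * weight z) = ennreal (\<delta>\<^sup>2 * weight_mass)"
    using d by (intro weight_superlevel) simp
  also have "(NNINT z. indicator ?E z * weight z * ennreal ((norm (u (x + \<delta> *\<^sub>R z)))\<^sup>2))
    = ennreal (\<delta>\<^sup>2) * (NNINT z. indicator {z. 1 < norm z} z * weight z * ennreal ((norm (u (x + z)))\<^sup>2))"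
  proof -
    let ?f = "\<lambda>z. indicator {z. 1 < norm z} z * weight z * ennreal ((norm (u (x + z)))\<^sup>2)"
    have "ennreal (\<delta>\<^sup>2) * (NNINT z. ?f z) = ennreal (\<delta>\<^sup>2) * (ennreal (\<bar>\<delta>\<bar> ^ DIM(real^'n)) * (NNINT z. ?f (0 + \<delta> *\<^sub>R z)))"
      using d by (subst nn_integral_lborel_affine[of ?f \<delta> 0]) auto
    also have "\<dots> = (NNINT z. ennreal (\<delta>\<^sup>2) * (ennreal (\<bar>\<delta>\<bar> ^ DIM(real^'n)) * ?f (0 + \<delta> *\<^sub>R z)))"
      by (simp add: nn_integral_cmult)
    also have "\<dots> = (NNINT z. indicator ?E z * weight z * ennreal ((norm (u (x + \<delta> *\<^sub>R z)))\<^sup>2))"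
    proof (intro nn_integral_cong)
      fix z
      have w: "ennreal (\<delta>\<^sup>2) * (ennreal (\<bar>\<delta>\<bar> ^ DIM(real^'n)) * weight (\<delta> *\<^sub>R z)) = weight z"
        unfolding weight_def using d
        by (simp add: ennreal_mult[symmetric] power_mult_distrib power_add power2_eq_square)
      have i: "indicator {z. 1 < norm z} (\<delta> *\<^sub>R z) = (indicator ?E z :: ennreal)"
        using d by (auto split: split_indicator)
      have "ennreal (\<delta>\<^sup>2) * (ennreal (\<bar>\<delta>\<bar> ^ DIM(real^'n)) * ?f (0 + \<delta> *\<^sub>R z)) =
         indicator {z. 1 < norm z} (\<delta> *\<^sub>R z) * (ennreal (\<delta>\<^sup>2) * (ennreal (\<bar>\<delta>\<bar> ^ DIM(real^'n)) * weight (\<delta> *\<^sub>R z))) * ennreal ((norm (u (x + \<delta> *\<^sub>R z)))\<^sup>2)"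
        by (simp only: add_0_left mult_ac)
      then show "ennreal (\<delta>\<^sup>2) * (ennreal (\<bar>\<delta>\<bar> ^ DIM(real^'n)) * ?f (0 + \<delta> *\<^sub>R z)) = indicator ?E z * weight z * ennreal ((norm (u (x + \<delta> *\<^sub>R z)))\<^sup>2)"
        unfolding w i .
    qed
    finally show ?thesis ..
  qed
  also have "ennreal (?c * (norm (u x))\<^sup>2) * ennreal (\<delta>\<^sup>2 * weight_mass) + ennreal ?c * (ennreal (\<delta>\<^sup>2) * (NNINT z. indicator {z. 1 < norm z} z * weight z * ennreal ((norm (u (x + z)))\<^sup>2)))
    = far_majorant x"
  proof -
    have 1: "ennreal (?c * (norm (u x))\<^sup>2) * ennreal (\<delta>\<^sup>2 * weight_mass) = 2 * ennreal ((norm (u x))\<^sup>2 * weight_mass)"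
    proof -
      have "?c * (norm (u x))\<^sup>2 * (\<delta>\<^sup>2 * weight_mass) = 2 * ((norm (u x))\<^sup>2 * weight_mass)" using d by simp
      then have "ennreal (?c * (norm (u x))\<^sup>2) * ennreal (\<delta>\<^sup>2 * weight_mass) = ennreal (2 * ((norm (u x))\<^sup>2 * weight_mass))"
        using weight_mass_nonneg by (simp add: ennreal_mult[symmetric])
      also have "\<dots> = 2 * ennreal ((norm (u x))\<^sup>2 * weight_mass)" using weight_mass_nonneg by (simp add: ennreal_mult)
      finally show ?thesis .
    qed
    have "?c * \<delta>\<^sup>2 = 2" using d by simp
    then have 2: "ennreal ?c * ennreal (\<delta>\<^sup>2) = 2" using d by (simp add: ennreal_mult[symmetric])
    show ?thesis unfolding 1 mult.assoc[symmetric] 2 far_majorant_def by (simp add: distrib_left mult.assoc)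
  qed
  finally show ?thesis .
qed

lemma near_majorant_finite: "(NNINT x. near_majorant x) < \<infinity>"
proof -
  let ?C = "(2 + L)\<^sup>2 * 2" and ?D = "(2 + L)\<^sup>2 * 2 * L\<^sup>2"
  have "(NNINT x. ennreal (((2 + L) * F x)\<^sup>2))
     \<le> (NNINT x. ennreal ?C * ennreal ((norm (D x))\<^sup>2) + ennreal ?D * ennreal ((norm (u x))\<^sup>2))"
  proof (intro nn_integral_mono)
    fix x
    have "(F x)\<^sup>2 \<le> 2 * (norm (D x))\<^sup>2 + 2 * (L * norm (u x))\<^sup>2"
      using sum_squares_bound[of "norm (D x)" "L * norm (u x)"] by (simp add: F_def power2_sum)
    then have "(2 + L)\<^sup>2 * (F x)\<^sup>2 \<le> (2 + L)\<^sup>2 * (2 * (norm (D x))\<^sup>2 + 2 * (L * norm (u x))\<^sup>2)"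
      by (intro mult_left_mono) auto
    also have "\<dots> = ?C * (norm (D x))\<^sup>2 + ?D * (norm (u x))\<^sup>2" by (simp add: power_mult_distrib algebra_simps)
    finally show "ennreal (((2 + L) * F x)\<^sup>2) \<le> ennreal ?C * ennreal ((norm (D x))\<^sup>2) + ennreal ?D * ennreal ((norm (u x))\<^sup>2)"
      by (simp add: ennreal_mult[symmetric] ennreal_plus[symmetric] ennreal_leI power_mult_distrib del: ennreal_plus)
  qed
  also have "\<dots> = ennreal ?C * (NNINT x. ennreal ((norm (D x))\<^sup>2)) + ennreal ?D * (NNINT x. ennreal ((norm (u x))\<^sup>2))"
    by (simp add: nn_integral_add nn_integral_cmult)
  also have "\<dots> < \<infinity>" using u_L2 D_L2 by (simp add: ennreal_mult_less_top)
  finally have F2: "(NNINT x. ennreal (((2 + L) * F x)\<^sup>2)) < \<infinity>" .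
  have "(NNINT x z. maximal_weight x z) \<le> ennreal (4 * (real DIM(real^'n) * measure lborel (ball (0::real^'n) 1))) * (NNINT x. ennreal (((2 + L) * F x)\<^sup>2))"
    using line_max_strong_type[of "\<lambda>x. (2 + L) * F x"] L_nonneg F_nonneg by (simp add: maximal_weight_def weight_def)
  also have "\<dots> < \<infinity>" using F2 by (simp add: ennreal_mult_less_top)
  finally have G: "(NNINT x z. maximal_weight x z) < \<infinity>" .
  have "(NNINT x. ennreal ((L * norm (u x))\<^sup>2 * weight_mass)) = (NNINT x. ennreal (L\<^sup>2 * weight_mass) * ennreal ((norm (u x))\<^sup>2))"
    using weight_mass_nonneg by (intro nn_integral_cong) (simp add: ennreal_mult[symmetric] power_mult_distrib ac_simps)
  also have "\<dots> = ennreal (L\<^sup>2 * weight_mass) * (NNINT x. ennreal ((norm (u x))\<^sup>2))"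
    by (rule nn_integral_cmult) measurable
  also have "\<dots> < \<infinity>" using u_L2 by (simp add: ennreal_mult_less_top)
  finally have "(NNINT x. ennreal ((L * norm (u x))\<^sup>2 * weight_mass)) < \<infinity>" .
  with G show ?thesis unfolding near_majorant_def by (subst nn_integral_add) auto
qed

lemma far_majorant_finite: "(NNINT x. far_majorant x) < \<infinity>"
proof -
  let ?U = "NNINT x. ennreal ((norm (u x))\<^sup>2)"
  have 1: "(NNINT x. ennreal ((norm (u x))\<^sup>2 * weight_mass)) = ennreal weight_mass * ?U"
    using weight_mass_nonneg by (subst nn_integral_cmult[symmetric]) (auto simp: ennreal_mult mult.commute)
  have "(NNINT x z. indicator {z. 1 < norm z} z * weight z * ennreal ((norm (u (x + z)))\<^sup>2))
    = (NNINT z x. indicator {z. 1 < norm z} z * weight z * ennreal ((norm (u (x + z)))\<^sup>2))"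
    by (rule lborel_pair.Fubini') measurable
  also have "\<dots> = (NNINT z. indicator {z. 1 < 1 * norm z} z * weight z * ?U)"
    by (simp add: nn_integral_cmult nn_integral_lborel_shift[of "\<lambda>x. ennreal ((norm (u x))\<^sup>2)"])
  also have "\<dots> = (NNINT z. indicator {z. 1 < 1 * norm z} z * weight z) * ?U"
    by (rule nn_integral_multc) measurable
  also have "\<dots> = ennreal weight_mass * ?U" by (subst weight_superlevel) auto
  finally have 2: "(NNINT x z. indicator {z. 1 < norm z} z * weight z * ennreal ((norm (u (x + z)))\<^sup>2)) = ennreal weight_mass * ?U" .
  have "(NNINT x. far_majorant x) = 2 * (ennreal weight_mass * ?U + ennreal weight_mass * ?U)"
    unfolding far_majorant_def by (simp add: nn_integral_cmult nn_integral_add 1 2)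
  also have "\<dots> < \<infinity>" using u_L2 by (simp add: ennreal_mult_less_top)
  finally show ?thesis .
qed

text \<open>Dominated convergence in \<open>z\<close>: the difference quotients converge for almost every \<open>z\<close>, and the limiting
  level set is null.\<close>

lemma J_tendsto:
  fixes \<omega> :: "real^'n"
  assumes x: "regular_point x" and fin: "near_majorant x < \<infinity>" and \<omega>: "norm \<omega> = 1"
  shows "((\<lambda>\<delta>. J A \<delta> u x) \<longlongrightarrow> ennreal (Q \<omega> * (norm (D x))\<^sup>2)) (at_right 0)"
proof (rule tendsto_at_right_0I_sequentially)
  fix X :: "nat \<Rightarrow> real" assume pos: "\<And>i. 0 < X i" and X: "X \<longlonglongrightarrow> 0"
  have X0: "filterlim X (at_right 0) sequentially"
    using X pos by (simp add: filterlim_at less_imp_neq[OF pos, THEN not_sym])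
  let ?m = "\<lambda>z. maximal_weight x z + indicator {z. 1 < (L * norm (u x)) * norm z} z * weight z"
  have "(\<lambda>i. near (X i) x) \<longlonglongrightarrow> (NNINT z. indicator {z. 1 < norm (along z (D x))} z * weight z)"
    unfolding near_def
  proof (rule nn_integral_dominated_convergence[where w="?m"])
    show "(NNINT z. ?m z) < \<infinity>" using fin by (simp add: near_majorant_eq)
    have rp: "AE z in lborel. regular_pair x z" using x by (simp add: regular_point_def)
    then show "AE z in lborel. indicator {z. X i < norm (gauged x z (X i) - u x) \<and> X i * norm z \<le> 1} z * weight z \<le> ?m z" for i
      by eventually_elim (rule near_integrand_le[OF _ pos])
    have "AE z in lborel. norm (along z (D x)) \<noteq> 1"
      by (rule AE_homogeneous_neq_1) (auto simp: along_scale)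
    with rp show "AE z in lborel. (\<lambda>i. indicator {z. X i < norm (gauged x z (X i) - u x) \<and> X i * norm z \<le> 1} z * weight z)
       \<longlonglongrightarrow> indicator {z. 1 < norm (along z (D x))} z * weight z"
    proof eventually_elim
      case (elim z)
      have lim: "(\<lambda>i. norm ((gauged x z (X i) - u x) /\<^sub>R X i)) \<longlonglongrightarrow> norm (along z (D x))"
        by (intro tendsto_norm filterlim_compose[OF gauged_difference_quotient[OF elim(1)] X0])
      have quot: "1 < norm ((gauged x z (X i) - u x) /\<^sub>R X i) \<longleftrightarrow> X i < norm (gauged x z (X i) - u x)" for i
        unfolding norm_scaleR using pos[of i] by (simp add: field_simps)
      have "(\<lambda>i. X i * norm z) \<longlonglongrightarrow> 0 * norm z" by (intro tendsto_intros X)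
      then have small: "\<forall>\<^sub>F i in sequentially. X i * norm z < 1" by (intro order_tendstoD(2)) auto
      show ?case
      proof (rule tendsto_eventually)
        show "\<forall>\<^sub>F i in sequentially. indicator {z. X i < norm (gauged x z (X i) - u x) \<and> X i * norm z \<le> 1} z * weight z
           = indicator {z. 1 < norm (along z (D x))} z * weight z"
        proof (cases "1 < norm (along z (D x))")
          case True
          from order_tendstoD(1)[OF lim True] small show ?thesis
            by eventually_elim (use True quot in \<open>auto split: split_indicator\<close>)
        next
          case False
          then have "norm (along z (D x)) < 1" using elim(2) by simp
          from order_tendstoD(2)[OF lim this] show ?thesis
          proof eventually_elim
            case (elim i)
            then have "\<not> X i < norm (gauged x z (X i) - u x)" using quot[of i] by linarith
            then show ?case using False by simp
          qed
        qed
      qed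
    qed
  qed measurable
  also have "(NNINT z. indicator {z. 1 < norm (along z (D x))} z * weight z) = ennreal (Q \<omega> * (norm (D x))\<^sup>2)"
    unfolding weight_def by (rule nn_integral_along_superlevel[OF \<omega>])
  finally have near: "(\<lambda>i. near (X i) x) \<longlonglongrightarrow> ennreal (Q \<omega> * (norm (D x))\<^sup>2)" .
  have far: "(\<lambda>i. far (X i) x) \<longlonglongrightarrow> 0"
  proof (rule tendsto_sandwich[OF _ _ tendsto_const])
    have "(\<lambda>i. ennreal ((X i)\<^sup>2 * weight_mass)) \<longlonglongrightarrow> ennreal (0\<^sup>2 * weight_mass)" by (intro tendsto_intros X tendsto_ennrealI)
    then show "(\<lambda>i. ennreal ((X i)\<^sup>2 * weight_mass)) \<longlonglongrightarrow> 0" by simp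
    show "\<forall>\<^sub>F i in sequentially. far (X i) x \<le> ennreal ((X i)\<^sup>2 * weight_mass)" using far_le_small[OF pos] by simp
  qed simp
  have "(\<lambda>i. near (X i) x + far (X i) x) \<longlonglongrightarrow> ennreal (Q \<omega> * (norm (D x))\<^sup>2) + 0"
    by (intro tendsto_add near far)
  then show "(\<lambda>i. J A (X i) u x) \<longlonglongrightarrow> ennreal (Q \<omega> * (norm (D x))\<^sup>2)"
    by (simp add: J_eq_near_plus_far[OF x pos])
qed

lemma J_le_majorant:
  assumes "regular_point x" "0 < \<delta>"
  shows "J A \<delta> u x \<le> near_majorant x + far_majorant x"
  unfolding J_eq_near_plus_far[OF assms] by (intro add_mono near_le far_le assms)

lemma majorant_finite: "(NNINT x. near_majorant x + far_majorant x) < \<infinity>"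
  using near_majorant_finite far_majorant_finite by (subst nn_integral_add) auto

lemma AE_majorant_finite: "AE x in lborel. near_majorant x + far_majorant x < \<infinity>"
proof -
  have "AE x in lborel. near_majorant x + far_majorant x \<noteq> \<infinity>"
    using majorant_finite by (intro nn_integral_noteq_infinite) auto
  then show ?thesis by eventually_elim (simp add: less_top)
qed

lemma AE_J_tendsto:
  fixes \<omega> :: "real^'n"
  assumes "norm \<omega> = 1"
  shows "AE x in lborel. ((\<lambda>\<delta>. J A \<delta> u x) \<longlongrightarrow> ennreal (Q \<omega> * (norm (D x))\<^sup>2)) (at_right 0)"
  using AE_regular_point AE_majorant_finite
proof eventually_elim
  case (elim x)
  then have "near_majorant x < \<infinity>" by (auto simp: less_top)
  with elim assms show ?case by (intro J_tendsto) auto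
qed

lemma J_integral_finite:
  assumes "0 < \<delta>" shows "(NNINT x. J A \<delta> u x) < \<infinity>"
proof -
  have "(NNINT x. J A \<delta> u x) \<le> (NNINT x. near_majorant x + far_majorant x)"
    using AE_regular_point by (intro nn_integral_mono_AE) (auto elim!: eventually_mono intro!: J_le_majorant assms)
  also have "\<dots> < \<infinity>" by (rule majorant_finite)
  finally show ?thesis .
qed

text \<open>Dominated convergence in \<open>x\<close>.\<close>

lemma J_tendsto_L1:
  fixes \<omega> :: "real^'n"
  assumes \<omega>: "norm \<omega> = 1"
  shows "((\<lambda>\<delta>. NNINT x. ennreal \<bar>enn2real (J A \<delta> u x) - Q \<omega> * (norm (D x))\<^sup>2\<bar>) \<longlongrightarrow> 0) (at_right 0)"
proof (rule tendsto_at_right_0I_sequentially)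
  fix X :: "nat \<Rightarrow> real" assume pos: "\<And>i. 0 < X i" and X: "X \<longlonglongrightarrow> 0"
  have X0: "filterlim X (at_right 0) sequentially"
    using X pos by (simp add: filterlim_at less_imp_neq[OF pos, THEN not_sym])
  let ?q = "\<lambda>x. Q \<omega> * (norm (D x))\<^sup>2"
  let ?w = "\<lambda>x. (near_majorant x + far_majorant x) + ennreal (?q x)"
  have [measurable]: "(\<lambda>x. J A (X i) u x) \<in> borel_measurable borel" for i by (rule J_borel[OF pos])
  have "(\<lambda>i. NNINT x. ennreal \<bar>enn2real (J A (X i) u x) - ?q x\<bar>) \<longlonglongrightarrow> (\<integral>\<^sup>+x. 0 \<partial>(lborel :: (real^'n) measure))"
  proof (rule nn_integral_dominated_convergence[where w="?w"])
    have "(NNINT x. ennreal (?q x)) = ennreal (Q \<omega>) * (NNINT x. ennreal ((norm (D x))\<^sup>2))"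
      by (subst nn_integral_cmult[symmetric]) (auto simp: ennreal_mult Q_nonneg)
    also have "\<dots> < \<infinity>" using D_L2 by (simp add: ennreal_mult_less_top)
    finally show "(NNINT x. ?w x) < \<infinity>" using majorant_finite by (subst nn_integral_add) auto
    show "AE x in lborel. ennreal \<bar>enn2real (J A (X i) u x) - ?q x\<bar> \<le> ?w x" for i
      using AE_regular_point AE_majorant_finite
    proof eventually_elim
      case (elim x)
      have le: "J A (X i) u x \<le> near_majorant x + far_majorant x" by (rule J_le_majorant[OF elim(1) pos])
      have "\<bar>enn2real (J A (X i) u x) - ?q x\<bar> \<le> enn2real (J A (X i) u x) + ?q x"
        using enn2real_nonneg[of "J A (X i) u x"] Q_nonneg[of \<omega>] by (intro order_trans[OF abs_triangle_ineq4]) simp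
      then have "ennreal \<bar>enn2real (J A (X i) u x) - ?q x\<bar> \<le> ennreal (enn2real (J A (X i) u x)) + ennreal (?q x)"
        by (simp add: ennreal_plus[symmetric] ennreal_leI Q_nonneg del: ennreal_plus)
      also have "ennreal (enn2real (J A (X i) u x)) = J A (X i) u x"
        using le elim(2) by (intro ennreal_enn2real) (auto simp: less_top intro: le_less_trans)
      finally show ?case using le by (meson add_right_mono order_trans)
    qed
    show "AE x in lborel. (\<lambda>i. ennreal \<bar>enn2real (J A (X i) u x) - ?q x\<bar>) \<longlonglongrightarrow> 0"
      using AE_J_tendsto[OF \<omega>]
    proof eventually_elim
      case (elim x)
      have "(\<lambda>i. J A (X i) u x) \<longlonglongrightarrow> ennreal (?q x)" by (rule filterlim_compose[OF elim X0])
      then have E: "(\<lambda>i. enn2real (J A (X i) u x)) \<longlonglongrightarrow> ?q x"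
        by (rule tendsto_enn2real) (simp add: Q_nonneg)
      have "(\<lambda>i. \<bar>enn2real (J A (X i) u x) - ?q x\<bar>) \<longlonglongrightarrow> \<bar>?q x - ?q x\<bar>"
        by (rule tendsto_rabs[OF tendsto_diff[OF E tendsto_const]])
      from tendsto_ennrealI[OF this] show ?case by simp
    qed
  qed measurable
  then show "(\<lambda>i. NNINT x. ennreal \<bar>enn2real (J A (X i) u x) - ?q x\<bar>) \<longlonglongrightarrow> 0" by simp
qed

end

section \<open>Borel representatives\<close>

text \<open>Completeness of Lebesgue measure.\<close>

lemma borel_measurable_lebesgue_cong_AE:
  fixes f f' :: "'a::euclidean_space \<Rightarrow> ennreal"
  assumes f': "f' \<in> borel_measurable lebesgue" and eq: "AE x in lebesgue. f x = f' x"
  shows "f \<in> borel_measurable lebesgue"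
proof (rule borel_measurableI_greater)
  fix y
  have S: "{x \<in> space lebesgue. y < f' x} \<in> sets lebesgue" using f' by measurable
  have AE: "AE x in lebesgue. x \<in> {x \<in> space lebesgue. y < f' x} \<longleftrightarrow> x \<in> {x \<in> space lebesgue. y < f x}"
    using eq by eventually_elim simp
  show "{x \<in> space lebesgue. y < f x} \<in> sets lebesgue"
    by (rule completion.in_sets_AE[OF AE S]) blast
qed

lemma lebesgue_measurable_ex_borel_complex:
  fixes f :: "'a::euclidean_space \<Rightarrow> complex"
  assumes f: "f \<in> borel_measurable lebesgue"
  shows "\<exists>f'\<in>borel_measurable borel. AE x in lborel. f x = f' x"
proof -
  obtain r where r: "r \<in> borel_measurable borel" "AE x in lborel. Re (f x) = r x"
    using completion_ex_borel_measurable_real[of "\<lambda>x. Re (f x)" lborel] f by auto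
  obtain i where i: "i \<in> borel_measurable borel" "AE x in lborel. Im (f x) = i x"
    using completion_ex_borel_measurable_real[of "\<lambda>x. Im (f x)" lborel] f by auto
  note [measurable] = r(1) i(1)
  show ?thesis
  proof (intro bexI[of _ "\<lambda>x. complex_of_real (r x) + \<i> * complex_of_real (i x)"])
    show "AE x in lborel. f x = complex_of_real (r x) + \<i> * complex_of_real (i x)"
      using r(2) i(2) by eventually_elim (simp add: complex_eq_iff)
  qed measurable
qed

lemma locally_integrable_borel_measurable:
  fixes f :: "real^'n \<Rightarrow> complex"
  assumes "locally_integrable f" shows "f \<in> borel_measurable lebesgue"
proof (rule borel_measurable_LIMSEQ_metric)
  show "(\<lambda>x. indicator (cball 0 (real n)) x *\<^sub>R f x) \<in> borel_measurable lebesgue" for n :: nat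
    using assms unfolding locally_integrable_def set_integrable_def by (auto intro: borel_measurable_integrable)
  fix x :: "real^'n"
  obtain n :: nat where n: "norm x \<le> real n" using real_arch_simple by blast
  show "(\<lambda>n. indicator (cball 0 (real n)) x *\<^sub>R f x) \<longlonglongrightarrow> f x"
  proof (rule tendsto_eventually)
    show "\<forall>\<^sub>F n in sequentially. indicator (cball 0 (real n)) x *\<^sub>R f x = f x"
      using eventually_ge_at_top[of n] by eventually_elim (use n in auto)
  qed
qed

lemma locally_integrable_cong_AE:
  fixes f f' :: "real^'n \<Rightarrow> complex"
  assumes "locally_integrable f" and [measurable]: "f' \<in> borel_measurable borel" and eq: "AE x in lebesgue. f x = f' x"
  shows "locally_integrable f'"
  unfolding locally_integrable_def
proof (intro allI impI)
  fix K :: "(real^'n) set" assume K: "compact K"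
  have int: "integrable lebesgue (\<lambda>x. indicator K x *\<^sub>R f x)"
    using assms(1) K by (simp add: locally_integrable_def set_integrable_def)
  have [measurable]: "K \<in> sets borel" using K by (simp add: borel_compact)
  have m: "(\<lambda>x. indicator K x *\<^sub>R f' x) \<in> borel_measurable lebesgue" by (rule measurable_completion) measurable
  show "set_integrable lebesgue K f'"
    unfolding set_integrable_def
  proof (rule integrable_cong_AE_imp[OF int m])
    show "AE x in lebesgue. indicator K x *\<^sub>R f x = indicator K x *\<^sub>R f' x"
      using eq by eventually_elim simp
  qed
qed

lemma continuous_partial_test_function:
  assumes "test_function \<phi>"
  shows "continuous_on UNIV \<phi>" "continuous_on UNIV (partial_deriv j \<phi>)"
proof -
  have "C_k 0 \<phi>" "C_k (Suc 0) \<phi>" using assms unfolding test_function_def by blast+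
  then show "continuous_on UNIV \<phi>" "continuous_on UNIV (partial_deriv j \<phi>)" by auto
qed

lemma weak_gradient_cong_AE:
  fixes u :: "real^'n \<Rightarrow> complex"
  assumes wg: "weak_gradient u g"
    and [measurable]: "u' \<in> borel_measurable borel" "g' \<in> borel_measurable borel"
    and u: "AE x in lebesgue. u x = u' x" and g: "AE x in lebesgue. g x = g' x"
  shows "weak_gradient u' g'"
proof -
  have li: "locally_integrable u" "\<And>j. locally_integrable (\<lambda>x. g x $ j)" using wg by (auto simp: weak_gradient_def)
  have gj: "AE x in lebesgue. g x $ j = g' x $ j" for j using g by eventually_elim simp
  have li': "locally_integrable u'" "\<And>j. locally_integrable (\<lambda>x. g' x $ j)"
    using locally_integrable_cong_AE[OF li(1) _ u] locally_integrable_cong_AE[OF li(2) _ gj] by auto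
  note [measurable] = li[THEN locally_integrable_borel_measurable] li'[THEN locally_integrable_borel_measurable]
  have "(\<integral>x. partial_deriv j \<phi> x *\<^sub>R u' x \<partial>lebesgue) = - (\<integral>x. \<phi> x *\<^sub>R (g' x $ j) \<partial>lebesgue)" if \<phi>: "test_function \<phi>" for \<phi> j
  proof -
    have [measurable]: "\<phi> \<in> borel_measurable lebesgue" "partial_deriv j \<phi> \<in> borel_measurable lebesgue"
      using continuous_partial_test_function[OF \<phi>]
      by (auto intro!: measurable_completion borel_measurable_continuous_onI)
    have "(\<integral>x. partial_deriv j \<phi> x *\<^sub>R u' x \<partial>lebesgue) = (\<integral>x. partial_deriv j \<phi> x *\<^sub>R u x \<partial>lebesgue)"
      using u by (intro integral_cong_AE) (auto elim: eventually_mono)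
    also have "\<dots> = - (\<integral>x. \<phi> x *\<^sub>R (g x $ j) \<partial>lebesgue)" using wg \<phi> by (simp add: weak_gradient_def)
    also have "(\<integral>x. \<phi> x *\<^sub>R (g x $ j) \<partial>lebesgue) = (\<integral>x. \<phi> x *\<^sub>R (g' x $ j) \<partial>lebesgue)"
      using gj[of j] by (intro integral_cong_AE) (auto elim: eventually_mono)
    finally show ?thesis .
  qed
  with li' show ?thesis by (auto simp: weak_gradient_def)
qed

lemma weak_gradient_ex_borel:
  fixes u :: "real^'n \<Rightarrow> complex"
  assumes wg: "weak_gradient u g"
  shows "\<exists>g'\<in>borel_measurable borel. AE x in lborel. g x = g' x"
proof -
  have "\<exists>h\<in>borel_measurable borel. AE x in lborel. g x $ j = h x" for j
    using wg by (intro lebesgue_measurable_ex_borel_complex locally_integrable_borel_measurable) (simp add: weak_gradient_def)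
  then obtain h where h: "\<And>j. h j \<in> borel_measurable borel" "\<And>j. AE x in lborel. g x $ j = h j x" by metis
  show ?thesis
  proof (intro bexI[of _ "\<lambda>x. \<chi> j. h j x"])
    have "AE x in lborel. \<forall>j\<in>UNIV. g x $ j = h j x" by (rule AE_finite_allI) (auto intro: h)
    then show "AE x in lborel. g x = (\<chi> j. h j x)" by eventually_elim (simp add: vec_eq_iff)
    have "(\<lambda>x. (\<chi> j. h j x) \<bullet> b) \<in> borel_measurable borel" if b: "b \<in> Basis" for b
    proof -
      obtain j c where "b = axis j c" using b unfolding Basis_vec_def by blast
      then show ?thesis using h(1) by (simp add: inner_axis)
    qed
    then show "(\<lambda>x. \<chi> j. h j x) \<in> borel_measurable borel"
      by (subst borel_measurable_euclidean_space) blast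
  qed
qed

text \<open>The gradient that witnesses membership in the energy space and the given one need not be the same
  function; they agree almost everywhere.\<close>

lemma weak_gradient_unique:
  fixes u :: "real^'n \<Rightarrow> complex"
  assumes [measurable]: "g \<in> borel_measurable borel" "h \<in> borel_measurable borel"
    and g: "weak_gradient u g" and h: "weak_gradient u h"
  shows "AE x in lborel. g x = h x"
proof -
  have "AE x in lborel. g x $ j - h x $ j = 0" for j
  proof (rule loc_int_AE_zero_of_box_bump)
    have li: "loc_int (\<lambda>x. g x $ j)" "loc_int (\<lambda>x. h x $ j)"
      using g h by (auto intro!: locally_integrable_imp_loc_int simp: weak_gradient_def)
    then show "loc_int (\<lambda>x. g x $ j - h x $ j)" by (intro loc_int_diff) auto
    fix a b :: "real^'n" and n assume ne: "box a b \<noteq> {}"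
    let ?\<phi> = "box_bump a b n"
    have "(\<integral>x. partial_deriv j ?\<phi> x *\<^sub>R u x \<partial>lebesgue) = - (\<integral>x. ?\<phi> x *\<^sub>R (g x $ j) \<partial>lebesgue)"
      "(\<integral>x. partial_deriv j ?\<phi> x *\<^sub>R u x \<partial>lebesgue) = - (\<integral>x. ?\<phi> x *\<^sub>R (h x $ j) \<partial>lebesgue)"
      using g h test_function_box_bump[OF ne, of n] unfolding weak_gradient_def by blast+
    then have "(\<integral>x. ?\<phi> x *\<^sub>R (g x $ j) \<partial>lebesgue) = (\<integral>x. ?\<phi> x *\<^sub>R (h x $ j) \<partial>lebesgue)" by simp
    then have eq: "(LBINT x. ?\<phi> x *\<^sub>R (g x $ j)) = (LBINT x. ?\<phi> x *\<^sub>R (h x $ j))"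
      by (simp add: integral_completion)
    obtain R where R: "\<forall>x\<in>cbox a b. norm x \<le> R" using bounded_cbox[of a b] by (auto simp: bounded_iff)
    have int: "integrable lborel (\<lambda>x. ?\<phi> x *\<^sub>R k x)"
      if k: "loc_int k" and [measurable]: "k \<in> borel_measurable borel" for k :: "real^'n \<Rightarrow> complex"
    proof (rule loc_int_bounded_support(2)[OF k, where C=1 and R=R])
      show "norm (?\<phi> x *\<^sub>R k x) \<le> 1 * norm (k x)" for x
        using box_bump_bounds[of a b n x] by (simp add: mult_left_le_one_le)
      show "?\<phi> x *\<^sub>R k x = 0" if "R < norm x" for x
      proof -
        have "x \<notin> box a b" using R that box_subset_cbox[of a b] by force
        then show ?thesis by (simp add: box_bump_outside[OF ne])
      qed
    qed measurable
    show "(LBINT x. ?\<phi> x *\<^sub>R (g x $ j - h x $ j)) = 0"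
      using eq int[OF li(1)] int[OF li(2)] by (simp add: scaleR_diff_right)
  qed measurable
  then have "AE x in lborel. \<forall>j\<in>UNIV. g x $ j - h x $ j = 0" by (intro AE_finite_allI) auto
  then show ?thesis by eventually_elim (simp add: vec_eq_iff)
qed

lemma J_cong_AE:
  fixes u u' :: "real^'n \<Rightarrow> complex"
  assumes eq: "AE y in lebesgue. u y = u' y" and "u x = u' x"
  shows "J A \<delta> u x = J A \<delta> u' x"
  unfolding J_def using eq assms(2)
  by (intro nn_integral_cong_AE) (auto elim!: eventually_mono simp: Psi_def split: split_indicator)

theorem proposition4p2:
  fixes A :: "real^'n \<Rightarrow> real^'n"
    and u :: "real^'n \<Rightarrow> complex"
    and grad_u :: "real^'n \<Rightarrow> complex^'n"
    and \<omega> :: "real^'n"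
  assumes "\<exists>L. L-lipschitz_on UNIV A"
    and "u \<in> H1A A"
    and "weak_gradient u grad_u"
    and "norm \<omega> = 1"
  shows "(AE x in lebesgue.
            ((\<lambda>\<delta>. J A \<delta> u x) \<longlongrightarrow>
               ennreal (Q \<omega> * (norm (magnetic_grad A u grad_u x))\<^sup>2)) (at_right 0))
       \<and> ((\<forall>\<delta>>0. J A \<delta> u \<in> borel_measurable lebesgue \<and>
                  (\<integral>\<^sup>+x. J A \<delta> u x \<partial>lebesgue) < \<infinity>)
        \<and> integrable lebesgue (\<lambda>x. Q \<omega> * (norm (magnetic_grad A u grad_u x))\<^sup>2)
        \<and> ((\<lambda>\<delta>. \<integral>\<^sup>+x. ennreal \<bar>enn2real (J A \<delta> u x)
                        - Q \<omega> * (norm (magnetic_grad A u grad_u x))\<^sup>2\<bar> \<partial>lebesgue)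
             \<longlongrightarrow> 0) (at_right 0))"
proof -
  let ?D = "magnetic_grad A u grad_u"
  obtain L where L: "L-lipschitz_on UNIV A" using assms(1) by blast
  obtain h where u_meas: "u \<in> borel_measurable lebesgue" and u2: "integrable lebesgue (\<lambda>x. (norm (u x))\<^sup>2)"
    and h: "weak_gradient u h" "integrable lebesgue (\<lambda>x. (norm (magnetic_grad A u h x))\<^sup>2)"
    using assms(2) unfolding H1A_def by blast
  obtain v where v[measurable]: "v \<in> borel_measurable borel" and uv: "AE x in lborel. u x = v x"
    using lebesgue_measurable_ex_borel_complex[OF u_meas] by blast
  obtain g where g[measurable]: "g \<in> borel_measurable borel" and ug: "AE x in lborel. grad_u x = g x"
    using weak_gradient_ex_borel[OF assms(3)] by blast
  obtain k where k[measurable]: "k \<in> borel_measurable borel" and hk: "AE x in lborel. h x = k x"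
    using weak_gradient_ex_borel[OF h(1)] by blast
  note lebesgue = AE_completion
  have wg: "weak_gradient v g"
    by (rule weak_gradient_cong_AE[OF assms(3) v g lebesgue[OF uv] lebesgue[OF ug]])
  \<comment> \<open>By uniqueness of weak gradients the energy is finite also for the given gradient.\<close>
  have "weak_gradient v k"
    by (rule weak_gradient_cong_AE[OF h(1) v k lebesgue[OF uv] lebesgue[OF hk]])
  then have gk: "AE x in lborel. g x = k x" by (rule weak_gradient_unique[OF g k wg])
  have Dh: "AE x in lborel. magnetic_grad A u h x = magnetic_grad A v g x"
    using uv hk gk by eventually_elim (simp add: magnetic_grad_def)
  have Du: "AE x in lborel. ?D x = magnetic_grad A v g x"
    using uv ug by eventually_elim (simp add: magnetic_grad_def)
  have v2: "(NNINT x. ennreal ((norm (v x))\<^sup>2)) < \<infinity>"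
  proof -
    have "(NNINT x. ennreal ((norm (v x))\<^sup>2)) = (\<integral>\<^sup>+x. ennreal ((norm (v x))\<^sup>2) \<partial>lebesgue)"
      by (rule nn_integral_completion[symmetric])
    also have "\<dots> = (\<integral>\<^sup>+x. ennreal ((norm (u x))\<^sup>2) \<partial>lebesgue)"
      using lebesgue[OF uv] by (intro nn_integral_cong_AE) (auto elim: eventually_mono)
    also have "\<dots> < \<infinity>" using u2 by (simp add: integrable_iff_bounded)
    finally show ?thesis .
  qed
  have D2: "(NNINT x. ennreal ((norm (magnetic_grad A v g x))\<^sup>2)) < \<infinity>"
  proof -
    have "(NNINT x. ennreal ((norm (magnetic_grad A v g x))\<^sup>2)) = (\<integral>\<^sup>+x. ennreal ((norm (magnetic_grad A v g x))\<^sup>2) \<partial>lebesgue)"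
      by (rule nn_integral_completion[symmetric])
    also have "\<dots> = (\<integral>\<^sup>+x. ennreal ((norm (magnetic_grad A u h x))\<^sup>2) \<partial>lebesgue)"
      using lebesgue[OF Dh] by (intro nn_integral_cong_AE) (auto elim: eventually_mono)
    also have "\<dots> < \<infinity>" using h(2) by (simp add: integrable_iff_bounded)
    finally show ?thesis .
  qed
  interpret borel_magnetic A L v g
    by unfold_locales (fact L v g wg v2 D2)+
  have Jeq: "AE x in lebesgue. \<forall>\<delta>. J A \<delta> u x = J A \<delta> v x"
    using lebesgue[OF uv] by eventually_elim (use J_cong_AE[OF lebesgue[OF uv]] in blast)
  note Du = lebesgue[OF Du]
  show ?thesis
  proof (intro conjI allI impI)
    show "AE x in lebesgue. ((\<lambda>\<delta>. J A \<delta> u x) \<longlongrightarrow>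
        ennreal (Q \<omega> * (norm (?D x))\<^sup>2)) (at_right 0)"
      using lebesgue[OF AE_J_tendsto[OF assms(4)]] Jeq Du by eventually_elim simp
  next
    fix \<delta> :: real assume \<delta>: "\<delta> > 0"
    have J: "AE x in lebesgue. J A \<delta> u x = J A \<delta> v x" using Jeq by eventually_elim simp
    show "J A \<delta> u \<in> borel_measurable lebesgue"
      by (rule borel_measurable_lebesgue_cong_AE[OF _ J]) (intro measurable_completion, use J_borel[OF \<delta>] in simp)
    have "(\<integral>\<^sup>+x. J A \<delta> u x \<partial>lebesgue) = (\<integral>\<^sup>+x. J A \<delta> v x \<partial>lebesgue)" by (rule nn_integral_cong_AE[OF J])
    then show "(\<integral>\<^sup>+x. J A \<delta> u x \<partial>lebesgue) < \<infinity>"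
      using J_integral_finite[OF \<delta>] by (simp add: nn_integral_completion)
  next
    have "integrable lborel (\<lambda>x. (norm (D x))\<^sup>2)"
      using D2 by (intro integrableI_bounded) auto
    then have "integrable lborel (\<lambda>x. Q \<omega> * (norm (D x))\<^sup>2)" by (rule integrable_mult_right)
    then have int: "integrable lebesgue (\<lambda>x. Q \<omega> * (norm (D x))\<^sup>2)"
      by (subst integrable_completion) auto
    show "integrable lebesgue (\<lambda>x. Q \<omega> * (norm (?D x))\<^sup>2)"
    proof (rule integrable_cong_AE_imp[OF int])
      have "AE x in lebesgue. ennreal (Q \<omega> * (norm (?D x))\<^sup>2) = ennreal (Q \<omega> * (norm (D x))\<^sup>2)"
        using Du by eventually_elim simp
      then have "(\<lambda>x. ennreal (Q \<omega> * (norm (?D x))\<^sup>2)) \<in> borel_measurable lebesgue"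
        by (rule borel_measurable_lebesgue_cong_AE[rotated]) (intro measurable_completion, measurable)
      then have "(\<lambda>x. enn2real (ennreal (Q \<omega> * (norm (?D x))\<^sup>2))) \<in> borel_measurable lebesgue"
        by measurable
      then show "(\<lambda>x. Q \<omega> * (norm (?D x))\<^sup>2) \<in> borel_measurable lebesgue"
        by (simp add: Q_nonneg)
      show "AE x in lebesgue. Q \<omega> * (norm (D x))\<^sup>2 = Q \<omega> * (norm (?D x))\<^sup>2"
        using Du by eventually_elim simp
    qed
  next
    have "(\<integral>\<^sup>+x. ennreal \<bar>enn2real (J A \<delta> u x) - Q \<omega> * (norm (?D x))\<^sup>2\<bar> \<partial>lebesgue)
      = (\<integral>\<^sup>+x. ennreal \<bar>enn2real (J A \<delta> v x) - Q \<omega> * (norm (D x))\<^sup>2\<bar> \<partial>lebesgue)" for \<delta>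
    proof (rule nn_integral_cong_AE)
      show "AE x in lebesgue. ennreal \<bar>enn2real (J A \<delta> u x) - Q \<omega> * (norm (?D x))\<^sup>2\<bar>
        = ennreal \<bar>enn2real (J A \<delta> v x) - Q \<omega> * (norm (D x))\<^sup>2\<bar>"
        using Jeq Du by eventually_elim simp
    qed
    then show "((\<lambda>\<delta>. \<integral>\<^sup>+x. ennreal \<bar>enn2real (J A \<delta> u x) - Q \<omega> * (norm (?D x))\<^sup>2\<bar> \<partial>lebesgue) \<longlongrightarrow> 0) (at_right 0)"
      using J_tendsto_L1[OF assms(4)] by (simp only: nn_integral_completion)
  qed
qed

end
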